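(* There exist constants $C_{PH}>0$ and $R_1>0$ such that for every $R\ge R_1$, every $z\in\mathbb{Z}^d$ and every non-negative bounded function $q$ on $\mathbb{N}_0\times\mathbb{Z}^d$ which is parabolic on the set $\{0,1,2,\dots,\lfloor\gamma/\phi((\sqrt b\,R)^{-2})\rfloor\}\times\mathbb{Z}^d$, the following inequality holds: $$\max_{(k,y)\in Q(\lfloor\gamma/\phi(R^{-2})\rfloor,\,z,\,R/B)}q(k,y)\le C_{PH}\min_{w\in B(z,R/B)}q(0,w).$$
   Context: Let $d\ge 1$ and let $(S_n)_{n\ge0}$ be the simple symmetric random walk on $\mathbb{Z}^d$ (each step is uniform on $\{\pm e_1,\dots,\pm e_d\}$). Let $\phi$ be a complete Bernstein function without drift, normalized by $\phi(0)=0$, $\phi(1)=1$; i.e. $\phi(\lambda)=\int_{(0,\infty)}(1-e^{-\lambda t})\,\mu(dt)$, where $\mu$ is a measure with $\int_{(0,\infty)}(1\wedge t)\,\mu(dt)<\infty$ having a completely monotone density with respect to Lebesgue measure. Assume the scaling condition: there are (fixed) constants $c_*,c^*>0$ and $0<\alpha_*\le\alpha^*<1$ with $$c_*\Big(\frac Rr\Big)^{\alpha_*}\le\frac{\phi(R)}{\phi(r)}\le c^*\Big(\frac Rr\Big)^{\alpha^*},\qquad 0<r\le R\le1 .$$ Put $a_m^\phi=\frac1{m!}\int_{(0,\infty)}t^me^{-t}\,\mu(dt)$, $m\ge1$; then $\sum_{m\ge1}a_m^\phi=1$. Let $R_1',R_2',\dots$ be i.i.d., independent of $(S_n)$, with $\mathbb{P}(R_1'=m)=a_m^\phi$,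 and $\tau_n=R_1'+\cdots+R_n'$. The subordinate random walk is $S^\phi_n=S_{\tau_n}$, $n\ge0$; $\mathbb{P}^x$ is the law of the walk started at $x$. For $x\in\mathbb{R}^d$, $r>0$: $B(x,r)=\{y\in\mathbb{Z}^d:|y-x|<r\}$ (Euclidean norm). Fix a constant $\gamma\in(0,1)$ such that $\mathbb{P}^x\big(\max_{k\le\lfloor\gamma/\phi(r^{-2})\rfloor}|S^\phi_k-x|\ge r/2\big)\le1/4$ for all $x\in\mathbb{Z}^d$, $r>0$ (such $\gamma$ exists). Define $$B=3\vee(2/c_* )^{1/(2\alpha_* )},\qquad b=3\vee\big(\lfloor(3/c_* )^{1/\alpha_*}\rfloor+1\big),$$ $$Q(k,x,r)=\{k,k+1,\dots,k+\lfloor\gamma/\phi(r^{-2})\rfloor\}\times B(x,r),\qquad a\vee b=\max\{a,b\}.$$ (The constant $B$ and the ball $B(x,r)$ are distinguished by context.) Consider the Markov chain $(V_k,S^\phi_k)_{k\ge0}$ on $\mathbb{N}_0\times\mathbb{Z}^d$, where $V_k=V_0+k$; $\mathbb{P}^{(j,x)}$ is its law started at $(j,x)$ and $\mathcal{F}_k=\sigma\{(V_l,S^\phi_l):l\le k\}$. A bounded function $q$ on $\mathbb{N}_0\times\mathbb{Z}^d$ is called parabolic on $D\subseteq\mathbb{N}_0\times\mathbb{Z}^d$ if $q(V_{k\wedge\tau_D},S^\phi_{k\wedge\tau_D})$, $k\ge0$, is a martingale (for every starting point, with respect to $(\mathcal{F}_k)$), where $\tau_D=\min\{k\ge 0:(V_k,S^\phi_k)\notin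 D\}$. The constants $C_{PH},R_1$ depend only on $\phi$ and $d$ (and the fixed constants $\gamma,c_*,c^*,\alpha_*,\alpha^*$). *)

theory Defs
  imports "HOL-Probability.Probability"
begin

section \<open>Complete Bernstein functions without drift\<close>

definition completely_monotone :: "(real \<Rightarrow> real) \<Rightarrow> bool" where
  "completely_monotone m \<longleftrightarrow>
     (\<forall>n. \<forall>t>0. (deriv ^^ n) m field_differentiable at t \<and> 0 \<le> (-1) ^ n * (deriv ^^ n) m t)"

text \<open>The Levy measure \<open>\<mu>\<close> on \<open>(0,\<infinity>)\<close> is rendered as a Borel measure on the real line that
  vanishes off \<open>(0,\<infinity>)\<close>. Only the values of the density \<open>m\<close> at positive arguments matter.\<close>

definition complete_Bernstein_no_drift :: "(real \<Rightarrow> real) \<Rightarrow> real measure \<Rightarrow> bool" where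
  "complete_Bernstein_no_drift \<phi> \<mu> \<longleftrightarrow>
     (\<exists>m. completely_monotone m \<and>
          \<mu> = density lborel (\<lambda>t. ennreal (m t) * indicator {0<..} t)) \<and>
     (\<integral>\<^sup>+t\<in>{0<..}. ennreal (min 1 t) \<partial>\<mu>) < \<infinity> \<and>
     (\<forall>u\<ge>0. \<phi> u = (LINT t:{0<..}|\<mu>. 1 - exp (- u * t)))"

section \<open>The subordinated random walk\<close>

definition jump_weight :: "real measure \<Rightarrow> nat \<Rightarrow> real" where
  "jump_weight \<mu> m = (LINT t:{0<..}|\<mu>. t ^ m * exp (- t)) / fact m"

text \<open>The law of \<open>R'\<close>; see \<open>pmf_subordinator_jump\<close> below for its well-definedness.\<close>

definition subordinator_jump :: "real measure \<Rightarrow> nat pmf" where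
  "subordinator_jump \<mu> = embed_pmf (\<lambda>m. if m = 0 then 0 else jump_weight \<mu> m)"

text \<open>\<open>\<int>\<^sup>d\<close> is the type \<open>int ^ 'n\<close> with \<open>d = CARD('n)\<close>.\<close>

definition srw_step :: "(int ^ 'n) pmf" where
  "srw_step = pmf_of_set (range (\<lambda>i. axis i 1) \<union> range (\<lambda>i. axis i (- 1)))"

text \<open>Canonical space carrying the i.i.d. steps of the simple random walk and, independently of
  them, the i.i.d. steps of the subordinator; the sequences are indexed from \<open>0\<close>.\<close>

definition step_space :: "real measure \<Rightarrow> ((nat \<Rightarrow> int ^ 'n) \<times> (nat \<Rightarrow> nat)) measure" where
  "step_space \<mu> = (\<Pi>\<^sub>M i\<in>UNIV. measure_pmf srw_step) \<Otimes>\<^sub>M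
                    (\<Pi>\<^sub>M i\<in>UNIV. measure_pmf (subordinator_jump \<mu>))"

definition subordinated_walk ::
    "(nat \<Rightarrow> int ^ 'n) \<times> (nat \<Rightarrow> nat) \<Rightarrow> nat \<Rightarrow> int ^ 'n" where
  "subordinated_walk = (\<lambda>(\<xi>, \<rho>) k. \<Sum>i<(\<Sum>j<k. \<rho> j). \<xi> i)"

definition path_space :: "(nat \<Rightarrow> 'a) measure" where
  "path_space = (\<Pi>\<^sub>M k\<in>UNIV. count_space UNIV)"

text \<open>The path laws \<open>\<P>\<^sup>x\<close> of the walk and \<open>\<P>\<^sup>(\<^sup>j\<^sup>,\<^sup>x\<^sup>)\<close> of the space-time chain.\<close>

definition walk_law :: "real measure \<Rightarrow> int ^ 'n \<Rightarrow> (nat \<Rightarrow> int ^ 'n) measure" where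
  "walk_law \<mu> x = distr (step_space \<mu>) path_space (\<lambda>\<omega> k. x + subordinated_walk \<omega> k)"

definition chain_law ::
    "real measure \<Rightarrow> nat \<times> (int ^ 'n) \<Rightarrow> (nat \<Rightarrow> nat \<times> (int ^ 'n)) measure" where
  "chain_law \<mu> = (\<lambda>(j, x). distr (walk_law \<mu> x) path_space (\<lambda>s k. (j + k, s k)))"

section \<open>Parabolic functions\<close>

definition martingale ::
    "'a measure \<Rightarrow> (nat \<Rightarrow> 'a measure) \<Rightarrow> (nat \<Rightarrow> 'a \<Rightarrow> real) \<Rightarrow> bool" where
  "martingale M F X \<longleftrightarrow>
     filtration (space M) F \<and> (\<forall>k. subalgebra M (F k)) \<and>
     (\<forall>k. X k \<in> borel_measurable (F k)) \<and>
     (\<forall>k. integrable M (X k)) \<and>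
     (\<forall>k l. k \<le> l \<longrightarrow> (AE \<omega> in M. real_cond_exp M (F k) (X l) \<omega> = X k \<omega>))"

definition path_filtration :: "nat \<Rightarrow> (nat \<Rightarrow> 'a) measure" where
  "path_filtration k = sigma UNIV {{p. p l \<in> A} | l A. l \<le> k}"

text \<open>The exit time is \<open>\<infinity>\<close> for paths that never leave \<open>D\<close>.\<close>

definition exit_time :: "'a set \<Rightarrow> (nat \<Rightarrow> 'a) \<Rightarrow> enat" where
  "exit_time D p = Inf (enat ` {k. p k \<notin> D})"

definition parabolic ::
    "real measure \<Rightarrow> (nat \<times> (int ^ 'n)) set \<Rightarrow> (nat \<times> (int ^ 'n) \<Rightarrow> real) \<Rightarrow> bool" where
  "parabolic \<mu> D q \<longleftrightarrow>
     (\<forall>start. martingale (chain_law \<mu> start) path_filtration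
        (\<lambda>k p. q (p (the_enat (min (enat k) (exit_time D p))))))"

section \<open>Balls, cylinders and constants\<close>

definition real_vec :: "int ^ 'n \<Rightarrow> real ^ 'n" where
  "real_vec x = (\<chi> i. real_of_int (x $ i))"

definition lattice_ball :: "real ^ 'n \<Rightarrow> real \<Rightarrow> (int ^ 'n) set" where
  "lattice_ball x r = {y. norm (real_vec y - x) < r}"

definition time_scale :: "(real \<Rightarrow> real) \<Rightarrow> real \<Rightarrow> real \<Rightarrow> nat" where
  "time_scale \<phi> \<gamma> r = nat \<lfloor>\<gamma> / \<phi> (r powi (- 2))\<rfloor>"

definition cylinder ::
    "(real \<Rightarrow> real) \<Rightarrow> real \<Rightarrow> nat \<Rightarrow> real ^ 'n \<Rightarrow> real \<Rightarrow> (nat \<times> (int ^ 'n)) set" where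
  "cylinder \<phi> \<gamma> k x r = {k..k + time_scale \<phi> \<gamma> r} \<times> lattice_ball x r"

definition const_B :: "real \<Rightarrow> real \<Rightarrow> real" where
  "const_B c \<alpha> = max 3 ((2 / c) powr (1 / (2 * \<alpha>)))"

definition const_b :: "real \<Rightarrow> real \<Rightarrow> int" where
  "const_b c \<alpha> = max 3 (\<lfloor>(3 / c) powr (1 / \<alpha>)\<rfloor> + 1)"

section \<open>Well-definedness\<close>

lemma jump_weight_nonneg: "0 \<le> jump_weight \<mu> m"
  unfolding jump_weight_def set_lebesgue_integral_def
  by (intro divide_nonneg_nonneg Bochner_Integration.integral_nonneg) (auto simp: indicator_def)

lemma pmf_subordinator_jump:
  assumes \<phi>: "complete_Bernstein_no_drift \<phi> \<mu>" and one: "\<phi> 1 = 1"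
  shows "pmf (subordinator_jump \<mu>) m = (if m = 0 then 0 else jump_weight \<mu> m)"
proof -
  have [measurable_cong]: "sets \<mu> = sets borel"
    using \<phi> unfolding complete_Bernstein_no_drift_def by auto
  define g where "g = (\<lambda>m t. indicator {0<..} t * (t ^ m * exp (- t)) / fact m :: real)"
  define h where "h = (\<lambda>t. indicator {0<..} t * (1 - exp (- t)) :: real)"
  have g0: "0 \<le> g m t" for m t by (auto simp: g_def indicator_def)
  have gm: "g m \<in> borel_measurable \<mu>" for m unfolding g_def by measurable
  have h0: "0 \<le> h t" for t by (auto simp: h_def indicator_def)
  have h1: "(\<integral>t. h t \<partial>\<mu>) = 1"
  proof -
    have "\<phi> 1 = (LINT t:{0<..}|\<mu>. 1 - exp (- 1 * t))"
      using \<phi> unfolding complete_Bernstein_no_drift_def by simp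
    then show ?thesis using one by (simp add: set_lebesgue_integral_def h_def)
  qed
  have hint: "integrable \<mu> h"
    using h1 not_integrable_integral_eq by fastforce
  have hnn: "(\<integral>\<^sup>+t. ennreal (h t) \<partial>\<mu>) = 1"
    using nn_integral_eq_integral[OF hint] h1 h0 by simp
  have sums: "(\<lambda>m. g (Suc m) t) sums h t" for t
  proof -
    have "(\<lambda>m. t ^ m / fact m) sums exp t"
      using exp_converges[of t] by (simp add: divide_inverse mult.commute)
    then have "(\<lambda>m. t ^ Suc m / fact (Suc m)) sums (exp t - 1)"
      by (subst sums_Suc_iff) simp
    then have "(\<lambda>m. indicator {0<..} t * exp (- t) * (t ^ Suc m / fact (Suc m))) sums
        (indicator {0<..} t * exp (- t) * (exp t - 1))"
      by (rule sums_mult)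
    moreover have "indicator {0<..} t * exp (- t) * (exp t - 1) = h t"
      by (simp add: h_def algebra_simps flip: exp_add)
    moreover have "indicator {0<..} t * exp (- t) * (t ^ Suc m / fact (Suc m)) = g (Suc m) t" for m
      unfolding g_def times_divide_eq_right by (simp only: mult.assoc mult.commute mult.left_commute)
    ultimately show ?thesis by simp
  qed
  have gh: "ennreal (h t) = (\<Sum>m. ennreal (g (Suc m) t))" for t
    using suminf_ennreal2[OF g0 sums_summable[OF sums]] sums_unique[OF sums] by simp
  have tot: "(\<Sum>m. \<integral>\<^sup>+t. ennreal (g (Suc m) t) \<partial>\<mu>) = 1"
    unfolding hnn[symmetric] gh by (rule nn_integral_suminf[symmetric]) (use gm in simp)
  have fin: "(\<integral>\<^sup>+t. ennreal (g (Suc m) t) \<partial>\<mu>) < \<infinity>" for m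
  proof -
    have "(\<integral>\<^sup>+t. ennreal (g (Suc m) t) \<partial>\<mu>) \<le> (\<Sum>m. \<integral>\<^sup>+t. ennreal (g (Suc m) t) \<partial>\<mu>)"
      using sum_le_suminf[of "\<lambda>m. \<integral>\<^sup>+t. ennreal (g (Suc m) t) \<partial>\<mu>" "{m}"] by simp
    then show ?thesis unfolding tot by (rule le_less_trans) simp
  qed
  have gint: "integrable \<mu> (g (Suc m))" for m
    by (rule integrableI_nonneg[OF gm AE_I2[OF g0] fin])
  have "jump_weight \<mu> m = (\<integral>t. g m t \<partial>\<mu>)" for m
    unfolding jump_weight_def set_lebesgue_integral_def real_scaleR_def g_def
    by (rule Bochner_Integration.integral_divide_zero[symmetric])
  then have w: "ennreal (jump_weight \<mu> (Suc m)) = (\<integral>\<^sup>+t. ennreal (g (Suc m) t) \<partial>\<mu>)" for m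
    using nn_integral_eq_integral[OF gint] g0 by simp
  define f where "f m = (if m = 0 then 0 else jump_weight \<mu> m)" for m
  have "(\<integral>\<^sup>+m. ennreal (f m) \<partial>count_space UNIV) = (\<Sum>m. ennreal (f m))"
    by (rule nn_integral_count_space_nat)
  also have "\<dots> = (\<Sum>m. ennreal (f (Suc m)))"
    using suminf_offset[OF summableI, of "\<lambda>m. ennreal (f m)" 1] by (simp add: f_def)
  also have "\<dots> = 1" unfolding tot[symmetric] by (simp add: w f_def)
  finally have "pmf (embed_pmf f) m = f m"
    by (intro pmf_embed_pmf) (auto simp: f_def jump_weight_nonneg)
  then show ?thesis by (simp add: subordinator_jump_def f_def[abs_def])
qed

lemma prob_space_step_space: "prob_space (step_space \<mu> :: ((nat \<Rightarrow> int ^ 'n) \<times> (nat \<Rightarrow> nat)) measure)"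
proof -
  interpret A: prob_space "\<Pi>\<^sub>M i\<in>(UNIV :: nat set). measure_pmf (srw_step :: (int ^ 'n) pmf)"
    by (rule prob_space_PiM) (rule prob_space_measure_pmf)
  interpret B: prob_space "\<Pi>\<^sub>M i\<in>(UNIV :: nat set). measure_pmf (subordinator_jump \<mu>)"
    by (rule prob_space_PiM) (rule prob_space_measure_pmf)
  interpret pair_prob_space "\<Pi>\<^sub>M i\<in>(UNIV :: nat set). measure_pmf (srw_step :: (int ^ 'n) pmf)"
    "\<Pi>\<^sub>M i\<in>(UNIV :: nat set). measure_pmf (subordinator_jump \<mu>)" ..
  show ?thesis unfolding step_space_def by (rule prob_space_axioms)
qed

lemma measurable_walk [measurable]:
  "(\<lambda>\<omega> k. x + subordinated_walk \<omega> k) \<in> measurable (step_space \<mu>) (path_space :: (nat \<Rightarrow> int ^ 'n) measure)"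
proof -
  have sets: "sets (step_space \<mu> :: ((nat \<Rightarrow> int ^ 'n) \<times> (nat \<Rightarrow> nat)) measure) =
      sets ((\<Pi>\<^sub>M i\<in>UNIV. count_space UNIV) \<Otimes>\<^sub>M (\<Pi>\<^sub>M i\<in>UNIV. count_space UNIV))"
    unfolding step_space_def by (intro sets_pair_measure_cong sets_PiM_cong) auto
  have X: "(\<lambda>\<omega>. \<Sum>i<n. fst \<omega> i) \<in> measurable (step_space \<mu>) (count_space (UNIV :: (int ^ 'n) set))" for n
  proof (induction n)
    case (Suc n)
    have [measurable]: "(\<lambda>\<omega>. fst \<omega> n) \<in> measurable (step_space \<mu>) (count_space (UNIV :: (int ^ 'n) set))"
      unfolding measurable_cong_sets[OF sets refl] by measurable
    note Suc [measurable]
    show ?case unfolding sum.lessThan_Suc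
      by (rule measurable_compose_countable[where g="\<lambda>\<omega>. fst \<omega> n"]) measurable
  qed simp
  have T: "(\<lambda>\<omega> :: (nat \<Rightarrow> int ^ 'n) \<times> (nat \<Rightarrow> nat). \<Sum>i<n. snd \<omega> i) \<in> measurable (step_space \<mu>) (count_space UNIV)" for n
    unfolding measurable_cong_sets[OF sets refl] by measurable
  have W: "(\<lambda>\<omega>. x + (\<Sum>i<(\<Sum>j<k. snd \<omega> j). fst \<omega> i)) \<in> measurable (step_space \<mu>) (count_space (UNIV :: (int ^ 'n) set))" for k
    by (rule measurable_compose_countable[OF _ T]) (rule measurable_compose[OF X], simp)
  show ?thesis
    unfolding path_space_def
    by (rule measurable_PiM_single') (use W in \<open>auto simp: subordinated_walk_def split_beta\<close>)
qed

lemma measurable_space_time [measurable]: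
  "(\<lambda>s k. (j + k, s k)) \<in> measurable path_space (path_space :: (nat \<Rightarrow> nat \<times> 'a) measure)"
  unfolding path_space_def
proof (rule measurable_PiM_single')
  show "(\<lambda>s. (j + k, s k)) \<in> measurable (\<Pi>\<^sub>M k\<in>UNIV. count_space UNIV) (count_space (UNIV :: (nat \<times> 'a) set))" for k
    by (rule measurable_compose[OF measurable_component_singleton]) auto
qed auto

lemma prob_space_walk_law: "prob_space (walk_law \<mu> x)"
  unfolding walk_law_def by (rule prob_space.prob_space_distr[OF prob_space_step_space]) measurable

lemma prob_space_chain_law: "prob_space (chain_law \<mu> start)"
proof -
  have "(\<lambda>s k. (j + k, s k)) \<in> measurable (walk_law \<mu> x) path_space" for j x
    unfolding walk_law_def by simp
  then show ?thesis
    unfolding chain_law_def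
    by (auto simp: split_beta intro!: prob_space.prob_space_distr[OF prob_space_walk_law])
qed

lemma path_filtration:
  fixes start :: "nat \<times> (int ^ 'b)"
  shows "filtration (space (chain_law \<mu> start)) path_filtration"
    and "subalgebra (chain_law \<mu> start) (path_filtration k)"
proof -
  have sp: "space (chain_law \<mu> start) = UNIV"
    by (auto simp: chain_law_def split_beta path_space_def space_PiM)
  have st: "sets (chain_law \<mu> start) = sets path_space"
    by (auto simp: chain_law_def split_beta)
  show "filtration (space (chain_law \<mu> start)) path_filtration"
    unfolding sp
  proof
    fix i j :: nat assume "i \<le> j"
    then have "{{p. p l \<in> A} | l A. l \<le> i} \<subseteq> {{p :: nat \<Rightarrow> nat \<times> (int ^ 'b). p l \<in> A} | l A. l \<le> j}"
      by (auto intro: order_trans)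
    then show "sets (path_filtration i :: (nat \<Rightarrow> nat \<times> (int ^ 'b)) measure) \<le> sets (path_filtration j)"
      by (simp add: path_filtration_def sigma_sets_mono')
  qed (simp add: path_filtration_def)
  have "{{p. p l \<in> A} | l A. l \<le> k} \<subseteq> sets (path_space :: (nat \<Rightarrow> nat \<times> (int ^ 'b)) measure)"
  proof safe
    fix l and A :: "(nat \<times> (int ^ 'b)) set"
    have "(\<lambda>p. p l) -` A \<inter> space path_space \<in> sets (path_space :: (nat \<Rightarrow> nat \<times> (int ^ 'b)) measure)"
      unfolding path_space_def by (rule measurable_sets[OF measurable_component_singleton]) auto
    then show "{p. p l \<in> A} \<in> sets path_space"
      by (simp add: path_space_def space_PiM vimage_def)
  qed
  then have "sigma_sets UNIV {{p. p l \<in> A} | l A. l \<le> k} \<subseteq> sets (path_space :: (nat \<Rightarrow> nat \<times> (int ^ 'b)) measure)"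
    using sets.sigma_sets_subset[of _ "path_space :: (nat \<Rightarrow> nat \<times> (int ^ 'b)) measure"]
    by (simp add: path_space_def space_PiM)
  then show "subalgebra (chain_law \<mu> start) (path_filtration k)"
    by (auto simp: subalgebra_def sp st path_filtration_def)
qed

lemma finite_lattice_ball: "finite (lattice_ball x r)"
proof -
  have "\<bar>y $ i\<bar> \<le> \<lceil>norm x + r\<rceil>" if "y \<in> lattice_ball x r" for y i
  proof -
    have "norm (real_vec y) \<le> norm x + r"
      using that norm_triangle_sub[of "real_vec y" x] by (simp add: lattice_ball_def)
    moreover have "\<bar>real_of_int (y $ i)\<bar> \<le> norm (real_vec y)"
      using component_le_norm_cart[of "real_vec y" i] by (simp add: real_vec_def)
    ultimately show ?thesis by linarith
  qed
  then have "lattice_ball x r \<subseteq> vec_lambda ` (UNIV \<rightarrow>\<^sub>E {- \<lceil>norm x + r\<rceil>..\<lceil>norm x + r\<rceil>})"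
    by (intro subsetI image_eqI[where f=vec_lambda and x="vec_nth _"])
      (auto simp: PiE_UNIV_domain abs_le_iff minus_le_iff)
  then show ?thesis
    by (rule finite_subset) (intro finite_imageI finite_PiE, auto)
qed

lemma centre_in_lattice_ball: "0 < r \<Longrightarrow> z \<in> lattice_ball (real_vec z) r"
  by (simp add: lattice_ball_def)

end

theory Submission
  imports Defs
begin

text \<open>
  A function that is parabolic on \<open>{0..N} \<times> \<int>\<^sup>d\<close> is nothing but a space-time average of its own
  values at time \<open>N\<close>: no path leaves the set before time \<open>N + 1\<close>, so the martingale property
  gives \<open>q (k, y) = (\<Sum>x. p\<^sub>l (x - y) * q (N, x))\<close> with \<open>l = N - k\<close>, where \<open>p\<^sub>l\<close> is the \<open>l\<close>-step
  transition kernel (\<open>parabolic_kernel\<close>). Comparing this with the same formula at \<open>(0, w)\<close>, the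
  Harnack inequality follows from a pointwise comparison of kernels, uniform over \<^emph>\<open>all\<close> points
  \<open>v\<close>: \<open>p\<^sub>l v \<le> C * p\<^sub>l\<^sub>+\<^sub>k (v + u)\<close> for \<open>\<bar>u\<bar> \<le> R\<close> and \<open>l\<close>, \<open>k\<close> both comparable to
  \<open>1 / \<phi> (R\<^sup>-\<^sup>2)\<close> (\<open>walk_kernel_Harnack\<close>). The constants \<open>B\<close> and \<open>b\<close> are such that \<open>l\<close> and \<open>k\<close>
  are indeed of this order for every point of the cylinder (\<open>time_scales\<close>).

  The kernel comparison reduces to continuous-time simple random walk. A Poisson variable with
  parameter \<open>t\<close>, conditioned to be positive, is \<open>1\<close> plus a Poisson variable whose random parameter
  is the time left after the first jump. Hence a jump of the subordinator is \<open>1\<close> plus a mixed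
  Poisson variable (\<open>subordinator_jump_mixed_Poisson\<close>), and \<open>p\<^sub>n\<close> is the \<open>n\<close>-step kernel of the
  simple random walk convolved with \<open>E h\<^bsub>\<theta>\<^esub>\<close> (\<open>walk_kernel_eq\<close>), where \<open>h\<^sub>t\<close> is the heat kernel of
  continuous-time simple random walk and \<open>\<theta> = \<theta>\<^sub>n\<close> is a sum of \<open>n\<close> independent positive
  variables with Laplace transform \<open>(1 - \<phi> \<lambda>) / (1 - \<lambda>)\<close>. The simple random walk factor moves only by
  \<open>O(\<surd>n)\<close>, far less than \<open>R\<close>, so what remains is to compare the mixtures of heat kernels
  (\<open>mixed_heat_Harnack\<close>).

  Passing to continuous time removes the parity of the simple random walk. The heat kernel is
  symmetric and decreasing in each \<open>\<bar>v\<^sub>i\<bar>\<close> by reflection (\<open>heat_coordinate_mono\<close>), and the identity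
  \<open>v\<^sub>i h\<^sub>t(v) = t/(2d) (h\<^sub>t(v - e\<^sub>i) - h\<^sub>t(v + e\<^sub>i))\<close> (\<open>heat_coordinate\<close>) shows that it is flat up to
  distance \<open>\<surd>t\<close>. Therefore \<open>h\<^sub>t(v)\<close> is dominated by an average of \<open>h\<^sub>t\<close> over a box of side
  \<open>\<surd>t \<and> R\<close> near \<open>v\<close>, and the semigroup property gives
  \<open>h\<^sub>t(v) \<le> C (R / (1 \<or> (\<surd>t \<and> R)))\<^sup>d h\<^sub>t\<^sub>+\<^sub>s(v + u)\<close> for \<open>s\<close> of order \<open>R\<^sup>2\<close> (\<open>heat_smoothing\<close>).
  This loses a factor when \<open>t\<close> is small compared with \<open>R\<^sup>2\<close>, but the Laplace transform bound
  \<open>E exp (- \<lambda> \<theta>\<^sub>n) \<le> exp (- c n \<phi> \<lambda>)\<close> together with the lower scaling of \<open>\<phi>\<close> makes small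
  values of \<open>\<theta>\<^sub>n\<close> so unlikely that the loss has bounded expectation
  (\<open>smoothing_loss_moment\<close>), while \<open>\<theta>\<^sub>k\<close> is of order \<open>R\<^sup>2\<close> with probability at least \<open>1/2\<close>
  (\<open>T_concentration\<close>).
\<close>

section \<open>Sums of independent variables\<close>

primrec iid_sum :: "'a::comm_monoid_add pmf \<Rightarrow> nat \<Rightarrow> 'a pmf" where
  "iid_sum P 0 = return_pmf 0"
| "iid_sum P (Suc n) = bind_pmf P (\<lambda>x. map_pmf ((+) x) (iid_sum P n))"

lemma iid_sum_add:
  "iid_sum P (m + n) = bind_pmf (iid_sum P m) (\<lambda>x. map_pmf ((+) x) (iid_sum P n))"
proof (induction m)
  case 0
  have "(+) (0::'a) = id" by auto
  then show ?case by (simp add: bind_return_pmf)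
next
  case (Suc m)
  have "(+) (x + y) = (\<lambda>z. x + (y + z))" for x y :: 'a
    by (simp add: fun_eq_iff add.assoc)
  then show ?case
    by (simp add: Suc map_bind_pmf bind_assoc_pmf bind_map_pmf pmf.map_comp o_def)
qed

text \<open>Splitting off the first coordinate of an i.i.d. sequence leaves an i.i.d. sequence, which
  matches the recursion of \<open>iid_sum\<close>.\<close>

lemma nn_integral_iid_partial_sum:
  fixes P :: "'a::{countable, comm_monoid_add} pmf" and f :: "'a \<Rightarrow> ennreal"
  shows "(\<integral>\<^sup>+\<omega>. f (\<Sum>i<n. \<omega> i) \<partial>(\<Pi>\<^sub>M i\<in>(UNIV::nat set). measure_pmf P)) = (\<integral>\<^sup>+x. f x \<partial>iid_sum P n)"
proof (induction n arbitrary: f)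
  case 0
  interpret prob_space "\<Pi>\<^sub>M i\<in>(UNIV::nat set). measure_pmf P"
    by (rule prob_space_PiM) (rule prob_space_measure_pmf)
  show ?case by (simp add: emeasure_space_1)
next
  case (Suc n)
  interpret sequence_space "measure_pmf P" by unfold_locales
  let ?S = "\<Pi>\<^sub>M i\<in>(UNIV::nat set). measure_pmf P"
  have meas[measurable]: "(\<lambda>\<omega>. \<Sum>i<m. \<omega> i) \<in> measurable ?S (count_space UNIV)" for m
  proof (induction m)
    case (Suc m)
    have comp: "(\<lambda>\<omega>. \<omega> m) \<in> measurable ?S (count_space UNIV)"
      by (rule measurable_compose[OF measurable_component_singleton]) auto
    show ?case unfolding sum.lessThan_Suc
      by (rule measurable_compose_countable[OF measurable_compose[OF Suc] comp]) simp
  qed simp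
  have fm: "(\<lambda>\<omega>. f (\<Sum>i<m. \<omega> i)) \<in> borel_measurable ?S" for m
    by (rule measurable_compose[OF meas]) simp
  have "(\<integral>\<^sup>+\<omega>. f (\<Sum>i<Suc n. \<omega> i) \<partial>?S)
      = (\<integral>\<^sup>+\<omega>. f (\<Sum>i<Suc n. \<omega> i) \<partial>distr (measure_pmf P \<Otimes>\<^sub>M ?S) ?S (\<lambda>(s, \<omega>). case_nat s \<omega>))"
    by (simp only: PiM_iter)
  also have "\<dots> = (\<integral>\<^sup>+(s, \<omega>). f (\<Sum>i<Suc n. case_nat s \<omega> i) \<partial>(measure_pmf P \<Otimes>\<^sub>M ?S))"
    by (subst nn_integral_distr) (use fm in \<open>auto simp: case_prod_beta' simp del: sum.lessThan_Suc\<close>)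
  also have "\<dots> = (\<integral>\<^sup>+(s, \<omega>). f (s + (\<Sum>i<n. \<omega> i)) \<partial>(measure_pmf P \<Otimes>\<^sub>M ?S))"
    by (simp only: sum.lessThan_Suc_shift nat.case)
  also have "\<dots> = (\<integral>\<^sup>+s. \<integral>\<^sup>+\<omega>. f (s + (\<Sum>i<n. \<omega> i)) \<partial>?S \<partial>measure_pmf P)"
  proof -
    have 1: "(\<lambda>(s, \<omega>). f (s + (\<Sum>i<n. \<omega> i))) \<in> borel_measurable (measure_pmf P \<Otimes>\<^sub>M ?S)"
    proof -
      have "(\<lambda>x. f (fst x + (\<Sum>i<n. snd x i))) \<in> borel_measurable (measure_pmf P \<Otimes>\<^sub>M ?S)"
      proof (rule measurable_compose_countable[where g=fst and f="\<lambda>s x. f (s + (\<Sum>i<n. snd x i))"])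
        show "fst \<in> measurable (measure_pmf P \<Otimes>\<^sub>M ?S) (count_space UNIV)"
          by (rule measurable_compose[OF measurable_fst]) auto
        show "(\<lambda>x. f (s + (\<Sum>i<n. snd x i))) \<in> borel_measurable (measure_pmf P \<Otimes>\<^sub>M ?S)" for s
          by (rule measurable_compose[OF measurable_snd], rule measurable_compose[OF meas]) simp
      qed
      then show ?thesis by (simp add: case_prod_beta')
    qed
    show ?thesis
      using P.nn_integral_fst[OF 1] by (simp add: case_prod_beta')
  qed
  also have "\<dots> = (\<integral>\<^sup>+s. \<integral>\<^sup>+x. f (s + x) \<partial>iid_sum P n \<partial>measure_pmf P)"
    by (simp add: Suc[of "\<lambda>x. f (_ + x)"])
  finally show ?case by simp
qed

section \<open>Simple random walk\<close>

abbreviation srw :: "nat \<Rightarrow> (int ^ 'n) pmf" where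
  "srw \<equiv> iid_sum srw_step"

lemma axis_unit_neq: "axis i (1::int) \<noteq> axis j (- 1)"
proof
  assume "axis i (1::int) = axis j (- 1)"
  then have "axis i (1::int) $ i = axis j (- 1) $ i" by simp
  then show False by (auto simp: axis_def split: if_splits)
qed

lemma inj_axis: "c \<noteq> 0 \<Longrightarrow> inj (\<lambda>i. axis i (c :: 'a :: zero))"
  by (auto simp: inj_def axis_eq_axis)

lemma srw_directions:
  fixes g :: "int ^ 'n \<Rightarrow> 'b :: comm_monoid_add"
  defines "D \<equiv> (range (\<lambda>i. axis i 1) \<union> range (\<lambda>i. axis i (- 1)) :: (int ^ 'n) set)"
  shows "finite D" "D \<noteq> {}" "card D = 2 * CARD('n)"
    "sum g D = (\<Sum>i\<in>UNIV. g (axis i 1) + g (axis i (- 1)))"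
proof -
  have disj: "range (\<lambda>i::'n. axis i (1::int)) \<inter> range (\<lambda>i. axis i (- 1)) = {}"
    using axis_unit_neq by auto
  show "finite D" "D \<noteq> {}" by (auto simp: D_def)
  show "card D = 2 * CARD('n)"
    unfolding D_def by (subst card_Un_disjoint[OF _ _ disj]) (auto simp: card_image inj_axis)
  show "sum g D = (\<Sum>i\<in>UNIV. g (axis i 1) + g (axis i (- 1)))"
    unfolding D_def
    by (subst sum.union_disjoint[OF _ _ disj]) (auto simp: sum.reindex inj_axis sum.distrib)
qed

lemma pmf_bind_srw_step:
  fixes f :: "int ^ 'n \<Rightarrow> 'b pmf"
  shows "pmf (bind_pmf srw_step f) v =
    (\<Sum>i\<in>UNIV. pmf (f (axis i 1)) v + pmf (f (axis i (- 1))) v) / (2 * CARD('n))"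
  unfolding pmf_bind srw_step_def
  by (subst integral_pmf_of_set) (auto simp: srw_directions)

lemma nn_integral_srw_step:
  fixes f :: "int ^ 'n \<Rightarrow> ennreal"
  shows "(\<integral>\<^sup>+x. f x \<partial>srw_step) =
    (\<Sum>i\<in>UNIV. f (axis i 1) + f (axis i (- 1))) / (2 * CARD('n))"
  unfolding srw_step_def
  by (subst nn_integral_pmf_of_set) (auto simp: srw_directions)

lemma pmf_map_plus: "pmf (map_pmf ((+) x) P) v = pmf P (v - x :: 'a :: ab_group_add)"
  using pmf_map_inj'[of "(+) x" P "v - x"] by simp

lemma axis_minus: "axis i (- 1 :: int) = - axis i 1"
  by (auto simp: vec_eq_iff axis_def)

lemma srw_Suc:
  "pmf (srw (Suc m)) (v :: int ^ 'n) =
    (\<Sum>i\<in>UNIV. pmf (srw m) (v - axis i 1) + pmf (srw m) (v + axis i 1)) / (2 * CARD('n))"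
  by (simp add: pmf_bind_srw_step pmf_map_plus axis_minus)

text \<open>Exchangeability of the steps: given \<open>S\<^sub>m = v\<close>, each of the \<open>m\<close> steps contributes on average
  the same amount to \<open>v\<^sub>i\<close>, and a single step moves coordinate \<open>i\<close> only if it is \<open>\<plusminus>e\<^sub>i\<close>. The proof is by induction on
  \<open>m\<close>, splitting off one more step.\<close>

lemma srw_coordinate:
  "of_int (v $ i) * pmf (srw m) (v :: int ^ 'n) =
    real m / (2 * CARD('n)) * (pmf (srw (m - 1)) (v - axis i 1) - pmf (srw (m - 1)) (v + axis i 1))"
proof (induction m arbitrary: v)
  case 0
  then show ?case by (auto simp: indicator_def)
next
  case (Suc m)
  let ?d = "2 * real CARD('n)" and ?e = "\<lambda>j. axis j (1::int) :: int ^ 'n"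
  let ?s = "\<lambda>m v. pmf (srw m) (v :: int ^ 'n)"
  have d: "?d > 0" by simp
  have step: "of_int ((v + u) $ i) * ?s m (v + u) =
     real m / ?d * (?s (m-1) ((v - ?e i) + u) - ?s (m-1) ((v + ?e i) + u))" for u
    using Suc[of "v + u"] by (simp add: algebra_simps)
  have "of_int (v $ i) * (?s m (v - ?e j) + ?s m (v + ?e j)) =
     real m / ?d * (?s (m-1) ((v - ?e i) - ?e j) + ?s (m-1) ((v - ?e i) + ?e j)
        - (?s (m-1) ((v + ?e i) - ?e j) + ?s (m-1) ((v + ?e i) + ?e j)))
      + (if j = i then ?s m (v - ?e i) - ?s m (v + ?e i) else 0)" for j
    using step[of "- ?e j"] step[of "?e j"] by (auto simp: algebra_simps axis_def)
  then have "of_int (v $ i) * (\<Sum>j\<in>UNIV. ?s m (v - ?e j) + ?s m (v + ?e j)) =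
     (\<Sum>j\<in>UNIV. real m / ?d * (?s (m-1) ((v - ?e i) - ?e j) + ?s (m-1) ((v - ?e i) + ?e j)
        - (?s (m-1) ((v + ?e i) - ?e j) + ?s (m-1) ((v + ?e i) + ?e j)))
      + (if j = i then ?s m (v - ?e i) - ?s m (v + ?e i) else 0))"
    unfolding sum_distrib_left by (intro sum.cong refl) 
  also have "\<dots> = real m / ?d * ((\<Sum>j\<in>UNIV. ?s (m-1) ((v - ?e i) - ?e j) + ?s (m-1) ((v - ?e i) + ?e j))
        - (\<Sum>j\<in>UNIV. ?s (m-1) ((v + ?e i) - ?e j) + ?s (m-1) ((v + ?e i) + ?e j)))
      + (?s m (v - ?e i) - ?s m (v + ?e i))"
    by (subst sum.distrib) (simp add: sum_distrib_left sum_subtractf right_diff_distrib)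
  also have "\<dots> = real m * (?s m (v - ?e i) - ?s m (v + ?e i)) + (?s m (v - ?e i) - ?s m (v + ?e i))"
  proof (cases m)
    case (Suc l)
    show ?thesis using d unfolding Suc srw_Suc by (simp add: field_simps del: iid_sum.simps)
  qed simp
  finally have "of_int (v $ i) * (\<Sum>j\<in>UNIV. ?s m (v - ?e j) + ?s m (v + ?e j)) =
     (real m + 1) * (?s m (v - ?e i) - ?s m (v + ?e i))" by (simp add: algebra_simps)
  then show ?case unfolding srw_Suc using d by (simp add: field_simps del: iid_sum.simps)
qed

section \<open>The heat kernel of continuous-time simple random walk\<close>

text \<open>Rate \<open>0\<close> is included because the empty convolution power below sits at time \<open>0\<close>; negative rates
  do not occur and give the same point mass.\<close>

definition pois :: "real \<Rightarrow> nat pmf" where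
  "pois t = (if 0 < t then poisson_pmf t else return_pmf 0)"

lemma pmf_pois: "0 \<le> t \<Longrightarrow> pmf (pois t) j = t ^ j / fact j * exp (- t)"
  by (cases "t = 0") (auto simp: pois_def power_0_left indicator_def)

lemma pois_add:
  assumes "0 \<le> s" "0 \<le> t"
  shows "pois (s + t) = bind_pmf (pois s) (\<lambda>x. map_pmf ((+) x) (pois t))"
proof (rule pmf_eqI)
  fix k :: nat
  have shift: "pmf (map_pmf ((+) x) (pois t)) k = (if x \<le> k then pmf (pois t) (k - x) else 0)" for x
  proof (cases "x \<le> k")
    case True
    then show ?thesis using pmf_map_inj'[of "(+) x" "pois t" "k - x"] by simp
  next
    case False
    then have "k \<notin> (+) x ` set_pmf (pois t)" by auto
    then show ?thesis using False by (simp add: pmf_eq_0_set_pmf)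
  qed
  have "pmf (bind_pmf (pois s) (\<lambda>x. map_pmf ((+) x) (pois t))) k =
     (\<Sum>i\<le>k. pmf (pois s) i * pmf (pois t) (k - i))"
    unfolding pmf_bind shift
    by (subst integral_measure_pmf[of "{..k}"]) (auto split: if_splits)
  also have "\<dots> = (\<Sum>i\<le>k. real (k choose i) * s ^ i * t ^ (k - i)) / fact k * exp (- (s + t))"
    unfolding sum_divide_distrib sum_distrib_right
    by (intro sum.cong refl) (simp add: assms pmf_pois binomial_fact field_simps exp_add exp_diff exp_minus)
  also have "\<dots> = pmf (pois (s + t)) k"
    using assms by (simp add: pmf_pois binomial_ring)
  finally show "pmf (pois (s + t)) k = pmf (bind_pmf (pois s) (\<lambda>x. map_pmf ((+) x) (pois t))) k" ..
qed

definition heat_pmf :: "real \<Rightarrow> (int ^ 'n) pmf" where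
  "heat_pmf t = bind_pmf (pois t) srw"

definition heat :: "real \<Rightarrow> int ^ 'n \<Rightarrow> real" where
  "heat t v = pmf (heat_pmf t) v"

lemma heat_nonneg [simp]: "0 \<le> heat t v"
  by (simp add: heat_def)

lemma heat_pmf_add:
  assumes "0 \<le> s" "0 \<le> t"
  shows "heat_pmf (s + t) = bind_pmf (heat_pmf s) (\<lambda>x. map_pmf ((+) x) (heat_pmf t))"
  unfolding heat_pmf_def pois_add[OF assms]
  by (simp add: bind_assoc_pmf bind_map_pmf map_bind_pmf iid_sum_add bind_commute_pmf[of "pois t"])

lemma ennreal_heat: "ennreal (heat t v) = (\<Sum>j. ennreal (pmf (pois t) j) * ennreal (pmf (srw j) v))"
  unfolding heat_def heat_pmf_def ennreal_pmf_bind nn_integral_measure_pmf nn_integral_count_space_nat ..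

lemma heat_sums:
  assumes "0 \<le> t"
  shows "(\<lambda>j. exp (- t) * t ^ j / fact j * pmf (srw j) v) sums heat t v"
proof -
  have "(\<lambda>j. ennreal (exp (- t) * t ^ j / fact j * pmf (srw j) v)) sums ennreal (heat t v)"
    unfolding ennreal_heat using assms
    by (auto simp: pmf_pois ennreal_mult'[symmetric] mult_ac intro!: summable_sums summableI)
  then show ?thesis by (subst (asm) sums_ennreal) (use assms in auto)
qed

lemma sum_heat_le_heat_add:
  assumes "0 \<le> s" "0 \<le> t" "finite A"
  shows "(\<Sum>x\<in>A. heat s x * heat t (y - x)) \<le> heat (s + t) y"
proof -
  have int: "integrable (measure_pmf (heat_pmf s)) (\<lambda>x. heat t (y - x))"
    by (rule measure_pmf.integrable_const_bound[of _ 1]) (auto simp: heat_def pmf_le_1)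
  have "(\<Sum>x\<in>A. heat s x * heat t (y - x)) = (\<integral>x. indicator A x * heat t (y - x) \<partial>heat_pmf s)"
    by (subst integral_measure_pmf[OF assms(3)]) (auto simp: heat_def indicator_def)
  also have "\<dots> \<le> (\<integral>x. heat t (y - x) \<partial>heat_pmf s)"
  proof (rule integral_mono)
    show "integrable (measure_pmf (heat_pmf s)) (\<lambda>x. indicator A x * heat t (y - x))"
      by (rule measure_pmf.integrable_const_bound[of _ 1]) (auto simp: heat_def pmf_le_1 indicator_def)
  qed (auto simp: int indicator_def)
  also have "\<dots> = heat (s + t) y"
    by (simp add: heat_def heat_pmf_add[OF assms(1,2)] pmf_bind pmf_map_plus)
  finally show ?thesis .
qed

text \<open>Size-biasing a Poisson variable (\<open>j P(N = j) = t P(N = j - 1)\<close>) turns the exchangeability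
  identity of the discrete walk into one at a single time \<open>t\<close>. It controls how fast the kernel can
  decay in each coordinate.\<close>

lemma heat_coordinate:
  fixes v :: "int ^ 'n"
  assumes "0 \<le> t"
  shows "of_int (v $ i) * heat t v = t / (2 * CARD('n)) * (heat t (v - axis i 1) - heat t (v + axis i 1))"
proof -
  let ?w = "\<lambda>j. exp (- t) * t ^ j / fact j"
  have "(\<lambda>j. of_int (v $ i) * (?w j * pmf (srw j) v)) sums (of_int (v $ i) * heat t v)"
    by (intro sums_mult heat_sums assms)
  moreover have "of_int (v $ i) * (?w j * pmf (srw j) v) = ?w j * (real j / (2 * CARD('n)) *
      (pmf (srw (j - 1)) (v - axis i 1) - pmf (srw (j - 1)) (v + axis i 1)))" for j
    unfolding srw_coordinate[symmetric] by (simp add: mult_ac)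
  ultimately have 1: "(\<lambda>j. ?w j * (real j / (2 * CARD('n)) *
      (pmf (srw (j - 1)) (v - axis i 1) - pmf (srw (j - 1)) (v + axis i 1)))) sums (of_int (v $ i) * heat t v)"
    (is "?f sums _") by simp
  have "(\<lambda>j. t / (2 * CARD('n)) * (?w j * pmf (srw j) (v - axis i 1) - ?w j * pmf (srw j) (v + axis i 1)))
     sums (t / (2 * CARD('n)) * (heat t (v - axis i 1) - heat t (v + axis i 1)))"
    by (intro sums_mult sums_diff heat_sums assms)
  moreover have "t / (2 * CARD('n)) * (?w j * pmf (srw j) (v - axis i 1) - ?w j * pmf (srw j) (v + axis i 1)) = ?f (Suc j)" for j
  proof -
    have "t * ?w j = ?w (Suc j) * real (Suc j)"
      by (simp add: divide_simps del: of_nat_Suc)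
    moreover have "t / D * (w * a - w * b) = (t * w) * (a - b) / D" for D w a b :: real
      by (simp add: algebra_simps diff_divide_distrib)
    ultimately show ?thesis by (simp only: diff_Suc_1) (simp only: times_divide_eq_left times_divide_eq_right mult.assoc)
  qed
  ultimately have "(\<lambda>j. ?f (Suc j)) sums (t / (2 * CARD('n)) * (heat t (v - axis i 1) - heat t (v + axis i 1)))"
    by simp
  then have "?f sums (t / (2 * CARD('n)) * (heat t (v - axis i 1) - heat t (v + axis i 1)) + ?f 0)"
    by (rule sums_Suc_iff[THEN iffD1])
  then have "?f sums (t / (2 * CARD('n)) * (heat t (v - axis i 1) - heat t (v + axis i 1)))"
    by simp
  then show ?thesis using 1 sums_unique2 by blast
qed

text \<open>The kernel of \<open>(I + P)\<^sup>m\<close>, i.e. \<open>2\<^sup>m\<close> times that of the lazy walk. Reflection arguments need a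
  walk that can stay put, because a step of \<open>P\<close> across the mirror would change the sign of the
  difference between a point and its image.\<close>

definition lazy_walk :: "nat \<Rightarrow> int ^ 'n \<Rightarrow> real" where
  "lazy_walk m v = (\<Sum>j\<le>m. real (m choose j) * pmf (srw j) v)"

lemma lazy_walk_Suc:
  fixes v :: "int ^ 'n"
  shows "lazy_walk (Suc m) v = lazy_walk m v + (\<Sum>i\<in>UNIV. lazy_walk m (v - axis i 1) + lazy_walk m (v + axis i 1)) / (2 * CARD('n))"
proof -
  let ?s = "\<lambda>j. pmf (srw j) v"
  have "lazy_walk (Suc m) v = ?s 0 + (\<Sum>j\<le>m. real (Suc m choose Suc j) * ?s (Suc j))"
    unfolding lazy_walk_def by (subst sum.atMost_Suc_shift) (simp del: iid_sum.simps)
  also have "\<dots> = (?s 0 + (\<Sum>j\<le>m. real (m choose Suc j) * ?s (Suc j))) + (\<Sum>j\<le>m. real (m choose j) * ?s (Suc j))"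
    by (simp add: sum.distrib algebra_simps del: iid_sum.simps)
  also have "?s 0 + (\<Sum>j\<le>m. real (m choose Suc j) * ?s (Suc j)) = (\<Sum>j\<le>Suc m. real (m choose j) * ?s j)"
    by (subst sum.atMost_Suc_shift) (simp del: iid_sum.simps)
  also have "\<dots> = lazy_walk m v" by (simp add: lazy_walk_def)
  also have "(\<Sum>j\<le>m. real (m choose j) * ?s (Suc j)) =
     (\<Sum>j\<le>m. \<Sum>i\<in>UNIV. real (m choose j) * (pmf (srw j) (v - axis i 1) + pmf (srw j) (v + axis i 1))) / (2 * CARD('n))"
    unfolding srw_Suc by (simp add: sum_divide_distrib sum_distrib_left)
  also have "\<dots> = (\<Sum>i\<in>UNIV. lazy_walk m (v - axis i 1) + lazy_walk m (v + axis i 1)) / (2 * CARD('n))"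
    by (subst sum.swap) (simp add: lazy_walk_def sum.distrib distrib_left)
  finally show ?thesis .
qed

text \<open>\<open>exp (t (P - I)) = exp (- 2 t) exp (t (P + I))\<close>.\<close>

lemma heat_lazy_walk_sums:
  assumes "0 \<le> t"
  shows "(\<lambda>m. exp (- 2 * t) * t ^ m / fact m * lazy_walk m v) sums heat t v"
proof -
  let ?a = "\<lambda>j. exp (- t) * t ^ j / fact j * pmf (srw j) v"
  let ?b = "\<lambda>j. exp (- t) * t ^ j / fact j"
  have b: "?b sums 1"
    using sums_mult[OF exp_converges[of t], of "exp (- t)"]
    by (simp add: divide_inverse mult_ac exp_minus_inverse)
  have a: "summable (\<lambda>j. norm (?a j))" "summable (\<lambda>j. norm (?b j))"
    using sums_summable[OF heat_sums[OF assms, of v]] sums_summable[OF b] assms by auto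
  have "(\<lambda>m. \<Sum>i\<le>m. ?a i * ?b (m - i)) sums (suminf ?a * suminf ?b)"
    by (rule Cauchy_product_sums[OF a])
  moreover have "suminf ?a * suminf ?b = heat t v"
    using sums_unique[OF heat_sums[OF assms, of v]] sums_unique[OF b] by simp
  moreover have "(\<Sum>i\<le>m. ?a i * ?b (m - i)) = exp (- 2 * t) * t ^ m / fact m * lazy_walk m v" for m
  proof -
    have "?a i * ?b (m - i) = exp (- 2 * t) * t ^ m / fact m * (real (m choose i) * pmf (srw i) v)" if "i \<le> m" for i
    proof -
      have "exp (- t) * exp (- t) = exp (- 2 * t)" by (simp flip: exp_add)
      moreover have "t ^ i * t ^ (m - i) = t ^ m" using that by (simp flip: power_add)
      moreover have "?a i * ?b (m - i) = (exp (- t) * exp (- t)) * (t ^ i * t ^ (m - i)) / (fact i * fact (m - i)) * pmf (srw i) v"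
        by simp
      ultimately have "?a i * ?b (m - i) = exp (- 2 * t) * t ^ m / (fact i * fact (m - i)) * pmf (srw i) v"
        by (simp only:)
      also have "\<dots> = exp (- 2 * t) * t ^ m / fact m * (real (m choose i) * pmf (srw i) v)"
        using that by (simp add: binomial_fact)
      finally show ?thesis .
    qed
    then show ?thesis by (simp add: lazy_walk_def sum_distrib_left)
  qed
  ultimately show ?thesis by simp
qed

definition coord_upd :: "'a ^ 'n \<Rightarrow> 'n \<Rightarrow> 'a \<Rightarrow> 'a ^ 'n" where
  "coord_upd v i x = (\<chi> j. if j = i then x else v $ j)"

lemma coord_upd_nth [simp]: "coord_upd v i x $ j = (if j = i then x else v $ j)"
  by (simp add: coord_upd_def)

text \<open>The mirror is the hyperplane \<open>x\<^sub>i = c + 1/2\<close>, which has the origin on its lower side. The difference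
  \<open>D\<close> of the kernel at a point and at its mirror image is antisymmetric, and it stays non-negative
  on the lower side: from a site next to the mirror, the only step that crosses it leads to
  the mirror image and contributes \<open>- D v / (2d)\<close>, which the holding term \<open>D v\<close> outweighs.\<close>

lemma lazy_walk_reflect:
  fixes v :: "int ^ 'n"
  assumes "0 \<le> c" "v $ i \<le> c"
  shows "lazy_walk m (coord_upd v i (2 * c + 1 - v $ i)) \<le> lazy_walk m v"
  using assms(2)
proof (induction m arbitrary: v)
  case 0
  have "coord_upd v i (2 * c + 1 - v $ i) \<noteq> 0"
  proof
    assume "coord_upd v i (2 * c + 1 - v $ i) = 0"
    then have "coord_upd v i (2 * c + 1 - v $ i) $ i = 0" by simp
    then show False using 0 assms(1) by simp
  qed
  then show ?case by (simp add: lazy_walk_def indicator_def)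
next
  case (Suc m)
  let ?r = "\<lambda>v :: int ^ 'n. coord_upd v i (2 * c + 1 - v $ i)" and ?L = "lazy_walk m :: int ^ 'n \<Rightarrow> real"
  let ?e = "\<lambda>j. axis j (1::int) :: int ^ 'n"
  define D where "D v = ?L v - ?L (?r v)" for v
  have D0: "0 \<le> D w" if "w $ i \<le> c" for w using Suc.IH[OF that] by (simp add: D_def)
  have other: "?r v - ?e j = ?r (v - ?e j)" "?r v + ?e j = ?r (v + ?e j)" if "j \<noteq> i" for j
    using that by (auto simp: vec_eq_iff axis_def)
  have same: "?r v - ?e i = ?r (v + ?e i)" "?r v + ?e i = ?r (v - ?e i)"
    by (auto simp: vec_eq_iff axis_def)
  have term_eq: "(?L (v - ?e j) + ?L (v + ?e j)) - (?L (?r v - ?e j) + ?L (?r v + ?e j)) =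
     D (v - ?e j) + D (v + ?e j)" for j
    by (cases "j = i") (simp_all add: same other D_def)
  have up: "- D v \<le> D (v + ?e i)"
  proof (cases "v $ i = c")
    case True
    then have "?r v = v + ?e i" "?r (v + ?e i) = v" by (auto simp: vec_eq_iff axis_def)
    then show ?thesis by (simp add: D_def)
  next
    case False
    then have "0 \<le> D (v + ?e i)" using Suc.prems by (intro D0) (auto simp: axis_def)
    then show ?thesis using D0[OF Suc.prems] by linarith
  qed
  have "- D v \<le> (\<Sum>j\<in>UNIV. D (v - ?e j) + D (v + ?e j))"
  proof -
    have "- D v = (\<Sum>j\<in>UNIV. if j = i then - D v else 0)" by simp
    also have "\<dots> \<le> (\<Sum>j\<in>UNIV. D (v - ?e j) + D (v + ?e j))"
    proof (rule sum_mono)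
      fix j
      have "0 \<le> D (v - ?e j)" using Suc.prems by (intro D0) (auto simp: axis_def)
      moreover have "0 \<le> D (v + ?e j)" if "j \<noteq> i" using Suc.prems that by (intro D0) (simp add: axis_def)
      ultimately show "(if j = i then - D v else 0) \<le> D (v - ?e j) + D (v + ?e j)"
        using up by (auto intro: add_increasing)
    qed
    finally show ?thesis .
  qed
  then have "- D v / (2 * CARD('n)) \<le> (\<Sum>j\<in>UNIV. D (v - ?e j) + D (v + ?e j)) / (2 * CARD('n))"
    by (intro divide_right_mono) auto
  moreover have "D v / (2 * CARD('n)) \<le> D v"
  proof -
    have "0 < CARD('n)" by simp
    then have "1 \<le> 2 * real CARD('n)" by linarith
    then show ?thesis
      using D0[OF Suc.prems] mult_left_mono[of 1 "2 * real CARD('n)" "D v"] by (simp add: divide_le_eq)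
  qed
  moreover have "lazy_walk (Suc m) v - lazy_walk (Suc m) (?r v) =
     D v + (\<Sum>j\<in>UNIV. D (v - ?e j) + D (v + ?e j)) / (2 * CARD('n))"
    unfolding lazy_walk_Suc term_eq[symmetric] sum_subtractf by (simp add: D_def diff_divide_distrib)
  ultimately show ?case by simp
qed

lemma heat_reflect:
  fixes v :: "int ^ 'n"
  assumes "0 \<le> t" "0 \<le> c" "v $ i \<le> c"
  shows "heat t (coord_upd v i (2 * c + 1 - v $ i)) \<le> heat t v"
proof (rule sums_le[OF _ heat_lazy_walk_sums heat_lazy_walk_sums])
  show "exp (- 2 * t) * t ^ m / fact m * lazy_walk m (coord_upd v i (2 * c + 1 - v $ i))
      \<le> exp (- 2 * t) * t ^ m / fact m * lazy_walk m v" for m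
    using assms by (intro mult_left_mono lazy_walk_reflect) auto
qed (use assms in auto)

lemma srw_flip: "pmf (srw m) (coord_upd v i (- v $ i)) = pmf (srw m) (v :: int ^ 'n)"
proof (induction m arbitrary: v)
  case 0
  have "coord_upd v i (- v $ i) = 0 \<longleftrightarrow> v = 0" by (auto simp: vec_eq_iff split: if_splits)
  then show ?case by (auto simp: indicator_def)
next
  case (Suc m)
  let ?r = "\<lambda>v :: int ^ 'n. coord_upd v i (- v $ i)"
  let ?e = "\<lambda>j. axis j (1::int) :: int ^ 'n"
  have other: "?r v - ?e j = ?r (v - ?e j)" "?r v + ?e j = ?r (v + ?e j)" if "j \<noteq> i" for j
    using that by (auto simp: vec_eq_iff axis_def)
  have same: "?r v - ?e i = ?r (v + ?e i)" "?r v + ?e i = ?r (v - ?e i)"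
    by (auto simp: vec_eq_iff axis_def)
  have "pmf (srw m) (?r v - ?e j) + pmf (srw m) (?r v + ?e j) = pmf (srw m) (v - ?e j) + pmf (srw m) (v + ?e j)" for j
  proof (cases "j = i")
    case True
    show ?thesis by (simp only: True same Suc.IH)
  next
    case False
    show ?thesis by (simp only: other[OF False] Suc.IH)
  qed
  then show ?case unfolding srw_Suc by simp
qed

lemma heat_flip:
  assumes "0 \<le> t"
  shows "heat t (coord_upd v i (- v $ i)) = heat t v"
proof -
  have "(\<lambda>j. exp (- t) * t ^ j / fact j * pmf (srw j) v) sums heat t (coord_upd v i (- v $ i))"
    using heat_sums[OF assms, of "coord_upd v i (- v $ i)"] by (simp only: srw_flip)
  with heat_sums[OF assms, of v] show ?thesis
    using sums_unique2 by blast
qed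

text \<open>Reflection in \<open>x\<^sub>i = x + 1/2\<close> exchanges the neighbours \<open>x\<close> and \<open>x + 1\<close>, so the kernel decreases
  along each non-negative half-axis; negative values are covered by symmetry.\<close>

lemma heat_coordinate_mono:
  fixes v :: "int ^ 'n"
  assumes "0 \<le> t" "\<bar>x\<bar> \<le> \<bar>y\<bar>"
  shows "heat t (coord_upd v i y) \<le> heat t (coord_upd v i x)"
proof -
  define h where "h x = heat t (coord_upd v i x)" for x
  have step: "h (x + 1) \<le> h x" if "0 \<le> x" for x
    using heat_reflect[OF assms(1) that, of "coord_upd v i x" i] by (simp add: h_def coord_upd_def cong: if_cong)
  have "h (x + int n) \<le> h x" if "0 \<le> x" for x n
  proof (induction n)
    case (Suc n)
    have "h (x + int (Suc n)) \<le> h (x + int n)" using step[of "x + int n"] that by (simp add: add_ac)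
    then show ?case using Suc by simp
  qed simp
  from this[of "\<bar>x\<bar>" "nat (\<bar>y\<bar> - \<bar>x\<bar>)"] have "h \<bar>y\<bar> \<le> h \<bar>x\<bar>" using assms(2) by simp
  moreover have "h \<bar>z\<bar> = h z" for z
    using heat_flip[OF assms(1), of "coord_upd v i z" i] by (auto simp: h_def abs_if coord_upd_def cong: if_cong)
  ultimately show ?thesis by (simp add: h_def)
qed

text \<open>Combining monotonicity \<open>h (n + 2) \<le> h (n + 1)\<close> with the recurrence
  \<open>h n = h (n + 2) + (2 d / t) (n + 1) h (n + 1)\<close> gives \<open>h n \<le> (1 + 2 d (n + 1) / t) h (n + 1)\<close>.
  The product of these factors up to \<open>N\<close> is bounded as long as \<open>N\<^sup>2 = O(t)\<close>.\<close>

lemma heat_zero_le: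
  fixes v :: "int ^ 'n"
  assumes "0 < t"
  shows "heat t (coord_upd v i 0) \<le> exp (real CARD('n) * real N * (real N + 1) / t) * heat t (coord_upd v i (int N))"
proof -
  define h where "h x = heat t (coord_upd v i x)" for x
  define d where "d = real CARD('n)"
  have d: "d > 0" by (simp add: d_def)
  have mono: "h y \<le> h x" if "\<bar>x\<bar> \<le> \<bar>y\<bar>" for x y
    using heat_coordinate_mono[of t x y v i] assms that by (simp add: h_def)
  have h0: "0 \<le> h x" for x by (simp add: h_def)
  have step: "h (int n) \<le> exp (2 * d * (real n + 1) / t) * h (int n + 1)" for n :: nat
  proof -
    have e: "coord_upd v i (int n + 1) - axis i 1 = coord_upd v i (int n)"
      "coord_upd v i (int n + 1) + axis i 1 = coord_upd v i (int n + 2)"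
      by (auto simp: vec_eq_iff axis_def)
    have "(real n + 1) * h (int n + 1) = t / (2 * d) * (h (int n) - h (int n + 2))"
      using heat_coordinate[of t "coord_upd v i (int n + 1)" i] assms unfolding e by (simp add: h_def d_def)
    then have "h (int n) = h (int n + 2) + 2 * d * (real n + 1) / t * h (int n + 1)"
      using assms d by (simp add: field_simps)
    also have "\<dots> \<le> (1 + 2 * d * (real n + 1) / t) * h (int n + 1)"
      using mono[of "int n + 1" "int n + 2"] by (simp add: algebra_simps)
    also have "\<dots> \<le> exp (2 * d * (real n + 1) / t) * h (int n + 1)"
      by (intro mult_right_mono h0) (rule exp_ge_add_one_self)
    finally show ?thesis .
  qed
  have "h 0 \<le> exp (d * real N * (real N + 1) / t) * h (int N)"
  proof (induction N)
    case (Suc N)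
    have "h 0 \<le> exp (d * real N * (real N + 1) / t) * h (int N)" by (rule Suc)
    also have "\<dots> \<le> exp (d * real N * (real N + 1) / t) * (exp (2 * d * (real N + 1) / t) * h (int N + 1))"
      by (intro mult_left_mono step) simp
    also have "\<dots> = exp (d * real N * (real N + 1) / t + 2 * d * (real N + 1) / t) * h (int (Suc N))"
      by (simp add: exp_add add_ac)
    also have "d * real N * (real N + 1) / t + 2 * d * (real N + 1) / t = d * real (Suc N) * (real (Suc N) + 1) / t"
      using assms by (simp add: field_simps)
    finally show ?case by simp
  qed simp
  then show ?thesis by (simp add: h_def d_def)
qed

lemma heat_coordinate_comparison:
  fixes v :: "int ^ 'n"
  assumes t: "0 < t" and N: "real N ^ 2 \<le> A * t" and x: "\<bar>x\<bar> \<le> max \<bar>y\<bar> (int N)"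
  shows "heat t (coord_upd v i y) \<le> exp (2 * real CARD('n) * A) * heat t (coord_upd v i x)"
proof (cases "\<bar>x\<bar> \<le> \<bar>y\<bar>")
  case True
  have "0 \<le> A * t" using N by (rule order_trans[rotated]) simp
  then have "1 \<le> exp (2 * real CARD('n) * A)" using t by (simp add: zero_le_mult_iff)
  then have "heat t (coord_upd v i x) \<le> exp (2 * real CARD('n) * A) * heat t (coord_upd v i x)"
    using mult_right_mono[of 1 "exp (2 * real CARD('n) * A)" "heat t (coord_upd v i x)"] by simp
  with heat_coordinate_mono[of t x y v i] True t show ?thesis by simp
next
  case False
  then have xN: "\<bar>x\<bar> \<le> \<bar>int N\<bar>" using x by simp
  have "real N * (real N + 1) \<le> 2 * real N ^ 2" by (cases N) (auto simp: power2_eq_square algebra_simps)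
  then have "real N * (real N + 1) / t \<le> 2 * A"
    using N t by (simp add: divide_le_eq)
  then have "real CARD('n) * (real N * (real N + 1) / t) \<le> real CARD('n) * (2 * A)"
    by (intro mult_left_mono) auto
  then have ex: "exp (real CARD('n) * real N * (real N + 1) / t) \<le> exp (2 * real CARD('n) * A)"
    by (simp add: algebra_simps)
  have "heat t (coord_upd v i y) \<le> heat t (coord_upd v i 0)"
    using t by (intro heat_coordinate_mono) auto
  also have "\<dots> \<le> exp (real CARD('n) * real N * (real N + 1) / t) * heat t (coord_upd v i (int N))"
    by (rule heat_zero_le[OF t])
  also have "\<dots> \<le> exp (2 * real CARD('n) * A) * heat t (coord_upd v i x)"
    using t xN by (intro mult_mono ex heat_coordinate_mono) auto
  finally show ?thesis .
qed

text \<open>Moving inwards does not decrease the kernel, and below the diffusive scale it does not vary by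
  more than a constant factor; changing one coordinate at a time combines both.\<close>

lemma heat_comparison:
  fixes v x :: "int ^ 'n"
  assumes t: "0 < t" and N: "real N ^ 2 \<le> A * t" and x: "\<And>i. \<bar>x $ i\<bar> \<le> max \<bar>v $ i\<bar> (int N)"
  shows "heat t v \<le> exp (2 * real CARD('n) * A) ^ CARD('n) * heat t x"
proof -
  have "heat t v \<le> exp (2 * real CARD('n) * A) ^ card S * heat t (\<chi> j. if j \<in> S then x $ j else v $ j)"
    if "finite S" for S :: "'n set" using that
  proof (induction S rule: finite_induct)
    case (insert i S)
    let ?w = "\<chi> j. if j \<in> S then x $ j else v $ j"
    have w: "coord_upd ?w i (v $ i) = ?w" using insert by (auto simp: vec_eq_iff)
    have "heat t ?w \<le> exp (2 * real CARD('n) * A) * heat t (coord_upd ?w i (x $ i))"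
      using heat_coordinate_comparison[OF t N x, of ?w i i] unfolding w .
    also have "coord_upd ?w i (x $ i) = (\<chi> j. if j \<in> insert i S then x $ j else v $ j)"
      by (auto simp: vec_eq_iff)
    finally have "exp (2 * real CARD('n) * A) ^ card S * heat t ?w \<le>
       exp (2 * real CARD('n) * A) ^ card S * (exp (2 * real CARD('n) * A) * heat t (\<chi> j. if j \<in> insert i S then x $ j else v $ j))"
      by (intro mult_left_mono) auto
    from order_trans[OF insert.IH this] show ?case using insert.hyps by (simp add: mult_ac)
  qed (simp add: vec_lambda_eta)
  from this[of UNIV] show ?thesis by (simp add: vec_lambda_eta)
qed

section \<open>Diffusive lower bounds\<close>

definition sqnorm :: "int ^ 'n \<Rightarrow> real" where
  "sqnorm v = (\<Sum>i\<in>UNIV. (real_of_int (v $ i))\<^sup>2)"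

lemma sqnorm_nonneg [simp]: "0 \<le> sqnorm v"
  by (simp add: sqnorm_def sum_nonneg)

lemma sqnorm_axis: "sqnorm (v + axis i c) = sqnorm v + 2 * of_int c * of_int (v $ i) + (of_int c)\<^sup>2"
proof -
  have "sqnorm (v + axis i c) = (\<Sum>j\<in>UNIV. (real_of_int (v $ j))\<^sup>2 +
      (if j = i then 2 * of_int c * of_int (v $ i) + (of_int c)\<^sup>2 else 0))"
    unfolding sqnorm_def by (intro sum.cong) (auto simp: axis_def power2_sum)
  then show ?thesis by (simp add: sum.distrib sqnorm_def)
qed

text \<open>Averaged over \<open>\<plusminus>e\<^sub>i\<close>, a step adds exactly \<open>1\<close> to the squared norm.\<close>

lemma srw_second_moment: "(\<integral>\<^sup>+x. ennreal (sqnorm (x :: int ^ 'n)) \<partial>srw m) = ennreal (real m)"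
proof (induction m)
  case 0
  then show ?case by (simp add: sqnorm_def)
next
  case (Suc m)
  have "(\<integral>\<^sup>+e. ennreal (sqnorm (x + e)) \<partial>srw_step) = ennreal (sqnorm x) + 1" for x :: "int ^ 'n"
  proof -
    have "ennreal (sqnorm (x + axis i 1)) + ennreal (sqnorm (x + axis i (- 1))) = ennreal (2 * (sqnorm x + 1))" for i
      using sqnorm_nonneg[of "x + axis i 1"] sqnorm_nonneg[of "x + axis i (- 1)"]
      by (subst ennreal_plus[symmetric]) (auto simp: sqnorm_axis)
    then have "(\<integral>\<^sup>+e. ennreal (sqnorm (x + e)) \<partial>srw_step) = of_nat CARD('n) * ennreal (2 * (sqnorm x + 1)) / (2 * of_nat CARD('n))"
      by (simp add: nn_integral_srw_step)
    also have "\<dots> = ennreal (real CARD('n) * (2 * (sqnorm x + 1)) / (2 * real CARD('n)))"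
      by (subst divide_ennreal[symmetric]) (auto simp: ennreal_mult' ennreal_of_nat_eq_real_of_nat)
    also have "real CARD('n) * (2 * (sqnorm x + 1)) / (2 * real CARD('n)) = sqnorm x + 1" by simp
    finally show ?thesis by simp
  qed
  moreover have "srw 1 = (srw_step :: (int ^ 'n) pmf)"
  proof -
    have "(\<lambda>x. return_pmf (x + 0)) = (return_pmf :: int ^ 'n \<Rightarrow> _)" by auto
    then show ?thesis by (simp add: bind_return_pmf')
  qed
  moreover have "srw (Suc m) = bind_pmf (srw m) (\<lambda>x. map_pmf ((+) x) (srw 1 :: (int ^ 'n) pmf))"
    using iid_sum_add[of "srw_step :: (int ^ 'n) pmf" m 1] by (simp only: Suc_eq_plus1)
  ultimately have "(\<integral>\<^sup>+x. ennreal (sqnorm x) \<partial>(srw (Suc m) :: (int ^ 'n) pmf)) = (\<integral>\<^sup>+x. ennreal (sqnorm x) + 1 \<partial>(srw m :: (int ^ 'n) pmf))"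
    by (simp only: nn_integral_bind_pmf nn_integral_map_pmf)
  also have "\<dots> = ennreal (real m) + 1"
    using Suc by (simp add: nn_integral_add)
  finally show ?case by (simp add: add.commute)
qed

lemma pois_mean:
  assumes "0 \<le> t" shows "(\<integral>\<^sup>+j. ennreal (real j) \<partial>pois t) = ennreal t"
proof -
  have "(\<lambda>j. t * (exp (- t) * (t ^ j / fact j))) sums (t * (exp (- t) * exp t))"
    using exp_converges[of t] by (intro sums_mult) (simp add: divide_inverse mult.commute)
  moreover have "t * (exp (- t) * (t ^ j / fact j)) = pmf (pois t) (Suc j) * real (Suc j)" for j
    using assms by (simp add: pmf_pois divide_simps del: of_nat_Suc)
  ultimately have "(\<lambda>j. pmf (pois t) (Suc j) * real (Suc j)) sums t"
    by (simp add: exp_minus_inverse mult_ac)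
  then have "(\<lambda>j. pmf (pois t) j * real j) sums t"
    using sums_Suc_iff[of "\<lambda>j. pmf (pois t) j * real j" t] by simp
  then have "(\<lambda>j. ennreal (pmf (pois t) j * real j)) sums ennreal t"
    using assms by (subst sums_ennreal) auto
  then show ?thesis
    by (simp add: nn_integral_measure_pmf nn_integral_count_space_nat sums_iff ennreal_mult')
qed

lemma heat_second_moment:
  assumes "0 \<le> t" shows "(\<integral>\<^sup>+x. ennreal (sqnorm x) \<partial>heat_pmf t) = ennreal t"
  unfolding heat_pmf_def by (simp add: srw_second_moment pois_mean assms)

lemma sqnorm_Chebyshev:
  fixes P :: "(int ^ 'n) pmf"
  assumes "(\<integral>\<^sup>+x. ennreal (sqnorm x) \<partial>P) = ennreal a" "0 \<le> a" "0 < b"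
  shows "1 - a / b \<le> measure P {x. sqnorm x < b}"
proof -
  have "emeasure P {x. b \<le> sqnorm x} = (\<integral>\<^sup>+x. indicator {x. b \<le> sqnorm x} x \<partial>P)" by simp
  also have "\<dots> \<le> (\<integral>\<^sup>+x. ennreal (1 / b) * ennreal (sqnorm x) \<partial>P)"
    using assms(3) by (intro nn_integral_mono)
      (auto simp: indicator_def ennreal_mult'[symmetric] divide_simps simp flip: ennreal_1 intro!: ennreal_leI)
  also have "\<dots> = ennreal (a / b)"
    unfolding nn_integral_cmult[of "\<lambda>x. ennreal (sqnorm x)" "measure_pmf P", simplified] assms(1)
    using assms by (simp add: ennreal_mult'[symmetric])
  finally have "measure P {x. b \<le> sqnorm x} \<le> a / b"
    using assms by (simp add: measure_pmf.emeasure_eq_measure)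
  moreover have "measure P {x. b \<le> sqnorm x} = 1 - measure P {x. sqnorm x < b}"
    using measure_pmf.prob_compl[of "{x. sqnorm x < b}" P]
    by (simp add: Compl_eq_Diff_UNIV[symmetric] Collect_neg_eq[symmetric] not_less)
  ultimately show ?thesis by simp
qed

lemma abs_le_of_sqnorm_less:
  assumes "sqnorm v < b\<^sup>2" "0 \<le> b"
  shows "\<bar>real_of_int (v $ i)\<bar> < b"
proof -
  have "(real_of_int (v $ i))\<^sup>2 \<le> sqnorm v"
    unfolding sqnorm_def by (rule member_le_sum) auto
  then have "(real_of_int (v $ i))\<^sup>2 < b\<^sup>2" using assms by simp
  then show ?thesis using assms(2) by (metis abs_of_nonneg power2_abs power_less_imp_less_base)
qed

lemma box_card:
  fixes X :: "'n::finite \<Rightarrow> 'a set"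
  assumes "\<And>i. finite (X i)"
  shows "finite {x :: 'a ^ 'n. \<forall>i. x $ i \<in> X i}" "card {x :: 'a ^ 'n. \<forall>i. x $ i \<in> X i} = (\<Prod>i\<in>UNIV. card (X i))"
proof -
  have eq: "{x :: 'a ^ 'n. \<forall>i. x $ i \<in> X i} = vec_lambda ` (Pi\<^sub>E UNIV X)"
    by (auto simp: image_iff PiE_UNIV_domain intro!: bexI[of _ "vec_nth _"])
  have inj: "inj_on vec_lambda (Pi\<^sub>E (UNIV::'n set) X)"
    by (auto simp: inj_on_def vec_lambda_inject)
  show "finite {x :: 'a ^ 'n. \<forall>i. x $ i \<in> X i}"
    unfolding eq using assms by (intro finite_imageI finite_PiE) auto
  show "card {x :: 'a ^ 'n. \<forall>i. x $ i \<in> X i} = (\<Prod>i\<in>UNIV. card (X i))"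
    unfolding eq by (subst card_image[OF inj]) (simp add: card_PiE)
qed

lemma heat_le_heat_zero: "0 < t \<Longrightarrow> heat t (v :: int ^ 'n) \<le> heat t (0 :: int ^ 'n)"
  using heat_comparison[of t 0 0 0 v] by simp

text \<open>By Chebyshev, mass at least \<open>3/4\<close> sits in a box with at most \<open>(5 \<surd>t)\<^sup>d\<close> sites, and the kernel is
  largest at the origin.\<close>

lemma heat_zero_lower:
  assumes "1 \<le> t"
  shows "3 / 4 / (5 * sqrt t) ^ CARD('n) \<le> heat t (0 :: int ^ 'n)"
proof -
  define M where "M = \<lfloor>2 * sqrt t\<rfloor>"
  define Box where "Box = {x :: int ^ 'n. \<forall>i. x $ i \<in> {- M..M}}"
  have Box: "finite Box" unfolding Box_def by (rule box_card) simp
  have M: "0 \<le> M" "of_int M \<le> 2 * sqrt t" using assms by (auto simp: M_def)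
  have st: "1 \<le> sqrt t" using assms by simp
  have "3 / 4 \<le> measure (heat_pmf t :: (int ^ 'n) pmf) {x. sqnorm x < 4 * t}"
    using sqnorm_Chebyshev[OF heat_second_moment, of t "4 * t"] assms by simp
  also have "\<dots> \<le> measure (heat_pmf t :: (int ^ 'n) pmf) Box"
  proof (rule measure_pmf.finite_measure_mono)
    show "{x. sqnorm x < 4 * t} \<subseteq> Box"
    proof
      fix x :: "int ^ 'n" assume "x \<in> {x. sqnorm x < 4 * t}"
      then have "sqnorm x < (2 * sqrt t)\<^sup>2" using assms by (simp add: power_mult_distrib)
      then have "\<bar>real_of_int (x $ i)\<bar> < 2 * sqrt t" for i
        using assms by (intro abs_le_of_sqnorm_less) auto
      then have "\<bar>x $ i\<bar> \<le> M" for i unfolding M_def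
        by (metis le_floor_iff less_imp_le of_int_abs)
      then show "x \<in> Box" by (simp add: Box_def abs_le_iff minus_le_iff)
    qed
  qed simp
  also have "\<dots> = (\<Sum>x\<in>Box. heat t x)"
    unfolding heat_def by (rule measure_measure_pmf_finite[OF Box])
  also have "\<dots> \<le> (\<Sum>x\<in>Box. heat t (0 :: int ^ 'n))"
    using assms by (intro sum_mono heat_le_heat_zero) simp
  also have "\<dots> = real (nat (2 * M + 1)) ^ CARD('n) * heat t (0 :: int ^ 'n)"
    using box_card(2)[of "\<lambda>_::'n. {- M..M}"] by (simp add: Box_def)
  also have "\<dots> \<le> (5 * sqrt t) ^ CARD('n) * heat t (0 :: int ^ 'n)"
  proof (intro mult_right_mono power_mono)
    show "real (nat (2 * M + 1)) \<le> 5 * sqrt t" using M st by linarith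
  qed auto
  finally show ?thesis using assms by (simp add: divide_le_eq mult_ac)
qed

lemma heat_lower:
  fixes y :: "int ^ 'n"
  assumes "1 \<le> t" "real N ^ 2 \<le> A * t" "\<And>i. \<bar>y $ i\<bar> \<le> int N"
  shows "3 / 4 / (exp (2 * real CARD('n) * A) * (5 * sqrt t)) ^ CARD('n) \<le> heat t y"
proof -
  have "3 / 4 / (5 * sqrt t) ^ CARD('n) \<le> heat t (0 :: int ^ 'n)" by (rule heat_zero_lower[OF assms(1)])
  also have "\<dots> \<le> exp (2 * real CARD('n) * A) ^ CARD('n) * heat t y"
    using assms by (intro heat_comparison) auto
  finally have "3 / 4 / (5 * sqrt t) ^ CARD('n) / exp (2 * real CARD('n) * A) ^ CARD('n) \<le> heat t y"
    by (subst pos_divide_le_eq) (auto simp: mult.commute)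
  then show ?thesis by (simp add: power_mult_distrib mult_ac)
qed

text \<open>The price of comparing the heat kernel at time \<open>t\<close> with the kernel a time of order \<open>R\<^sup>2\<close> later: the
  ratio of the volume of a box of side \<open>R\<close> to that of a box near \<open>v\<close> on which \<open>h\<^sub>t\<close> is at least of
  order \<open>h\<^sub>t v\<close>.\<close>

definition smoothing_loss :: "nat \<Rightarrow> real \<Rightarrow> real \<Rightarrow> real" where
  "smoothing_loss d R t = (R / max 1 (min (sqrt t) R)) ^ d"

text \<open>With \<open>N\<close> the integer part of \<open>\<surd>t \<and> R\<close>, there are \<open>(N + 1)\<^sup>d\<close> sites within distance \<open>N\<close> of \<open>v\<close> per
  coordinate at which \<open>h\<^sub>t\<close> is at least a constant times \<open>h\<^sub>t v\<close>: a segment from \<open>v\<^sub>i\<close> towards zero,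
  or a segment starting at zero if \<open>\<bar>v\<^sub>i\<bar> < N\<close>. From each of them \<open>v + u\<close> is reached in the
  remaining time \<open>H\<close> with probability at least of order \<open>R\<^sup>-\<^sup>d\<close>.\<close>

lemma heat_smoothing:
  assumes "0 < \<delta>"
  shows "\<exists>C>0. \<forall>R\<ge>1. \<forall>t>0. \<forall>H\<ge>1. \<forall>u v :: int ^ 'n. \<delta> * R\<^sup>2 \<le> H \<longrightarrow> \<delta> * H \<le> R\<^sup>2 \<longrightarrow>
     (\<forall>i. real_of_int \<bar>u $ i\<bar> \<le> 2 * R) \<longrightarrow>
     heat t v \<le> C * smoothing_loss CARD('n) R t * heat (t + H) (v + u)"
proof -
  let ?d = "CARD('n)"
  define E where "E = exp (2 * real ?d) ^ ?d"
  define K where "K = exp (2 * real ?d * (16 / \<delta>)) * (5 / sqrt \<delta>)"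
  define C where "C = E * (4 / 3) * K ^ ?d"
  have pos: "0 < E" "0 < K" "0 < C" using assms by (auto simp: E_def K_def C_def)
  show ?thesis
  proof (intro exI[of _ C] conjI allI impI pos(3))
    fix R t H :: real and u v :: "int ^ 'n"
    assume R: "1 \<le> R" and t: "0 < t" and H1: "1 \<le> H" and H: "\<delta> * R\<^sup>2 \<le> H" "\<delta> * H \<le> R\<^sup>2"
      and u: "\<forall>i. real_of_int \<bar>u $ i\<bar> \<le> 2 * R"
    define N where "N = nat \<lfloor>min (sqrt t) R\<rfloor>"
    have N: "real N \<le> sqrt t" "real N \<le> R" "max 1 (min (sqrt t) R) \<le> real N + 1"
      using t R unfolding N_def by (auto simp: min_def) linarith+
    have N2: "real N ^ 2 \<le> 1 * t" using power_mono[OF N(1), of 2] t by simp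
    \<comment> \<open>Integer segments of \<open>N + 1\<close> sites; the clipping by \<open>0\<close> makes them start at the origin when \<open>v $ i\<close> is close to it.\<close>
    define X where "X i = (if 0 \<le> v $ i then {max 0 (v $ i - int N)..max 0 (v $ i - int N) + int N}
       else {min 0 (v $ i + int N) - int N..min 0 (v $ i + int N)})" for i
    have Xcard: "finite (X i)" "card (X i) = N + 1" for i by (auto simp: X_def)
    have X: "\<bar>x\<bar> \<le> max \<bar>v $ i\<bar> (int N)" "\<bar>v $ i - x\<bar> \<le> int N" if "x \<in> X i" for x i
      using that by (auto simp: X_def split: if_splits)
    define A where "A = {x :: int ^ 'n. \<forall>i. x $ i \<in> X i}"
    have A: "finite A" "card A = (N + 1) ^ ?d"
      using box_card[OF Xcard(1)] Xcard by (simp_all add: A_def)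
    have low: "3 / 4 / (K * R) ^ ?d \<le> heat H (v + u - x)" if "x \<in> A" for x
    proof -
      \<comment> \<open>The displacement is at most \<open>2 * R\<close> from \<open>u\<close> plus \<open>N \<le> R\<close> from \<open>x\<close>.\<close>
      define N' where "N' = nat \<lceil>3 * R\<rceil>"
      have N': "real N' \<le> 4 * R" "3 * R \<le> real N'" using R unfolding N'_def by linarith+
      have "real N' ^ 2 \<le> (4 * R)\<^sup>2" using N' by (intro power_mono) auto
      also have "\<dots> \<le> 16 / \<delta> * H" using H assms by (simp add: power_mult_distrib field_simps)
      finally have sq: "real N' ^ 2 \<le> 16 / \<delta> * H" .
      have "\<bar>(v + u - x) $ i\<bar> \<le> int N'" for i
      proof -
        have "\<bar>v $ i - x $ i\<bar> \<le> int N" using that X(2) by (auto simp: A_def)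
        then have "real_of_int \<bar>v $ i - x $ i\<bar> \<le> R" using N(2) by linarith
        moreover have "real_of_int \<bar>u $ i\<bar> \<le> 2 * R" using u by simp
        ultimately have "real_of_int \<bar>(v + u - x) $ i\<bar> \<le> real N'" using N'(2) by (simp add: algebra_simps)
        then show ?thesis by linarith
      qed
      from heat_lower[OF H1 sq this]
      have "3 / 4 / (exp (2 * real ?d * (16 / \<delta>)) * (5 * sqrt H)) ^ ?d \<le> heat H (v + u - x)" .
      moreover have "exp (2 * real ?d * (16 / \<delta>)) * (5 * sqrt H) \<le> K * R"
      proof -
        have "sqrt H \<le> sqrt (R\<^sup>2 / \<delta>)" using H assms by (intro real_sqrt_le_mono) (simp add: field_simps)
        also have "\<dots> = R / sqrt \<delta>" using R by (simp add: real_sqrt_divide)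
        finally have "exp (2 * real ?d * (16 / \<delta>)) * 5 * sqrt H \<le> exp (2 * real ?d * (16 / \<delta>)) * 5 * (R / sqrt \<delta>)"
          by (rule mult_left_mono) simp
        then show ?thesis by (simp add: K_def mult_ac)
      qed
      then have "3 / 4 / (K * R) ^ ?d \<le> 3 / 4 / (exp (2 * real ?d * (16 / \<delta>)) * (5 * sqrt H)) ^ ?d"
        using H1 by (intro divide_left_mono power_mono mult_pos_pos zero_less_power) (use pos R in auto)
      ultimately show ?thesis by simp
    qed
    have comp: "heat t v / E \<le> heat t x" if "x \<in> A" for x
    proof -
      have "heat t v \<le> exp (2 * real ?d * 1) ^ ?d * heat t x"
        using that X(1) by (intro heat_comparison[OF t N2]) (auto simp: A_def)
      then show ?thesis using pos(1) by (simp add: E_def divide_le_eq mult_ac)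
    qed
    have "(real N + 1) ^ ?d * (heat t v / E * (3 / 4 / (K * R) ^ ?d)) = (\<Sum>x\<in>A. heat t v / E * (3 / 4 / (K * R) ^ ?d))"
      by (simp add: A add_ac)
    also have "\<dots> \<le> (\<Sum>x\<in>A. heat t x * heat H (v + u - x))"
      using pos R by (intro sum_mono mult_mono comp low) auto
    also have "\<dots> \<le> heat (t + H) (v + u)"
      using t H1 A by (intro sum_heat_le_heat_add) auto
    finally have "heat t v * (real N + 1) ^ ?d \<le> C * R ^ ?d * heat (t + H) (v + u)"
      using pos R by (simp add: C_def field_simps power_mult_distrib)
    moreover have "heat t v * max 1 (min (sqrt t) R) ^ ?d \<le> heat t v * (real N + 1) ^ ?d"
      using N by (intro mult_left_mono power_mono) auto
    ultimately have "heat t v * max 1 (min (sqrt t) R) ^ ?d \<le> C * R ^ ?d * heat (t + H) (v + u)" by simp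
    moreover have "0 < max 1 (min (sqrt t) R) ^ ?d" by simp
    ultimately show "heat t v \<le> C * smoothing_loss ?d R t * heat (t + H) (v + u)"
      unfolding smoothing_loss_def power_divide by (simp add: pos_le_divide_eq mult_ac)
  qed
qed

section \<open>Mixed Poisson laws\<close>

lemma measurable_pmf_pois [measurable]: "(\<lambda>t. pmf (pois t) j) \<in> borel_measurable borel"
proof -
  have "(\<lambda>t. pmf (pois t) j) = (\<lambda>t. if 0 \<le> t then t ^ j / fact j * exp (- t) else if j = 0 then 1 else 0)"
    by (auto simp: fun_eq_iff pmf_pois) (auto simp: pois_def)
  then show ?thesis by simp
qed

lemma nn_integral_pois: "(\<integral>\<^sup>+j. f j \<partial>pois t) = (\<Sum>j. ennreal (pmf (pois t) j) * f j)"
  by (simp add: nn_integral_measure_pmf nn_integral_count_space_nat)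

lemma measurable_nn_integral_pois [measurable]:
  assumes "\<And>j. f j \<in> borel_measurable borel"
  shows "(\<lambda>t. \<integral>\<^sup>+j. f j t \<partial>pois t) \<in> borel_measurable borel"
  unfolding nn_integral_pois using assms by measurable

lemma measurable_heat [measurable]: "(\<lambda>t. heat t v) \<in> borel_measurable borel"
proof -
  have "(\<lambda>t. enn2real (ennreal (heat t v))) \<in> borel_measurable borel"
    unfolding ennreal_heat by measurable
  then show ?thesis by simp
qed

lemma nn_integral_pmf_swap:
  fixes P :: "'a :: countable pmf"
  assumes "sigma_finite_measure M" "\<And>x. f x \<in> borel_measurable M"
  shows "(\<integral>\<^sup>+t. (\<integral>\<^sup>+x. f x t \<partial>P) \<partial>M) = (\<integral>\<^sup>+x. (\<integral>\<^sup>+t. f x t \<partial>M) \<partial>P)"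
proof -
  interpret M: sigma_finite_measure M by fact
  interpret pair_sigma_finite "measure_pmf P" M ..
  have "(\<lambda>(x, t). f x t) \<in> borel_measurable (count_space UNIV \<Otimes>\<^sub>M M)"
    by (rule measurable_pair_measure_countable1) (use assms(2) in auto)
  then have "(\<lambda>(x, t). f x t) \<in> borel_measurable (measure_pmf P \<Otimes>\<^sub>M M)"
    by (subst measurable_cong_sets[OF sets_pair_measure_cong refl]) auto
  from Fubini'[OF this] show ?thesis by simp
qed

text \<open>For \<open>\<nu> = gap_law \<mu>\<close>, introduced below, this is the law of \<open>\<theta>\<^sub>n\<close>.\<close>

primrec conv_pow :: "real measure \<Rightarrow> nat \<Rightarrow> real measure" where
  "conv_pow \<nu> 0 = return borel 0"
| "conv_pow \<nu> (Suc n) = (\<nu> \<star> conv_pow \<nu> n)"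

locale step_distribution = prob_space \<nu> for \<nu> :: "real measure" +
  assumes sets_step [measurable_cong]: "sets \<nu> = sets borel"
    and step_pos: "AE r in \<nu>. 0 < r"
begin

lemma sets_conv_pow [measurable_cong, simp]: "sets (conv_pow \<nu> n) = sets borel"
  by (induction n) auto

lemma prob_space_conv_pow: "prob_space (conv_pow \<nu> n)"
proof (induction n)
  case 0
  show ?case by (simp add: prob_space_return)
next
  case (Suc n)
  then interpret T: prob_space "conv_pow \<nu> n" .
  interpret pair_prob_space \<nu> "conv_pow \<nu> n" ..
  show ?case unfolding conv_pow.simps convolution_def
    by (rule prob_space_distr) measurable
qed

lemma sigma_finite_conv_pow: "sigma_finite_measure (conv_pow \<nu> n)"
  using prob_space_conv_pow[of n] by (simp add: prob_space_imp_sigma_finite)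

lemma measurable_nn_integral_conv_pow:
  assumes [measurable]: "f \<in> borel_measurable borel"
  shows "(\<lambda>x. \<integral>\<^sup>+y. f (x + y) \<partial>conv_pow \<nu> n) \<in> borel_measurable borel"
proof -
  interpret T: sigma_finite_measure "conv_pow \<nu> n" by (rule sigma_finite_conv_pow)
  show ?thesis by measurable
qed

lemma nn_integral_conv_pow_Suc:
  assumes "f \<in> borel_measurable borel"
  shows "(\<integral>\<^sup>+t. f t \<partial>conv_pow \<nu> (Suc n)) = (\<integral>\<^sup>+r. (\<integral>\<^sup>+t. f (r + t) \<partial>conv_pow \<nu> n) \<partial>\<nu>)"
  unfolding conv_pow.simps using assms prob_space_conv_pow[of n]
  by (intro nn_integral_convolution) (auto simp: sets_step prob_space.finite_measure finite_measure_axioms)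

lemma nn_integral_conv_pow_add:
  assumes f: "f \<in> borel_measurable borel"
  shows "(\<integral>\<^sup>+t. f t \<partial>conv_pow \<nu> (m + n)) = (\<integral>\<^sup>+s. (\<integral>\<^sup>+t. f (s + t) \<partial>conv_pow \<nu> n) \<partial>conv_pow \<nu> m)"
  using f
proof (induction m arbitrary: f)
  case 0
  then show ?case
    using measurable_nn_integral_conv_pow[OF 0, of n] by (simp add: nn_integral_return)
next
  case (Suc m)
  have "(\<integral>\<^sup>+t. f t \<partial>conv_pow \<nu> (Suc (m + n))) = (\<integral>\<^sup>+r. (\<integral>\<^sup>+t. f (r + t) \<partial>conv_pow \<nu> (m + n)) \<partial>\<nu>)"
    by (rule nn_integral_conv_pow_Suc[OF Suc.prems])
  also have "\<dots> = (\<integral>\<^sup>+r. (\<integral>\<^sup>+s. (\<integral>\<^sup>+t. f (r + s + t) \<partial>conv_pow \<nu> n) \<partial>conv_pow \<nu> m) \<partial>\<nu>)"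
    using Suc.prems by (intro nn_integral_cong) (subst Suc.IH, auto simp: add.assoc)
  also have "\<dots> = (\<integral>\<^sup>+s. (\<integral>\<^sup>+t. f (s + t) \<partial>conv_pow \<nu> n) \<partial>conv_pow \<nu> (Suc m))"
    by (rule nn_integral_conv_pow_Suc[symmetric, OF measurable_nn_integral_conv_pow[OF Suc.prems]])
  finally show ?case by simp
qed

lemma conv_pow_nonneg: "AE t in conv_pow \<nu> n. 0 \<le> t"
proof (induction n)
  case 0
  show ?case unfolding conv_pow.simps by (subst AE_return) auto
next
  case (Suc n)
  have "(\<integral>\<^sup>+t. indicator {..<0} t \<partial>conv_pow \<nu> (Suc n)) =
      (\<integral>\<^sup>+r. (\<integral>\<^sup>+t. indicator {..<0} (r + t) \<partial>conv_pow \<nu> n) \<partial>\<nu>)"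
    by (rule nn_integral_conv_pow_Suc) simp
  also have "\<dots> = (\<integral>\<^sup>+r. 0 \<partial>\<nu>)"
  proof (rule nn_integral_cong_AE)
    show "AE r in \<nu>. (\<integral>\<^sup>+t. indicator {..<0} (r + t) \<partial>conv_pow \<nu> n) = 0"
      using step_pos
    proof eventually_elim
      case (elim r)
      have "(\<integral>\<^sup>+t. indicator {..<0} (r + t) \<partial>conv_pow \<nu> n) = (\<integral>\<^sup>+t. 0 \<partial>conv_pow \<nu> n)"
        by (rule nn_integral_cong_AE, use Suc in eventually_elim) (use elim in \<open>auto simp: indicator_def\<close>)
      then show ?case by simp
    qed
  qed
  finally have "emeasure (conv_pow \<nu> (Suc n)) {..<0} = 0" by simp
  then show ?case
    by (intro AE_I[of _ _ "{..<0}"]) auto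
qed

lemma conv_pow_pos:
  assumes "0 < n"
  shows "AE t in conv_pow \<nu> n. 0 < t"
proof -
  obtain m where n: "n = Suc m" using assms by (cases n) auto
  have "(\<integral>\<^sup>+t. indicator {..0} t \<partial>conv_pow \<nu> (Suc m)) =
      (\<integral>\<^sup>+r. (\<integral>\<^sup>+t. indicator {..0} (r + t) \<partial>conv_pow \<nu> m) \<partial>\<nu>)"
    by (rule nn_integral_conv_pow_Suc) simp
  also have "\<dots> = (\<integral>\<^sup>+r. 0 \<partial>\<nu>)"
  proof (rule nn_integral_cong_AE)
    show "AE r in \<nu>. (\<integral>\<^sup>+t. indicator {..0} (r + t) \<partial>conv_pow \<nu> m) = 0"
      using step_pos
    proof eventually_elim
      case (elim r)
      have "(\<integral>\<^sup>+t. indicator {..0} (r + t) \<partial>conv_pow \<nu> m) = (\<integral>\<^sup>+t. 0 \<partial>conv_pow \<nu> m)"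
        by (rule nn_integral_cong_AE, use conv_pow_nonneg[of m] in eventually_elim)
           (use elim in \<open>auto simp: indicator_def\<close>)
      then show ?case by simp
    qed
  qed
  finally have "emeasure (conv_pow \<nu> (Suc m)) {..0} = 0" by simp
  then show ?thesis unfolding n
    by (intro AE_I[of _ _ "{..0}"]) auto
qed

lemma conv_pow_Laplace:
  "(\<integral>\<^sup>+t. ennreal (exp (- l * t)) \<partial>conv_pow \<nu> n) = (\<integral>\<^sup>+r. ennreal (exp (- l * r)) \<partial>\<nu>) ^ n"
proof (induction n)
  case 0
  show ?case by (simp add: nn_integral_return)
next
  case (Suc n)
  have "(\<integral>\<^sup>+t. ennreal (exp (- l * t)) \<partial>conv_pow \<nu> (Suc n)) =
      (\<integral>\<^sup>+r. (\<integral>\<^sup>+t. ennreal (exp (- l * (r + t))) \<partial>conv_pow \<nu> n) \<partial>\<nu>)"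
    by (rule nn_integral_conv_pow_Suc) simp
  also have "\<dots> = (\<integral>\<^sup>+r. ennreal (exp (- l * r)) * (\<integral>\<^sup>+t. ennreal (exp (- l * t)) \<partial>conv_pow \<nu> n) \<partial>\<nu>)"
    by (subst nn_integral_cmult[symmetric])
       (auto simp: ring_distribs exp_add exp_diff exp_minus ennreal_mult'[symmetric] field_simps)
  also have "\<dots> = (\<integral>\<^sup>+r. ennreal (exp (- l * r)) \<partial>\<nu>) * (\<integral>\<^sup>+t. ennreal (exp (- l * t)) \<partial>conv_pow \<nu> n)"
    by (rule nn_integral_multc) measurable
  finally show ?case by (simp only: Suc power_Suc)
qed

text \<open>If one variable is \<open>1\<close> plus a Poisson variable with random rate, then a sum of \<open>n\<close> of them is
  \<open>n\<close> plus a Poisson variable whose rate is the sum of the rates.\<close>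

lemma nn_integral_iid_sum_mixed_Poisson:
  fixes J :: "nat pmf" and f :: "nat \<Rightarrow> ennreal"
  assumes J: "\<And>f. (\<integral>\<^sup>+m. f m \<partial>J) = (\<integral>\<^sup>+r. (\<integral>\<^sup>+j. f (Suc j) \<partial>pois r) \<partial>\<nu>)"
  shows "(\<integral>\<^sup>+m. f m \<partial>iid_sum J n) = (\<integral>\<^sup>+t. (\<integral>\<^sup>+j. f (n + j) \<partial>pois t) \<partial>conv_pow \<nu> n)"
proof (induction n arbitrary: f)
  case 0
  have "pois 0 = return_pmf 0" by (simp add: pois_def)
  moreover have "(\<lambda>t. \<integral>\<^sup>+j. f (0 + j) \<partial>pois t) \<in> borel_measurable borel"
    by (rule measurable_nn_integral_pois) simp
  ultimately show ?case unfolding conv_pow.simps by (subst nn_integral_return) auto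
next
  case (Suc n)
  have m: "(\<lambda>t. \<integral>\<^sup>+l. g l \<partial>pois t) \<in> borel_measurable borel" for g
    by (rule measurable_nn_integral_pois) simp
  have "(\<integral>\<^sup>+m. f m \<partial>iid_sum J (Suc n)) = (\<integral>\<^sup>+r. (\<integral>\<^sup>+m. f (r + m) \<partial>iid_sum J n) \<partial>J)"
    by simp
  also have "\<dots> = (\<integral>\<^sup>+r. (\<integral>\<^sup>+j. (\<integral>\<^sup>+m. f (Suc j + m) \<partial>iid_sum J n) \<partial>pois r) \<partial>\<nu>)"
    by (rule J)
  also have "\<dots> = (\<integral>\<^sup>+r. (\<integral>\<^sup>+j. (\<integral>\<^sup>+t. (\<integral>\<^sup>+l. f (Suc j + (n + l)) \<partial>pois t) \<partial>conv_pow \<nu> n) \<partial>pois r) \<partial>\<nu>)"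
    by (simp only: Suc.IH)
  also have "\<dots> = (\<integral>\<^sup>+r. (\<integral>\<^sup>+t. (\<integral>\<^sup>+j. (\<integral>\<^sup>+l. f (Suc j + (n + l)) \<partial>pois t) \<partial>pois r) \<partial>conv_pow \<nu> n) \<partial>\<nu>)"
    by (subst nn_integral_pmf_swap[OF sigma_finite_conv_pow]) (use m in \<open>auto\<close>)
  also have "\<dots> = (\<integral>\<^sup>+r. (\<integral>\<^sup>+t. (\<integral>\<^sup>+j. f (Suc n + j) \<partial>pois (r + t)) \<partial>conv_pow \<nu> n) \<partial>\<nu>)"
  proof (rule nn_integral_cong_AE)
    show "AE r in \<nu>. (\<integral>\<^sup>+t. (\<integral>\<^sup>+j. (\<integral>\<^sup>+l. f (Suc j + (n + l)) \<partial>pois t) \<partial>pois r) \<partial>conv_pow \<nu> n) =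
        (\<integral>\<^sup>+t. (\<integral>\<^sup>+j. f (Suc n + j) \<partial>pois (r + t)) \<partial>conv_pow \<nu> n)"
      using step_pos
    proof eventually_elim
      case (elim r)
      show ?case using conv_pow_nonneg[of n]
      proof (intro nn_integral_cong_AE, eventually_elim)
        case (elim t)
        then show ?case using \<open>0 < r\<close> by (simp add: pois_add add_ac)
      qed
    qed
  qed
  also have "\<dots> = (\<integral>\<^sup>+t. (\<integral>\<^sup>+j. f (Suc n + j) \<partial>pois t) \<partial>conv_pow \<nu> (Suc n))"
    by (rule nn_integral_conv_pow_Suc[symmetric]) (rule m)
  finally show ?case .
qed

end

section \<open>The jump law of the subordinator\<close>

text \<open>Given a Poisson clock run up to time \<open>t\<close> with at least one ring, let \<open>r\<close> be the time left after the
  first ring. Its density is \<open>exp (r - t) / (1 - exp (- t))\<close> on \<open>(0, t)\<close>. A jump of the subordinator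
  picks \<open>t\<close> from \<open>(1 - exp (- t)) \<mu>(dt)\<close>, a probability measure because \<open>\<phi> 1 = 1\<close>; the law of \<open>r\<close>
  is then the one below.\<close>

definition gap_law :: "real measure \<Rightarrow> real measure" where
  "gap_law \<mu> = density lborel (\<lambda>r. indicator {0<..} r * (\<integral>\<^sup>+t. indicator {r..} t * ennreal (exp (r - t)) \<partial>\<mu>))"

locale bernstein =
  fixes \<phi> :: "real \<Rightarrow> real" and \<mu> :: "real measure"
  assumes bernstein: "complete_Bernstein_no_drift \<phi> \<mu>" and phi_1: "\<phi> 1 = 1"
begin

lemma Levy_density: "\<exists>w. w \<in> borel_measurable borel \<and> \<mu> = density lborel w \<and> (\<forall>t. w t \<noteq> \<infinity>) \<and> (\<forall>t\<le>0. w t = 0)"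
proof -
  obtain m where m: "completely_monotone m" and \<mu>: "\<mu> = density lborel (\<lambda>t. ennreal (m t) * indicator {0<..} t)"
    using bernstein unfolding complete_Bernstein_no_drift_def by blast
  have "continuous_on {0<..} m"
    using m unfolding completely_monotone_def
    by (intro continuous_at_imp_continuous_on ballI field_differentiable_imp_continuous_at)
       (metis funpow_0 greaterThan_iff)
  then have "(\<lambda>t. indicator {0<..} t *\<^sub>R m t) \<in> borel_measurable borel"
    by (intro borel_measurable_continuous_on_indicator) auto
  then have "(\<lambda>t. ennreal (indicator {0<..} t *\<^sub>R m t)) \<in> borel_measurable borel" by measurable
  moreover have "(\<lambda>t. ennreal (indicator {0<..} t *\<^sub>R m t)) = (\<lambda>t. ennreal (m t) * indicator {0<..} t)"
    by (auto simp: indicator_def)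
  ultimately show ?thesis using \<mu>
    by (intro exI[of _ "\<lambda>t. ennreal (m t) * indicator {0<..} t"]) (auto simp: indicator_def ennreal_mult_eq_top_iff)
qed

lemma sets_mu [measurable_cong]: "sets \<mu> = sets borel"
  using Levy_density by auto

lemma sigma_finite_mu: "sigma_finite_measure \<mu>"
proof -
  obtain w where "w \<in> borel_measurable lborel" "\<mu> = density lborel w" "\<forall>t. w t \<noteq> \<infinity>"
    using Levy_density by auto
  then show ?thesis
    by (simp add: sigma_finite_measure.sigma_finite_iff_density_finite[OF sigma_finite_lborel])
qed

lemma mu_pos: "AE t in \<mu>. 0 < t"
proof -
  obtain w where w: "w \<in> borel_measurable borel" "\<mu> = density lborel w" "\<And>t. t \<le> 0 \<Longrightarrow> w t = 0"
    using Levy_density by blast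
  show ?thesis unfolding w(2) using w(1) w(3) by (subst AE_density) (auto simp: not_le[symmetric])
qed

lemma nn_integral_min_finite: "(\<integral>\<^sup>+t. ennreal (min 1 t) \<partial>\<mu>) < \<infinity>"
proof -
  have "(\<integral>\<^sup>+t. ennreal (min 1 t) \<partial>\<mu>) = (\<integral>\<^sup>+t\<in>{0<..}. ennreal (min 1 t) \<partial>\<mu>)"
    by (rule nn_integral_cong_AE, use mu_pos in eventually_elim) auto
  then show ?thesis using bernstein unfolding complete_Bernstein_no_drift_def by simp
qed

lemma integrable_mu:
  assumes [measurable]: "f \<in> borel_measurable borel"
    and f: "\<And>t. 0 < t \<Longrightarrow> 0 \<le> f t \<and> f t \<le> c * min 1 t"
  shows "integrable \<mu> f"
proof (rule Bochner_Integration.integrable_bound[of _ "\<lambda>t. c * min 1 t"])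
  have "integrable \<mu> (\<lambda>t. min 1 t)"
  proof (rule integrableI_nonneg)
    show "AE t in \<mu>. 0 \<le> min 1 t" using mu_pos by eventually_elim simp
  qed (use nn_integral_min_finite in auto)
  then show "integrable \<mu> (\<lambda>t. c * min 1 t)" by simp
  show "AE t in \<mu>. norm (f t) \<le> norm (c * min 1 t)"
    using mu_pos by eventually_elim (use f in force)
qed measurable

lemma one_minus_exp_le: "0 \<le> u \<Longrightarrow> 0 < t \<Longrightarrow> 1 - exp (- u * t) \<le> max 1 u * min 1 (t::real)"
proof -
  assume u: "0 \<le> u" and t: "0 < t"
  have "1 - exp (- u * t) \<le> u * t" using exp_ge_add_one_self[of "- u * t"] by simp
  also have "\<dots> \<le> max 1 u * t" using t by (intro mult_right_mono) auto
  finally have 1: "1 - exp (- u * t) \<le> max 1 u * t" .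
  have 2: "1 - exp (- u * t) \<le> max 1 u * 1" using exp_gt_zero[of "- u * t"] by linarith
  show ?thesis using 1 2 by (cases "t \<le> 1") (auto simp: min_def)
qed

lemma integrable_one_minus_exp: "0 \<le> u \<Longrightarrow> integrable \<mu> (\<lambda>t. 1 - exp (- u * t))"
  by (rule integrable_mu[of _ "max 1 u"]) (use one_minus_exp_le in auto)

lemma phi_eq: "0 \<le> u \<Longrightarrow> \<phi> u = (\<integral>t. 1 - exp (- u * t) \<partial>\<mu>)"
proof -
  assume u: "0 \<le> u"
  have "\<phi> u = (LINT t:{0<..}|\<mu>. 1 - exp (- u * t))"
    using bernstein u unfolding complete_Bernstein_no_drift_def by simp
  also have "\<dots> = (\<integral>t. 1 - exp (- u * t) \<partial>\<mu>)"
    unfolding set_lebesgue_integral_def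
    by (rule integral_cong_AE, measurable, use mu_pos in eventually_elim) auto
  finally show ?thesis .
qed

lemma nn_integral_gap_law:
  assumes [measurable]: "f \<in> borel_measurable borel"
  shows "(\<integral>\<^sup>+r. f r \<partial>gap_law \<mu>) = (\<integral>\<^sup>+t. (\<integral>\<^sup>+r. ennreal (exp (r - t)) * f r * indicator {0..t} r \<partial>lborel) \<partial>\<mu>)"
proof -
  interpret mu: sigma_finite_measure \<mu> by (rule sigma_finite_mu)
  interpret pair_sigma_finite lborel \<mu> ..
  have m[measurable]: "(\<lambda>r. indicator {0<..} r * (\<integral>\<^sup>+t. indicator {r..} t * ennreal (exp (r - t)) \<partial>\<mu>)) \<in> borel_measurable borel"
  proof -
    have [measurable]: "Measurable.pred (borel \<Otimes>\<^sub>M \<mu>) (\<lambda>x. snd x \<in> {fst x..})" by simp measurable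
    show ?thesis by measurable
  qed
  have [measurable]: "Measurable.pred (lborel \<Otimes>\<^sub>M \<mu>) (\<lambda>x. snd x \<in> {fst x..})" by simp measurable
  have "(\<integral>\<^sup>+r. f r \<partial>gap_law \<mu>) = (\<integral>\<^sup>+r. (\<integral>\<^sup>+t. f r * indicator {0<..} r * (indicator {r..} t * ennreal (exp (r - t))) \<partial>\<mu>) \<partial>lborel)"
  proof -
    have "(\<integral>\<^sup>+t. f r * indicator {0<..} r * (indicator {r..} t * ennreal (exp (r - t))) \<partial>\<mu>) =
        f r * indicator {0<..} r * (\<integral>\<^sup>+t. indicator {r..} t * ennreal (exp (r - t)) \<partial>\<mu>)" for r
      by (rule nn_integral_cmult) measurable
    then show ?thesis
      unfolding gap_law_def by (subst nn_integral_density) (auto simp: mult_ac)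
  qed
  also have "\<dots> = (\<integral>\<^sup>+t. (\<integral>\<^sup>+r. f r * indicator {0<..} r * (indicator {r..} t * ennreal (exp (r - t))) \<partial>lborel) \<partial>\<mu>)"
    by (rule Fubini'[symmetric]) measurable
  also have "\<dots> = (\<integral>\<^sup>+t. (\<integral>\<^sup>+r. ennreal (exp (r - t)) * f r * indicator {0..t} r \<partial>lborel) \<partial>\<mu>)"
  proof (rule nn_integral_cong, rule nn_integral_cong_AE)
    fix t
    have "AE r in lborel. r \<noteq> (0::real)" by (rule AE_lborel_singleton)
    then show "AE r in lborel. f r * indicator {0<..} r * (indicator {r..} t * ennreal (exp (r - t))) =
       ennreal (exp (r - t)) * f r * indicator {0..t} r"
      by eventually_elim (auto simp: indicator_def mult_ac)
  qed
  finally show ?thesis .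
qed

text \<open>The inner integral over \<open>r\<close> is \<open>(exp (- l t) - exp (- t)) / (1 - l)\<close>, whose \<open>\<mu>\<close>-integral is a
  difference of values of \<open>\<phi>\<close>.\<close>

lemma gap_law_Laplace:
  assumes l: "0 \<le> l" "l < 1"
  shows "(\<integral>\<^sup>+r. ennreal (exp (- l * r)) \<partial>gap_law \<mu>) = ennreal ((1 - \<phi> l) / (1 - l))"
proof -
  have inner: "(\<integral>\<^sup>+r. ennreal (exp (r - t)) * ennreal (exp (- l * r)) * indicator {0..t} r \<partial>lborel) =
      ennreal ((exp (- l * t) - exp (- t)) / (1 - l))" if "0 < t" for t
  proof -
    have "(\<integral>\<^sup>+r. ennreal (exp (r - t)) * ennreal (exp (- l * r)) * indicator {0..t} r \<partial>lborel) =
       (\<integral>\<^sup>+r. ennreal (exp ((1 - l) * r - t)) * indicator {0..t} r \<partial>lborel)"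
      by (intro nn_integral_cong) (simp add: ennreal_mult'[symmetric] algebra_simps flip: exp_add)
    also have "\<dots> = ennreal (exp ((1 - l) * t - t) / (1 - l) - exp ((1 - l) * 0 - t) / (1 - l))"
      using l that by (intro nn_integral_FTC_Icc) (auto intro!: derivative_eq_intros)
    also have "exp ((1 - l) * t - t) / (1 - l) - exp ((1 - l) * 0 - t) / (1 - l) = (exp (- l * t) - exp (- t)) / (1 - l)"
      by (simp add: diff_divide_distrib algebra_simps)
    finally show ?thesis .
  qed
  have i1: "integrable \<mu> (\<lambda>t. 1 - exp (- 1 * t))" and il: "integrable \<mu> (\<lambda>t. 1 - exp (- l * t))"
    using integrable_one_minus_exp[of 1] integrable_one_minus_exp[of l] l by auto
  have "(\<integral>\<^sup>+r. ennreal (exp (- l * r)) \<partial>gap_law \<mu>) = (\<integral>\<^sup>+t. ennreal (((1 - exp (- 1 * t)) - (1 - exp (- l * t))) / (1 - l)) \<partial>\<mu>)"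
    by (subst nn_integral_gap_law, measurable, rule nn_integral_cong_AE, use mu_pos in eventually_elim)
       (simp add: inner[simplified])
  also have "\<dots> = ennreal (\<integral>t. ((1 - exp (- 1 * t)) - (1 - exp (- l * t))) / (1 - l) \<partial>\<mu>)"
  proof (rule nn_integral_eq_integral)
    show "integrable \<mu> (\<lambda>t. ((1 - exp (- 1 * t)) - (1 - exp (- l * t))) / (1 - l))"
      by (rule Bochner_Integration.integrable_divide[OF Bochner_Integration.integrable_diff[OF i1 il]])
    show "AE t in \<mu>. 0 \<le> ((1 - exp (- 1 * t)) - (1 - exp (- l * t))) / (1 - l)"
      using mu_pos
    proof eventually_elim
      case (elim t)
      then have "exp (- 1 * t) \<le> exp (- l * t)" using l by simp
      then show ?case using l by simp
    qed
  qed
  also have "(\<integral>t. ((1 - exp (- 1 * t)) - (1 - exp (- l * t))) / (1 - l) \<partial>\<mu>) = (\<phi> 1 - \<phi> l) / (1 - l)"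
    using i1 il l by (simp only: integral_divide_zero Bochner_Integration.integral_diff phi_eq[of 1] phi_eq[of l])
  finally show ?thesis by (simp add: phi_1)
qed

lemma phi_0: "\<phi> 0 = 0"
  using phi_eq[of 0] by simp

lemma gap_step_distribution: "step_distribution (gap_law \<mu>)"
proof -
  have "emeasure (gap_law \<mu>) (space (gap_law \<mu>)) = (\<integral>\<^sup>+r. ennreal (exp (- 0 * r)) \<partial>gap_law \<mu>)"
    by simp
  also have "\<dots> = 1" by (subst gap_law_Laplace) (auto simp: phi_0)
  finally have "emeasure (gap_law \<mu>) (space (gap_law \<mu>)) = 1" .
  moreover have "AE r in gap_law \<mu>. 0 < r"
  proof -
    have "(\<integral>\<^sup>+r. indicator {..0} r \<partial>gap_law \<mu>) =
        (\<integral>\<^sup>+t. (\<integral>\<^sup>+r. ennreal (exp (r - t)) * indicator {..0} r * indicator {0..t} r \<partial>lborel) \<partial>\<mu>)"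
      by (rule nn_integral_gap_law) simp
    also have "\<dots> = (\<integral>\<^sup>+t. (\<integral>\<^sup>+r. 0 \<partial>(lborel :: real measure)) \<partial>\<mu>)"
    proof (rule nn_integral_cong, rule nn_integral_cong_AE)
      fix t
      have "AE r in lborel. r \<noteq> (0::real)" by (rule AE_lborel_singleton)
      then show "AE r in lborel. ennreal (exp (r - t)) * indicator {..0} r * indicator {0..t} r = 0"
        by eventually_elim (auto simp: indicator_def)
    qed
    finally have "emeasure (gap_law \<mu>) {..0} = 0" by (simp add: gap_law_def)
    then show ?thesis by (intro AE_I[of _ _ "{..0}"]) (auto simp: gap_law_def)
  qed
  moreover have "sets (gap_law \<mu>) = sets borel" by (simp add: gap_law_def)
  ultimately show ?thesis
    by (intro step_distribution.intro prob_spaceI step_distribution_axioms.intro)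
qed

lemma jump_weight_ennreal:
  assumes "0 < m"
  shows "ennreal (jump_weight \<mu> m) = (\<integral>\<^sup>+t. ennreal (t ^ m * exp (- t) / fact m) \<partial>\<mu>)"
proof -
  obtain k where m: "m = Suc k" using assms by (cases m) auto
  have pow: "t ^ j / fact j \<le> exp t" if "0 < t" for t :: real and j
  proof -
    have "(\<Sum>i\<in>{j}. t ^ i / fact i) \<le> (\<Sum>i. t ^ i / fact i)"
      using exp_converges[of t] that by (intro sum_le_suminf) (auto simp: sums_iff divide_inverse mult_ac)
    then show ?thesis by (simp add: exp_def divide_inverse mult_ac)
  qed
  have bound: "0 \<le> t ^ m * exp (- t) / fact m \<and> t ^ m * exp (- t) / fact m \<le> 1 * min 1 t" if t: "0 < t" for t :: real
  proof -
    have 1: "t ^ m * exp (- t) / fact m \<le> 1"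
      using mult_right_mono[OF pow[OF t, of m], of "exp (- t)"] by (simp add: exp_minus_inverse)
    have "t ^ k * exp (- t) / fact k \<le> 1"
      using mult_right_mono[OF pow[OF t, of k], of "exp (- t)"] by (simp add: exp_minus_inverse)
    moreover have "t ^ m * exp (- t) / fact m = t * (t ^ k * exp (- t) / fact k) / real m"
      by (simp add: m mult_ac del: of_nat_Suc)
    ultimately have "t ^ m * exp (- t) / fact m \<le> t * 1 / real m"
      using t assms by (simp only:) (intro divide_right_mono mult_left_mono, auto)
    also have "\<dots> \<le> t" using t assms by (simp add: divide_le_eq)
    finally show ?thesis using 1 t by simp
  qed
  have int: "integrable \<mu> (\<lambda>t. t ^ m * exp (- t) / fact m)"
    by (rule integrable_mu[of _ 1]) (use bound in auto)
  have "jump_weight \<mu> m = (\<integral>t. t ^ m * exp (- t) / fact m \<partial>\<mu>)"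
    unfolding jump_weight_def set_lebesgue_integral_def
    by (subst Bochner_Integration.integral_divide_zero[symmetric], rule integral_cong_AE, measurable,
        use mu_pos in eventually_elim) auto
  moreover have "AE t in \<mu>. 0 \<le> t ^ m * exp (- t) / fact m"
    using mu_pos by eventually_elim (use bound in auto)
  ultimately show ?thesis using nn_integral_eq_integral[OF int] by simp
qed

text \<open>For a fixed end time \<open>t\<close> the claim is \<open>(\<integral>r\<in>{0..t}. r\<^sup>j / j! dr) = t\<^sup>j\<^sup>+\<^sup>1 / (j+1)!\<close>.\<close>

lemma subordinator_jump_mixed_Poisson:
  "(\<integral>\<^sup>+m. f m \<partial>subordinator_jump \<mu>) = (\<integral>\<^sup>+r. (\<integral>\<^sup>+j. f (Suc j) \<partial>pois r) \<partial>gap_law \<mu>)"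
proof -
  interpret step_distribution "gap_law \<mu>" by (rule gap_step_distribution)
  have w: "(\<integral>\<^sup>+r. ennreal (pmf (pois r) j) \<partial>gap_law \<mu>) = ennreal (jump_weight \<mu> (Suc j))" for j
  proof -
    have inner: "(\<integral>\<^sup>+r. ennreal (exp (r - t)) * ennreal (pmf (pois r) j) * indicator {0..t} r \<partial>lborel) =
       ennreal (t ^ Suc j * exp (- t) / fact (Suc j))" if t: "0 < t" for t
    proof -
      have "(\<integral>\<^sup>+r. ennreal (exp (r - t)) * ennreal (pmf (pois r) j) * indicator {0..t} r \<partial>lborel) =
        (\<integral>\<^sup>+r. ennreal (r ^ j / fact j * exp (- t)) * indicator {0..t} r \<partial>lborel)"
      proof (intro nn_integral_cong)
        fix r
        have "exp (r - t) * exp (- r) = exp (- t)" by (simp flip: exp_add)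
        then have "exp (r - t) * (r ^ j / fact j * exp (- r)) = r ^ j / fact j * exp (- t)"
          by (simp add: mult_ac)
        then show "ennreal (exp (r - t)) * ennreal (pmf (pois r) j) * indicator {0..t} r =
          ennreal (r ^ j / fact j * exp (- t)) * indicator {0..t} r"
          by (auto simp: indicator_def pmf_pois ennreal_mult'[symmetric])
      qed
      also have "\<dots> = ennreal (t ^ Suc j / fact (Suc j) * exp (- t) - 0 ^ Suc j / fact (Suc j) * exp (- t))"
      proof (rule nn_integral_FTC_Icc)
        fix r :: real
        have "((\<lambda>r. r ^ Suc j) has_real_derivative real (Suc j) * r ^ j) (at r)"
          using DERIV_pow[of "Suc j" r] by simp
        from DERIV_cmult[OF this, of "exp (- t) / fact (Suc j)"]
        show "((\<lambda>r. r ^ Suc j / fact (Suc j) * exp (- t)) has_real_derivative r ^ j / fact j * exp (- t)) (at r)"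
          by (simp add: mult_ac del: of_nat_Suc)
      qed (use t in auto)
      finally show ?thesis by simp
    qed
    show ?thesis
      unfolding jump_weight_ennreal[OF zero_less_Suc]
      by (subst nn_integral_gap_law, measurable, rule nn_integral_cong_AE, use mu_pos in eventually_elim)
         (rule inner)
  qed
  have "(\<integral>\<^sup>+m. f m \<partial>subordinator_jump \<mu>) = (\<Sum>m. ennreal (pmf (subordinator_jump \<mu>) m) * f m)"
    by (simp add: nn_integral_measure_pmf nn_integral_count_space_nat)
  also have "\<dots> = (\<Sum>j. ennreal (jump_weight \<mu> (Suc j)) * f (Suc j))"
    using suminf_offset[OF summableI, of "\<lambda>m. ennreal (pmf (subordinator_jump \<mu>) m) * f m" 1]
    by (simp add: pmf_subordinator_jump[OF bernstein phi_1])
  also have "\<dots> = (\<Sum>j. \<integral>\<^sup>+r. ennreal (pmf (pois r) j) * f (Suc j) \<partial>gap_law \<mu>)"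
    by (simp add: nn_integral_multc w)
  also have "\<dots> = (\<integral>\<^sup>+r. (\<integral>\<^sup>+j. f (Suc j) \<partial>pois r) \<partial>gap_law \<mu>)"
    unfolding nn_integral_pois by (rule nn_integral_suminf[symmetric]) measurable
  finally show ?thesis .
qed

section \<open>The transition kernel as a mixture of heat kernels\<close>

lemma measurable_walk_at: "(\<lambda>\<omega>. subordinated_walk \<omega> n) \<in> measurable (step_space \<mu>) (count_space (UNIV :: (int ^ 'n) set))"
proof -
  have "(\<lambda>\<omega>. (\<lambda>k. 0 + subordinated_walk \<omega> k) n) \<in> measurable (step_space \<mu>) (count_space (UNIV :: (int ^ 'n) set))"
    by (rule measurable_compose[OF measurable_walk]) (simp add: path_space_def)
  then show ?thesis by simp
qed

lemma nn_integral_subordinated_walk: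
  fixes f :: "int ^ 'n \<Rightarrow> ennreal"
  shows "(\<integral>\<^sup>+\<omega>. f (subordinated_walk \<omega> n) \<partial>step_space \<mu>) =
    (\<integral>\<^sup>+m. (\<integral>\<^sup>+x. f x \<partial>srw m) \<partial>iid_sum (subordinator_jump \<mu>) n)"
proof -
  let ?A = "\<Pi>\<^sub>M i\<in>(UNIV :: nat set). measure_pmf (srw_step :: (int ^ 'n) pmf)"
  let ?B = "\<Pi>\<^sub>M i\<in>(UNIV :: nat set). measure_pmf (subordinator_jump \<mu>)"
  interpret A: prob_space ?A by (rule prob_space_PiM) (rule prob_space_measure_pmf)
  interpret B: prob_space ?B by (rule prob_space_PiM) (rule prob_space_measure_pmf)
  interpret pair_sigma_finite ?A ?B ..
  have m: "(\<lambda>\<omega>. f (subordinated_walk \<omega> n)) \<in> borel_measurable (?A \<Otimes>\<^sub>M ?B)"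
    using measurable_compose[OF measurable_walk_at, of f borel n] unfolding step_space_def by simp
  have "(\<integral>\<^sup>+\<omega>. f (subordinated_walk \<omega> n) \<partial>step_space \<mu>) =
      (\<integral>\<^sup>+\<rho>. (\<integral>\<^sup>+\<xi>. f (subordinated_walk (\<xi>, \<rho>) n) \<partial>?A) \<partial>?B)"
    unfolding step_space_def by (rule nn_integral_snd[OF m, symmetric])
  also have "\<dots> = (\<integral>\<^sup>+\<rho>. (\<integral>\<^sup>+x. f x \<partial>srw (\<Sum>j<n. \<rho> j)) \<partial>?B)"
    unfolding subordinated_walk_def by (simp only: case_prod_conv nn_integral_iid_partial_sum)
  also have "\<dots> = (\<integral>\<^sup>+m. (\<integral>\<^sup>+x. f x \<partial>srw m) \<partial>iid_sum (subordinator_jump \<mu>) n)"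
    by (rule nn_integral_iid_partial_sum)
  finally show ?thesis .
qed

definition mixed_heat :: "nat \<Rightarrow> int ^ 'n \<Rightarrow> ennreal" where
  "mixed_heat n y = (\<integral>\<^sup>+t. ennreal (heat t y) \<partial>conv_pow (gap_law \<mu>) n)"

definition walk_pmf :: "nat \<Rightarrow> (int ^ 'n) pmf" where
  "walk_pmf n = bind_pmf (iid_sum (subordinator_jump \<mu>) n) srw"

definition walk_kernel :: "nat \<Rightarrow> int ^ 'n \<Rightarrow> ennreal" where
  "walk_kernel n v = ennreal (pmf (walk_pmf n) v)"

text \<open>The clock of the walk after \<open>n\<close> steps is \<open>n\<close> plus a Poisson variable with rate \<open>\<theta>\<^sub>n\<close>; the first
  \<open>n\<close> steps of the simple random walk are independent of the Poisson many remaining ones.\<close>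

lemma walk_kernel_eq:
  "walk_kernel n v = (\<integral>\<^sup>+x. mixed_heat n (v - x) \<partial>(srw n :: (int ^ 'n) pmf))"
proof -
  interpret step_distribution "gap_law \<mu>" by (rule gap_step_distribution)
  let ?T = "conv_pow (gap_law \<mu>) n"
  have "walk_kernel n v = (\<integral>\<^sup>+m. ennreal (pmf (srw m :: (int ^ 'n) pmf) v) \<partial>iid_sum (subordinator_jump \<mu>) n)"
    by (simp add: walk_kernel_def walk_pmf_def ennreal_pmf_bind)
  also have "\<dots> = (\<integral>\<^sup>+t. (\<integral>\<^sup>+j. ennreal (pmf (srw (n + j) :: (int ^ 'n) pmf) v) \<partial>pois t) \<partial>?T)"
    by (rule nn_integral_iid_sum_mixed_Poisson[OF subordinator_jump_mixed_Poisson])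
  also have "\<dots> = (\<integral>\<^sup>+t. (\<integral>\<^sup>+x. ennreal (heat t (v - x)) \<partial>(srw n :: (int ^ 'n) pmf)) \<partial>?T)"
  proof (rule nn_integral_cong)
    fix t
    have "(\<integral>\<^sup>+j. ennreal (pmf (srw (n + j) :: (int ^ 'n) pmf) v) \<partial>pois t) =
      ennreal (pmf (bind_pmf (pois t) (\<lambda>j. srw (n + j) :: (int ^ 'n) pmf)) v)"
      by (simp add: ennreal_pmf_bind)
    also have "bind_pmf (pois t) (\<lambda>j. srw (n + j)) = bind_pmf (srw n) (\<lambda>x. map_pmf ((+) x) (heat_pmf t :: (int ^ 'n) pmf))"
      unfolding iid_sum_add heat_pmf_def map_bind_pmf by (rule bind_commute_pmf)
    also have "ennreal (pmf \<dots> v) = (\<integral>\<^sup>+x. ennreal (heat t (v - x)) \<partial>(srw n :: (int ^ 'n) pmf))"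
      by (simp only: ennreal_pmf_bind pmf_map_plus heat_def)
    finally show "(\<integral>\<^sup>+j. ennreal (pmf (srw (n + j) :: (int ^ 'n) pmf) v) \<partial>pois t) = (\<integral>\<^sup>+x. ennreal (heat t (v - x)) \<partial>(srw n :: (int ^ 'n) pmf))" .
  qed
  also have "\<dots> = (\<integral>\<^sup>+x. mixed_heat n (v - x) \<partial>(srw n :: (int ^ 'n) pmf))"
    unfolding mixed_heat_def by (rule nn_integral_pmf_swap[OF sigma_finite_conv_pow]) measurable
  finally show ?thesis .
qed

lemma nn_integral_walk_pmf:
  fixes f :: "int ^ 'n \<Rightarrow> ennreal"
  shows "(\<integral>\<^sup>+\<omega>. f (subordinated_walk \<omega> n) \<partial>step_space \<mu>) = (\<integral>\<^sup>+x. walk_kernel n x * f x \<partial>count_space UNIV)"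
  unfolding nn_integral_subordinated_walk walk_kernel_def walk_pmf_def nn_integral_measure_pmf[symmetric]
  by simp

end

section \<open>The smoothing loss in dyadic scales\<close>

lemma smoothing_loss_nonneg [simp]: "1 \<le> R \<Longrightarrow> 0 \<le> smoothing_loss d R t"
  by (simp add: smoothing_loss_def)

lemma measurable_smoothing_loss [measurable]: "smoothing_loss d R \<in> borel_measurable borel"
  unfolding smoothing_loss_def by measurable

lemma finite_dyadic: "finite {i. (2::real) ^ i \<le> x}"
proof -
  obtain N where N: "x < 2 ^ N" using real_arch_pow[of 2 x] by auto
  have "i < N" if "(2::real) ^ i \<le> x" for i
    using power_less_imp_less_exp[OF _ le_less_trans[OF that N]] by simp
  then have "{i. (2::real) ^ i \<le> x} \<subseteq> {..<N}" by auto
  then show ?thesis using finite_subset by blast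
qed

text \<open>If \<open>t\<close> is about \<open>2\<^sup>-\<^sup>i R\<^sup>2\<close> then the loss is at most \<open>2\<^bsup>(i + 1) d\<^esup>\<close>, and the indicator of
  \<open>t \<le> 2\<^sup>-\<^sup>i R\<^sup>2\<close> is at most an exponential; in this form the expectation involves nothing but
  Laplace transforms. The rate has a factor \<open>1/2\<close> so that it never exceeds \<open>1/2\<close>, which is where the
  Laplace transform bound for \<open>\<theta>\<^sub>n\<close> is available.\<close>

lemma smoothing_loss_dyadic:
  assumes R: "1 \<le> R" and t: "0 < t"
  shows "smoothing_loss d R t \<le> 1 + (\<Sum>i\<in>{i. 2 ^ i \<le> R\<^sup>2}. 2 ^ (Suc i * d) * (exp 1 * exp (- (2 ^ i / (2 * R\<^sup>2)) * t)))"
    (is "_ \<le> 1 + sum ?g ?I")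
proof -
  define M where "M = max 1 (min (sqrt t) R)"
  define y where "y = (R / M)\<^sup>2"
  have M: "1 \<le> M" "M \<le> R" using R by (auto simp: M_def)
  have RM: "1 \<le> R / M" using M by simp
  then have y1: "1 \<le> y" unfolding y_def by simp
  have fin: "finite ?I" by (rule finite_dyadic)
  have g0: "0 \<le> ?g i" for i by simp
  show ?thesis
  proof (cases "t \<le> R\<^sup>2")
    case False
    then have "R \<le> sqrt t" using R by (intro real_le_rsqrt) simp
    then have "smoothing_loss d R t = 1" using R by (simp add: smoothing_loss_def)
    then show ?thesis using sum_nonneg[of ?I ?g] g0 by simp
  next
    case True
    obtain i where i: "2 ^ i \<le> y" "y < 2 ^ Suc i"
    proof -
      obtain N where N: "y < 2 ^ N" using real_arch_pow[of 2 y] by auto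
      define k where "k = (LEAST N. y < 2 ^ N)"
      have k: "y < 2 ^ k" unfolding k_def using LeastI[of "\<lambda>N. y < 2 ^ N" N] N by simp
      have "k \<noteq> 0" using k y1 by (intro notI) simp
      then obtain i where ki: "k = Suc i" using not0_implies_Suc by blast
      have "\<not> y < 2 ^ i" using not_less_Least[of i "\<lambda>N. y < 2 ^ N"] ki unfolding k_def by simp
      then show ?thesis using that[of i] k ki by simp
    qed
    have "y \<le> R\<^sup>2" unfolding y_def using M R by (intro power_mono) (auto simp: divide_le_eq mult_le_cancel_left1)
    then have iI: "i \<in> ?I" using i by simp
    have "sqrt t \<le> R" using True R by (simp add: real_le_lsqrt)
    then have "sqrt t \<le> M" by (simp add: M_def)
    then have tM: "t \<le> M\<^sup>2" using t by (simp add: sqrt_le_D)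
    have "2 ^ i * t \<le> y * M\<^sup>2" using i tM t y1 by (intro mult_mono) auto
    also have "\<dots> = R\<^sup>2" using M by (simp add: y_def power_divide)
    finally have "2 ^ i * t \<le> 2 * R\<^sup>2" using zero_le_power2[of R] by linarith
    then have "2 ^ i / (2 * R\<^sup>2) * t \<le> 1" using R t by (simp add: divide_le_eq)
    then have e1: "1 \<le> exp 1 * exp (- (2 ^ i / (2 * R\<^sup>2)) * t)" by (simp flip: exp_add)
    moreover have "smoothing_loss d R t \<le> 2 ^ (Suc i * d)"
    proof -
      have "smoothing_loss d R t = (R / M) ^ d" by (simp add: smoothing_loss_def M_def)
      also have "\<dots> \<le> y ^ d" unfolding y_def
      proof (rule power_mono)
        show "R / M \<le> (R / M)\<^sup>2" using mult_left_mono[OF RM, of "R / M"] RM by (simp add: power2_eq_square)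
      qed (use RM in simp)
      also have "\<dots> \<le> (2 ^ Suc i) ^ d" using i y1 by (intro power_mono) auto
      finally show ?thesis by (simp only: power_mult)
    qed
    moreover have "2 ^ (Suc i * d) * 1 \<le> ?g i" by (rule mult_left_mono[OF e1]) simp
    ultimately have "smoothing_loss d R t \<le> ?g i" by linarith
    also have "\<dots> \<le> sum ?g ?I" by (rule member_le_sum[OF iI _ fin]) (rule g0)
    finally show ?thesis by simp
  qed
qed

text \<open>A power \<open>N\<close> with \<open>q\<^sup>N > 2\<^sup>d\<^sup>+\<^sup>1\<close> and \<open>exp (- x) \<le> N! / x\<^sup>N\<close> reduce the series to a geometric one.\<close>

lemma dyadic_exp_summable:
  assumes "0 < \<kappa>" "1 < (q::real)"
  shows "summable (\<lambda>i. 2 ^ (Suc i * d) * (exp 1 * exp (- \<kappa> * q ^ i)))"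
proof -
  obtain N where N: "2 ^ (d + 1) < q ^ N" using real_arch_pow[OF assms(2)] by blast
  have bound: "2 ^ (Suc i * d) * (exp 1 * exp (- \<kappa> * q ^ i)) \<le> 2 ^ d * exp 1 * (fact N / \<kappa> ^ N) * (1 / 2) ^ i" for i
  proof -
    let ?x = "\<kappa> * q ^ i"
    have x: "0 < ?x" using assms by simp
    have "(\<Sum>i\<in>{N}. ?x ^ i / fact i) \<le> (\<Sum>i. ?x ^ i / fact i)"
      using exp_converges[of ?x] x by (intro sum_le_suminf) (auto simp: sums_iff divide_inverse mult_ac)
    then have "?x ^ N / fact N \<le> exp ?x" by (simp add: exp_def divide_inverse mult_ac)
    then have "1 / exp ?x \<le> 1 / (?x ^ N / fact N)"
      using x assms by (intro divide_left_mono mult_pos_pos divide_pos_pos zero_less_power) auto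
    then have "exp (- ?x) \<le> fact N / ?x ^ N" by (simp add: exp_minus divide_inverse mult.commute)
    also have "?x ^ N = \<kappa> ^ N * (q ^ N) ^ i"
      by (simp add: power_mult_distrib flip: power_mult) (simp add: mult.commute)
    also have "fact N / (\<kappa> ^ N * (q ^ N) ^ i) \<le> fact N / (\<kappa> ^ N * (2 ^ (d + 1)) ^ i)"
      using N assms by (intro divide_left_mono mult_left_mono power_mono mult_pos_pos) auto
    finally have "exp (- ?x) \<le> fact N / (\<kappa> ^ N * (2 ^ (d + 1)) ^ i)" .
    then have "2 ^ (Suc i * d) * (exp 1 * exp (- ?x)) \<le> 2 ^ (Suc i * d) * (exp 1 * (fact N / (\<kappa> ^ N * (2 ^ (d + 1)) ^ i)))"
      by (intro mult_left_mono) auto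
    also have "\<dots> = 2 ^ d * exp 1 * (fact N / \<kappa> ^ N) * (1 / 2) ^ i"
      using assms(1) by (simp add: field_simps power_add flip: power_mult)
    finally show ?thesis by simp
  qed
  show ?thesis
  proof (rule summable_comparison_test')
    show "summable (\<lambda>i. 2 ^ d * exp 1 * (fact N / \<kappa> ^ N) * (1 / 2 :: real) ^ i)"
      by (intro summable_mult summable_geometric) simp
    show "norm (2 ^ (Suc i * d) * (exp 1 * exp (- \<kappa> * q ^ i))) \<le> 2 ^ d * exp 1 * (fact N / \<kappa> ^ N) * (1 / 2) ^ i"
      if "0 \<le> i" for i using bound[of i] by simp
  qed
qed

section \<open>Consequences of the scaling of the Bernstein function\<close>

locale scaled_bernstein = bernstein +
  fixes c_low c_up \<alpha>_low \<alpha>_up :: real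
  assumes c_pos: "0 < c_low" "0 < c_up" and alpha: "0 < \<alpha>_low" "\<alpha>_low \<le> \<alpha>_up" "\<alpha>_up < 1"
    and scaling: "\<And>r R. 0 < r \<Longrightarrow> r \<le> R \<Longrightarrow> R \<le> 1 \<Longrightarrow>
           c_low * (R / r) powr \<alpha>_low \<le> \<phi> R / \<phi> r \<and> \<phi> R / \<phi> r \<le> c_up * (R / r) powr \<alpha>_up"
begin

sublocale step_distribution "gap_law \<mu>" by (rule gap_step_distribution)

abbreviation (input) T :: "nat \<Rightarrow> real measure" where
  "T \<equiv> conv_pow (gap_law \<mu>)"

lemma phi_pos:
  assumes "0 < l" "l \<le> 1" shows "0 < \<phi> l"
proof -
  have "0 < c_low * (1 / l) powr \<alpha>_low" using c_pos assms by simp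
  also have "\<dots> \<le> 1 / \<phi> l" using scaling[of l 1] assms phi_1 by simp
  finally show ?thesis by simp
qed

lemma phi_mono: "0 \<le> l \<Longrightarrow> l \<le> u \<Longrightarrow> \<phi> l \<le> \<phi> u"
proof -
  assume lu: "0 \<le> l" "l \<le> u"
  have "(\<integral>t. 1 - exp (- l * t) \<partial>\<mu>) \<le> (\<integral>t. 1 - exp (- u * t) \<partial>\<mu>)"
  proof (rule integral_mono_AE)
    show "AE t in \<mu>. 1 - exp (- l * t) \<le> 1 - exp (- u * t)"
      using mu_pos by eventually_elim (use lu in auto)
  qed (use integrable_one_minus_exp lu in auto)
  then show ?thesis using phi_eq lu by simp
qed

lemma phi_scale_ge: "0 < r \<Longrightarrow> r \<le> R \<Longrightarrow> R \<le> 1 \<Longrightarrow> c_low * (R / r) powr \<alpha>_low * \<phi> r \<le> \<phi> R"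
  using scaling[of r R] phi_pos[of r] by (simp add: pos_le_divide_eq)

lemma phi_scale_le: "0 < r \<Longrightarrow> r \<le> R \<Longrightarrow> R \<le> 1 \<Longrightarrow> \<phi> R \<le> c_up * (R / r) powr \<alpha>_up * \<phi> r"
  using scaling[of r R] phi_pos[of r] by (simp add: pos_divide_le_eq)

lemma phi_lower: "0 < l \<Longrightarrow> l \<le> 1 \<Longrightarrow> l powr \<alpha>_up / c_up \<le> \<phi> l"
  using phi_scale_le[of l 1] c_pos phi_1
  by (simp add: powr_divide field_simps)

lemma phi_upper: "0 < l \<Longrightarrow> l \<le> 1 \<Longrightarrow> \<phi> l \<le> l powr \<alpha>_low / c_low"
  using phi_scale_ge[of l 1] c_pos phi_1
  by (simp add: powr_divide field_simps)

text \<open>For small \<open>l\<close> the upper scaling, with exponent less than \<open>1\<close>, gives \<open>4 l \<le> \<phi> l\<close>, so the denominator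
  costs only half of the decay \<open>1 - \<phi> l \<le> exp (- \<phi> l)\<close>. For the remaining \<open>l\<close> the left-hand side, a
  Laplace transform, is decreasing, and the right-hand side is bounded below because \<open>\<phi> l \<le> 1\<close>.\<close>

lemma gap_Laplace_le: "\<exists>c>0. \<forall>l. 0 < l \<longrightarrow> l \<le> 1 / 2 \<longrightarrow> (1 - \<phi> l) / (1 - l) \<le> exp (- c * \<phi> l)"
proof -
  \<comment> \<open>Below this threshold the upper scaling yields \<open>4 * l \<le> \<phi> l\<close>.\<close>
  define l0 where "l0 = min (1 / 2) ((1 / (4 * c_up)) powr (1 / (1 - \<alpha>_up)))"
  have l0: "0 < l0" "l0 \<le> 1 / 2" using c_pos by (auto simp: l0_def)
  have small: "(1 - \<phi> l) / (1 - l) \<le> exp (- \<phi> l / 2)" if l: "0 < l" "l \<le> l0" for l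
  proof -
    have l2: "l \<le> 1 / 2" using l l0 by simp
    have "l powr (1 - \<alpha>_up) \<le> ((1 / (4 * c_up)) powr (1 / (1 - \<alpha>_up))) powr (1 - \<alpha>_up)"
      using l alpha by (intro powr_mono2) (auto simp: l0_def)
    also have "\<dots> = 1 / (4 * c_up)" using alpha c_pos by (simp add: powr_powr)
    finally have "l powr (1 - \<alpha>_up) * l powr \<alpha>_up \<le> 1 / (4 * c_up) * l powr \<alpha>_up"
      by (intro mult_right_mono) auto
    then have "4 * l \<le> l powr \<alpha>_up / c_up" using l c_pos by (simp add: powr_add[symmetric] field_simps)
    also have "\<dots> \<le> \<phi> l" using l l2 by (intro phi_lower) auto
    finally have phi4: "4 * l \<le> \<phi> l" .
    have phi1: "\<phi> l \<le> 1" using phi_mono[of l 1] l l2 phi_1 by simp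
    have "1 / (1 - l) \<le> 1 + 2 * l"
    proof -
      have "l * (2 * l) \<le> l * 1" using l l2 by (intro mult_left_mono) auto
      then show ?thesis using l2 by (simp add: divide_le_eq algebra_simps)
    qed
    then have "(1 - \<phi> l) * (1 / (1 - l)) \<le> (1 + - \<phi> l) * (1 + 2 * l)"
      using phi1 l2 by (intro mult_mono) auto
    also have "\<dots> \<le> exp (- \<phi> l) * exp (2 * l)"
      using l phi1 by (intro mult_mono exp_ge_add_one_self) auto
    also have "\<dots> = exp (2 * l - \<phi> l)" by (simp flip: exp_add)
    also have "\<dots> \<le> exp (- \<phi> l / 2)" using phi4 by simp
    finally show ?thesis by simp
  qed
  have phi0: "0 < \<phi> l0" "\<phi> l0 \<le> 1" using l0 phi_pos phi_mono[of l0 1] phi_1 by auto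
  show ?thesis
  proof (intro exI[of _ "\<phi> l0 / 2"] conjI allI impI)
    fix l assume l: "0 < l" "l \<le> 1 / (2::real)"
    have phil: "0 < \<phi> l" "\<phi> l \<le> 1" using l phi_pos phi_mono[of l 1] phi_1 by auto
    show "(1 - \<phi> l) / (1 - l) \<le> exp (- (\<phi> l0 / 2) * \<phi> l)"
    proof (cases "l \<le> l0")
      case True
      have "\<phi> l0 / 2 * \<phi> l \<le> 1 / 2 * \<phi> l" using phi0 phil by (intro mult_right_mono) auto
      then show ?thesis using order_trans[OF small[OF l(1) True]] by simp
    next
      case False
      have "ennreal ((1 - \<phi> l) / (1 - l)) = (\<integral>\<^sup>+r. ennreal (exp (- l * r)) \<partial>gap_law \<mu>)"
        using l by (intro gap_law_Laplace[symmetric]) auto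
      also have "\<dots> \<le> (\<integral>\<^sup>+r. ennreal (exp (- l0 * r)) \<partial>gap_law \<mu>)"
        by (rule nn_integral_mono_AE, use step_pos in eventually_elim) (use False in \<open>auto intro!: ennreal_leI\<close>)
      also have "\<dots> = ennreal ((1 - \<phi> l0) / (1 - l0))"
        using l0 by (intro gap_law_Laplace) auto
      finally have "(1 - \<phi> l) / (1 - l) \<le> (1 - \<phi> l0) / (1 - l0)"
        using phi0 l0 by (subst (asm) ennreal_le_iff) auto
      also have "\<dots> \<le> exp (- \<phi> l0 / 2)" using small[of l0] l0 by simp
      also have "\<dots> \<le> exp (- (\<phi> l0 / 2) * \<phi> l)"
        using phi0 phil mult_left_mono[of "\<phi> l" 1 "\<phi> l0 / 2"] by simp
      finally show ?thesis .
    qed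
  qed (use phi0 in simp)
qed

lemma T_Laplace_le: "\<exists>c>0. \<forall>n l. 0 < l \<longrightarrow> l \<le> 1 / 2 \<longrightarrow>
    (\<integral>\<^sup>+t. ennreal (exp (- l * t)) \<partial>T n) \<le> ennreal (exp (- c * (real n * \<phi> l)))"
proof -
  obtain c where c: "0 < c" "\<And>l. 0 < l \<Longrightarrow> l \<le> 1 / 2 \<Longrightarrow> (1 - \<phi> l) / (1 - l) \<le> exp (- c * \<phi> l)"
    using gap_Laplace_le by blast
  show ?thesis
  proof (intro exI[of _ c] conjI allI impI c(1))
    fix n :: nat and l :: real assume l: "0 < l" "l \<le> 1 / 2"
    have "(\<integral>\<^sup>+t. ennreal (exp (- l * t)) \<partial>T n) = ennreal ((1 - \<phi> l) / (1 - l)) ^ n"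
      unfolding conv_pow_Laplace using l by (subst gap_law_Laplace) auto
    also have "\<dots> \<le> ennreal (exp (- c * \<phi> l)) ^ n"
      by (intro power_mono ennreal_leI c l) auto
    also have "\<dots> = ennreal (exp (- c * (real n * \<phi> l)))"
      by (simp add: ennreal_power mult_ac flip: exp_of_nat_mult)
    finally show "(\<integral>\<^sup>+t. ennreal (exp (- l * t)) \<partial>T n) \<le> ennreal (exp (- c * (real n * \<phi> l)))" .
  qed
qed

text \<open>At the rate \<open>2\<^sup>i / (2 R\<^sup>2)\<close> the exponent \<open>n \<phi>\<close> of the Laplace transform is at least of order
  \<open>2\<^bsup>i \<alpha>\<^esup> n \<phi> (R\<^sup>-\<^sup>2)\<close> by the lower scaling, so its exponential beats the loss \<open>2\<^bsup>(i + 1) d\<^esup>\<close>.\<close>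

lemma smoothing_loss_moment:
  assumes g: "0 < \<gamma>1"
  shows "\<exists>C>0. \<forall>R\<ge>1. \<forall>n. \<gamma>1 \<le> real n * \<phi> (1 / R\<^sup>2) \<longrightarrow>
     (\<integral>\<^sup>+t. ennreal (smoothing_loss d R t) \<partial>T n) \<le> ennreal C"
proof -
  obtain c where c: "0 < c" and L: "\<And>n l. 0 < l \<Longrightarrow> l \<le> 1 / 2 \<Longrightarrow>
      (\<integral>\<^sup>+t. ennreal (exp (- l * t)) \<partial>T n) \<le> ennreal (exp (- c * (real n * \<phi> l)))"
    using T_Laplace_le by blast
  define q where "q = 2 powr \<alpha>_low"
  define \<kappa> where "\<kappa> = c * (c_low * \<gamma>1 / (2 * c_up))"
  have q: "1 < q" using alpha by (simp add: q_def)
  have k: "0 < \<kappa>" using c c_pos g by (simp add: \<kappa>_def)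
  let ?a = "\<lambda>i. 2 ^ (Suc i * d) * (exp 1 * exp (- \<kappa> * q ^ i)) :: real"
  have sum: "summable ?a" by (rule dyadic_exp_summable[OF k q])
  have a0: "0 \<le> ?a i" for i by simp
  define C where "C = 1 + suminf ?a"
  have "0 \<le> suminf ?a" by (rule suminf_nonneg[OF sum a0])
  then have C: "0 < C" by (simp add: C_def)
  show ?thesis
  proof (intro exI[of _ C] conjI allI impI C)
    fix R :: real and n :: nat assume R: "1 \<le> R" and n: "\<gamma>1 \<le> real n * \<phi> (1 / R\<^sup>2)"
    let ?I = "{i. 2 ^ i \<le> R\<^sup>2}"
    interpret Tn: prob_space "T n" by (rule prob_space_conv_pow)
    have n0: "0 < n" using n g by (intro gr0I) simp
    have R2: "1 \<le> R\<^sup>2" using R by simp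
    have fin: "finite ?I" by (rule finite_dyadic)
    have term_le: "(\<integral>\<^sup>+t. ennreal (2 ^ (Suc i * d) * (exp 1 * exp (- (2 ^ i / (2 * R\<^sup>2)) * t))) \<partial>T n) \<le> ennreal (?a i)"
      if i: "i \<in> ?I" for i
    proof -
      let ?l = "2 ^ i / (2 * R\<^sup>2)"
      have l: "0 < ?l" "?l \<le> 1 / 2" using i R by (auto simp: divide_le_eq)
      have "\<phi> (1 / R\<^sup>2) \<le> c_up * ((1 / R\<^sup>2) / (1 / (2 * R\<^sup>2))) powr \<alpha>_up * \<phi> (1 / (2 * R\<^sup>2))"
        using R2 by (intro phi_scale_le) (auto simp: divide_le_eq field_simps)
      also have "(1 / R\<^sup>2) / (1 / (2 * R\<^sup>2)) = 2" using R by simp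
      also have "c_up * 2 powr \<alpha>_up * \<phi> (1 / (2 * R\<^sup>2)) \<le> c_up * 2 powr 1 * \<phi> (1 / (2 * R\<^sup>2))"
        using alpha c_pos phi_pos[of "1 / (2 * R\<^sup>2)"] R R2
        by (intro mult_right_mono mult_left_mono powr_mono) (auto simp: divide_le_eq)
      finally have h: "\<phi> (1 / R\<^sup>2) / (2 * c_up) \<le> \<phi> (1 / (2 * R\<^sup>2))"
        using c_pos by (simp add: divide_le_eq mult_ac)
      have "c_low * (?l / (1 / (2 * R\<^sup>2))) powr \<alpha>_low * \<phi> (1 / (2 * R\<^sup>2)) \<le> \<phi> ?l"
      proof (rule phi_scale_ge)
        show "1 / (2 * R\<^sup>2) \<le> ?l" by (intro divide_right_mono) auto
        show "?l \<le> 1" using l(2) by linarith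
      qed (use R l in auto)
      also have "?l / (1 / (2 * R\<^sup>2)) = 2 powr real i" using R by (simp add: powr_realpow)
      also have "(2 powr real i) powr \<alpha>_low = q ^ i"
        by (simp add: q_def powr_powr powr_power mult.commute)
      finally have h2: "c_low * q ^ i * \<phi> (1 / (2 * R\<^sup>2)) \<le> \<phi> ?l" .
      have "\<kappa> * q ^ i = c * (c_low * q ^ i * (\<gamma>1 / (2 * c_up)))" by (simp add: \<kappa>_def)
      also have "\<dots> \<le> c * (c_low * q ^ i * (real n * \<phi> (1 / R\<^sup>2) / (2 * c_up)))"
        using c c_pos q n by (intro mult_left_mono divide_right_mono) auto
      also have "\<dots> = c * (real n * (c_low * q ^ i * (\<phi> (1 / R\<^sup>2) / (2 * c_up))))" by simp
      also have "\<dots> \<le> c * (real n * (c_low * q ^ i * \<phi> (1 / (2 * R\<^sup>2))))"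
        using c c_pos q h by (intro mult_left_mono) auto
      also have "\<dots> \<le> c * (real n * \<phi> ?l)"
        using c h2 by (intro mult_left_mono) auto
      finally have ex: "exp (- c * (real n * \<phi> ?l)) \<le> exp (- \<kappa> * q ^ i)" by simp
      have "(\<integral>\<^sup>+t. ennreal (2 ^ (Suc i * d) * (exp 1 * exp (- ?l * t))) \<partial>T n) =
          ennreal (2 ^ (Suc i * d) * exp 1) * (\<integral>\<^sup>+t. ennreal (exp (- ?l * t)) \<partial>T n)"
        by (subst nn_integral_cmult[symmetric]) (auto simp: ennreal_mult'[symmetric] mult_ac)
      also have "\<dots> \<le> ennreal (2 ^ (Suc i * d) * exp 1) * ennreal (exp (- \<kappa> * q ^ i))"
        using order_trans[OF L[OF l] ennreal_leI[OF ex]] by (intro mult_left_mono) auto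
      also have "\<dots> = ennreal (?a i)" by (simp add: ennreal_mult'[symmetric] mult_ac)
      finally show ?thesis .
    qed
    have "(\<integral>\<^sup>+t. ennreal (smoothing_loss d R t) \<partial>T n) \<le>
      (\<integral>\<^sup>+t. ennreal (1 + (\<Sum>i\<in>?I. 2 ^ (Suc i * d) * (exp 1 * exp (- (2 ^ i / (2 * R\<^sup>2)) * t)))) \<partial>T n)"
      by (rule nn_integral_mono_AE, use conv_pow_pos[OF n0] in eventually_elim)
         (rule ennreal_leI, rule smoothing_loss_dyadic[OF R])
    also have "\<dots> = (\<integral>\<^sup>+t. 1 + (\<Sum>i\<in>?I. ennreal (2 ^ (Suc i * d) * (exp 1 * exp (- (2 ^ i / (2 * R\<^sup>2)) * t)))) \<partial>T n)"
      by (intro nn_integral_cong) (simp add: sum_nonneg ennreal_plus sum_ennreal)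
    also have "\<dots> = 1 + (\<Sum>i\<in>?I. (\<integral>\<^sup>+t. ennreal (2 ^ (Suc i * d) * (exp 1 * exp (- (2 ^ i / (2 * R\<^sup>2)) * t))) \<partial>T n))"
    proof -
      have one: "(\<integral>\<^sup>+t. 1 \<partial>T n) = 1" by (simp add: Tn.emeasure_space_1)
      show ?thesis
        by (subst nn_integral_add, measurable, subst nn_integral_sum, measurable) (simp only: one)
    qed
    also have "\<dots> \<le> 1 + (\<Sum>i\<in>?I. ennreal (?a i))"
      by (intro add_left_mono sum_mono term_le)
    also have "\<dots> = ennreal (1 + (\<Sum>i\<in>?I. ?a i))"
      by (simp add: sum_nonneg ennreal_plus sum_ennreal)
    also have "\<dots> \<le> ennreal C"
      unfolding C_def using sum_le_suminf[OF sum fin] a0 by (intro ennreal_leI) auto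
    finally show "(\<integral>\<^sup>+t. ennreal (smoothing_loss d R t) \<partial>T n) \<le> ennreal C" .
  qed
qed

text \<open>Markov's inequality for \<open>exp (- \<lambda> \<theta>\<^sub>n)\<close> with \<open>\<lambda> = 1 / (\<epsilon> R\<^sup>2)\<close>: by the lower scaling \<open>n \<phi> \<lambda>\<close> grows
  like \<open>\<epsilon>\<^bsup>-\<alpha>\<^esup>\<close>. The number \<open>3\<close> in \<open>K\<close> makes the bound \<open>exp (1 - 3) \<le> 1/4\<close>.\<close>

lemma T_lower_tail:
  assumes g: "0 < \<gamma>1"
  shows "\<exists>\<epsilon>0>0. \<forall>\<epsilon>. 0 < \<epsilon> \<longrightarrow> \<epsilon> \<le> \<epsilon>0 \<longrightarrow> \<epsilon> \<le> 1 \<longrightarrow> (\<forall>R n. 2 \<le> \<epsilon> * R\<^sup>2 \<longrightarrow> \<gamma>1 \<le> real n * \<phi> (1 / R\<^sup>2) \<longrightarrow>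
     measure (T n) {..<\<epsilon> * R\<^sup>2} \<le> 1 / 4)"
proof -
  obtain c where c: "0 < c" and L: "\<And>n l. 0 < l \<Longrightarrow> l \<le> 1 / 2 \<Longrightarrow>
      (\<integral>\<^sup>+t. ennreal (exp (- l * t)) \<partial>T n) \<le> ennreal (exp (- c * (real n * \<phi> l)))"
    using T_Laplace_le by blast
  define K where "K = 3 / (c * c_low * \<gamma>1)"
  have K: "0 < K" using c c_pos g by (simp add: K_def)
  define \<epsilon>0 where "\<epsilon>0 = (1 / K) powr (1 / \<alpha>_low)"
  have e0: "0 < \<epsilon>0" using K by (simp add: \<epsilon>0_def)
  show ?thesis
  proof (intro exI[of _ \<epsilon>0] conjI allI impI e0)
    fix \<epsilon> R :: real and n :: nat
    assume \<epsilon>: "0 < \<epsilon>" "\<epsilon> \<le> \<epsilon>0" "\<epsilon> \<le> 1" and R: "2 \<le> \<epsilon> * R\<^sup>2" and n: "\<gamma>1 \<le> real n * \<phi> (1 / R\<^sup>2)"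
    interpret Tn: prob_space "T n" by (rule prob_space_conv_pow)
    define l where "l = 1 / (\<epsilon> * R\<^sup>2)"
    have l: "0 < l" "l \<le> 1 / 2" using R by (auto simp: l_def divide_le_eq)
    have R0: "0 < R\<^sup>2" using R \<epsilon> by (metis less_le_trans zero_less_mult_pos zero_less_numeral)
    have R1: "1 / R\<^sup>2 \<le> l" using \<epsilon> R0 by (simp add: l_def field_simps)
    have "\<epsilon> powr \<alpha>_low \<le> ((1 / K) powr (1 / \<alpha>_low)) powr \<alpha>_low"
      using \<epsilon> alpha by (intro powr_mono2) (auto simp: \<epsilon>0_def)
    also have "\<dots> = 1 / K" using alpha K by (simp add: powr_powr)
    finally have "K \<le> 1 / \<epsilon> powr \<alpha>_low" using K \<epsilon> by (simp add: field_simps)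
    moreover have "c_low * (l / (1 / R\<^sup>2)) powr \<alpha>_low * \<phi> (1 / R\<^sup>2) \<le> \<phi> l"
      using l R1 R0 by (intro phi_scale_ge) auto
    moreover have "(l / (1 / R\<^sup>2)) powr \<alpha>_low = 1 / \<epsilon> powr \<alpha>_low"
      using R0 \<epsilon> by (simp add: l_def powr_divide)
    moreover have "0 \<le> \<phi> (1 / R\<^sup>2)"
    proof (rule less_imp_le, rule phi_pos)
      show "1 / R\<^sup>2 \<le> 1" using R1 l by linarith
    qed (use R0 in simp)
    ultimately have "c_low * K * \<phi> (1 / R\<^sup>2) \<le> \<phi> l"
      using c_pos order_trans[OF mult_right_mono[OF mult_left_mono[of K "1 / \<epsilon> powr \<alpha>_low" c_low]]]
      by (metis less_imp_le)
    then have "c * (real n * (c_low * K * \<phi> (1 / R\<^sup>2))) \<le> c * (real n * \<phi> l)"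
      using c by (intro mult_left_mono) auto
    moreover have "c * c_low * K * \<gamma>1 \<le> c * c_low * K * (real n * \<phi> (1 / R\<^sup>2))"
      using c c_pos K n by (intro mult_left_mono) auto
    moreover have "c * c_low * K * \<gamma>1 = 3" using c c_pos g by (simp add: K_def)
    ultimately have 3: "3 \<le> c * (real n * \<phi> l)" by (simp add: mult_ac)
    have "emeasure (T n) {..<\<epsilon> * R\<^sup>2} = (\<integral>\<^sup>+t. indicator {..<\<epsilon> * R\<^sup>2} t \<partial>T n)" by simp
    also have "\<dots> \<le> (\<integral>\<^sup>+t. ennreal (exp 1) * ennreal (exp (- l * t)) \<partial>T n)"
    proof (rule nn_integral_mono)
      fix t
      have "1 \<le> exp 1 * exp (- l * t)" if "t < \<epsilon> * R\<^sup>2"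
      proof -
        have "l * t \<le> 1" using that \<epsilon> R0 by (simp add: l_def divide_le_eq)
        then show ?thesis by (simp flip: exp_add)
      qed
      then show "indicator {..<\<epsilon> * R\<^sup>2} t \<le> ennreal (exp 1) * ennreal (exp (- l * t))"
        by (auto simp: indicator_def ennreal_mult'[symmetric] simp flip: ennreal_1 intro!: ennreal_leI)
    qed
    also have "\<dots> = ennreal (exp 1) * (\<integral>\<^sup>+t. ennreal (exp (- l * t)) \<partial>T n)"
      by (rule nn_integral_cmult) measurable
    also have "\<dots> \<le> ennreal (exp 1) * ennreal (exp (- c * (real n * \<phi> l)))"
      by (intro mult_left_mono L l) auto
    also have "\<dots> = ennreal (exp (1 - c * (real n * \<phi> l)))"
      by (simp add: ennreal_mult'[symmetric] flip: exp_add)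
    also have "\<dots> \<le> ennreal (exp (- 2))" using 3 by (intro ennreal_leI) simp
    also have "\<dots> \<le> ennreal (1 / 4)"
    proof (rule ennreal_leI)
      have "2 \<le> exp (1::real)" using exp_ge_add_one_self[of 1] by simp
      then have "2 * 2 \<le> exp 1 * exp (1::real)" by (intro mult_mono) auto
      then have "4 \<le> exp (2::real)" by (simp flip: exp_add)
      then show "exp (- 2) \<le> 1 / (4::real)" by (simp add: exp_minus field_simps)
    qed
    finally show "measure (T n) {..<\<epsilon> * R\<^sup>2} \<le> 1 / 4"
      by (simp add: Tn.emeasure_eq_measure)
  qed
qed

text \<open>Markov's inequality for \<open>1 - exp (- \<lambda> \<theta>\<^sub>n)\<close> with \<open>\<lambda> = \<epsilon> / R\<^sup>2\<close>, whose expectation is at most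
  \<open>2 n \<phi> \<lambda>\<close> by Bernoulli's inequality and hence of order \<open>\<epsilon>\<^sup>\<alpha>\<close>.\<close>

lemma T_upper_tail:
  assumes g: "0 < \<gamma>2"
  shows "\<exists>\<epsilon>0>0. \<forall>\<epsilon>. 0 < \<epsilon> \<longrightarrow> \<epsilon> \<le> \<epsilon>0 \<longrightarrow> \<epsilon> \<le> 1 / 2 \<longrightarrow> (\<forall>R\<ge>1. \<forall>n. real n * \<phi> (1 / R\<^sup>2) \<le> \<gamma>2 \<longrightarrow>
     measure (T n) {R\<^sup>2 / \<epsilon><..} \<le> 1 / 4)"
proof -
  define K where "K = 16 * \<gamma>2 / c_low"
  have K: "0 < K" using c_pos g by (simp add: K_def)
  define \<epsilon>0 where "\<epsilon>0 = (1 / K) powr (1 / \<alpha>_low)"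
  have e0: "0 < \<epsilon>0" using K by (simp add: \<epsilon>0_def)
  show ?thesis
  proof (intro exI[of _ \<epsilon>0] conjI allI impI e0)
    fix \<epsilon> R :: real and n :: nat
    assume \<epsilon>: "0 < \<epsilon>" "\<epsilon> \<le> \<epsilon>0" "\<epsilon> \<le> 1 / 2" and R: "1 \<le> R" and n: "real n * \<phi> (1 / R\<^sup>2) \<le> \<gamma>2"
    interpret Tn: prob_space "T n" by (rule prob_space_conv_pow)
    have R2: "1 \<le> R\<^sup>2" using R by simp
    define l where "l = \<epsilon> / R\<^sup>2"
    have "\<epsilon> * 1 \<le> 1 / 2 * R\<^sup>2" using \<epsilon> R2 by (intro mult_mono) auto
    then have l: "0 < l" "l \<le> 1 / 2" using R \<epsilon> by (auto simp: l_def field_simps)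
    have lR: "l \<le> 1 / R\<^sup>2" using \<epsilon> R2 by (simp add: l_def divide_right_mono)
    have "\<epsilon> powr \<alpha>_low \<le> ((1 / K) powr (1 / \<alpha>_low)) powr \<alpha>_low"
      using \<epsilon> alpha by (intro powr_mono2) (auto simp: \<epsilon>0_def)
    also have "\<dots> = 1 / K" using alpha K by (simp add: powr_powr)
    finally have "K \<le> 1 / \<epsilon> powr \<alpha>_low" using K \<epsilon> by (simp add: field_simps)
    moreover have "c_low * ((1 / R\<^sup>2) / l) powr \<alpha>_low * \<phi> l \<le> \<phi> (1 / R\<^sup>2)"
      using l lR R2 by (intro phi_scale_ge) (auto simp: divide_le_eq)
    moreover have "((1 / R\<^sup>2) / l) powr \<alpha>_low = 1 / \<epsilon> powr \<alpha>_low"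
      using R2 R \<epsilon> by (simp add: l_def powr_divide)
    moreover have "0 \<le> \<phi> l" using phi_pos[of l] l by simp
    ultimately have "c_low * K * \<phi> l \<le> \<phi> (1 / R\<^sup>2)"
      using c_pos order_trans[OF mult_right_mono[OF mult_left_mono[of K "1 / \<epsilon> powr \<alpha>_low" c_low]]]
      by (metis less_imp_le)
    then have "real n * (c_low * K * \<phi> l) \<le> real n * \<phi> (1 / R\<^sup>2)"
      by (intro mult_left_mono) auto
    then have "real n * (16 * \<gamma>2 * \<phi> l) \<le> \<gamma>2"
      using n c_pos by (simp add: K_def)
    then have "\<gamma>2 * (16 * (real n * \<phi> l)) \<le> \<gamma>2 * 1" by (simp add: mult_ac)
    then have n16: "16 * (real n * \<phi> l) \<le> 1" using g by (simp only: mult_le_cancel_left_pos)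
    define L where "L = (1 - \<phi> l) / (1 - l)"
    have phil: "0 < \<phi> l" "\<phi> l \<le> 1" using l phi_pos phi_mono[of l 1] phi_1 by auto
    have L0: "0 \<le> L" using phil l by (simp add: L_def)
    have "1 - L \<le> 2 * \<phi> l"
    proof -
      have "1 - L = (\<phi> l - l) / (1 - l)" using l by (simp add: L_def field_simps)
      also have "\<dots> \<le> \<phi> l / (1 - l)" using l by (intro divide_right_mono) auto
      also have "\<dots> \<le> \<phi> l / (1 / 2)" using l phil by (intro divide_left_mono) auto
      finally show ?thesis by simp
    qed
    moreover have "1 + real n * (L - 1) \<le> (1 + (L - 1)) ^ n"
      using L0 by (intro Bernoulli_inequality) simp
    moreover have "real n * (1 - L) \<le> real n * (2 * \<phi> l)"
      using calculation(1) by (intro mult_left_mono) auto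
    ultimately have Ln: "1 - L ^ n \<le> 1 / 8" using n16 by (simp add: algebra_simps)
    have nn: "(\<integral>\<^sup>+t. ennreal (exp (- l * t)) \<partial>T n) = ennreal (L ^ n)"
      unfolding conv_pow_Laplace L_def using l phil by (subst gap_law_Laplace) (auto simp: ennreal_power)
    have int: "integrable (T n) (\<lambda>t. exp (- l * t))"
      by (rule integrableI_nonneg) (auto simp: nn[simplified])
    have eq: "(\<integral>t. exp (- l * t) \<partial>T n) = L ^ n"
      using nn L0 by (subst integral_eq_nn_integral) auto
    have "measure (T n) {R\<^sup>2 / \<epsilon><..} = (\<integral>t. indicator {R\<^sup>2 / \<epsilon><..} t \<partial>T n)" by simp
    also have "\<dots> \<le> (\<integral>t. 2 * (1 - exp (- l * t)) \<partial>T n)"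
    proof (rule integral_mono_AE)
      show "AE t in T n. indicator {R\<^sup>2 / \<epsilon><..} t \<le> 2 * (1 - exp (- l * t))"
        using conv_pow_nonneg[of n]
      proof eventually_elim
        case (elim t)
        show ?case
        proof (cases "R\<^sup>2 / \<epsilon> < t")
          case True
          then have "1 \<le> l * t" using \<epsilon> R2 R by (simp add: l_def field_simps)
          then have "exp (- l * t) \<le> exp (- 1)" by simp
          moreover have "exp (- 1) \<le> 1 / (2::real)"
            using exp_ge_add_one_self[of "1::real"] by (simp add: exp_minus field_simps)
          ultimately have "2 * exp (- l * t) \<le> 1" by linarith
          then show ?thesis using True by simp
        qed (use elim l in simp)
      qed
    next
      show "integrable (T n) (indicat_real {R\<^sup>2 / \<epsilon><..})"
        by (rule integrable_real_indicator) (auto simp: Tn.emeasure_eq_measure)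
    qed (use int in auto)
    also have "\<dots> = 2 * (1 - L ^ n)" using int by (simp add: eq[simplified] Tn.prob_space[simplified])
    also have "\<dots> \<le> 1 / 4" using Ln by simp
    finally show "measure (T n) {R\<^sup>2 / \<epsilon><..} \<le> 1 / 4" .
  qed
qed

section \<open>Comparison of transition kernels\<close>

lemma T_concentration:
  assumes g: "0 < \<gamma>1" "0 < \<gamma>2"
  shows "\<exists>\<epsilon>>0. \<epsilon> \<le> 1 / 2 \<and> (\<forall>R\<ge>1. \<forall>n. 2 \<le> \<epsilon> * R\<^sup>2 \<longrightarrow> \<gamma>1 \<le> real n * \<phi> (1 / R\<^sup>2) \<longrightarrow>
     real n * \<phi> (1 / R\<^sup>2) \<le> \<gamma>2 \<longrightarrow> 1 \<le> 2 * emeasure (T n) {\<epsilon> * R\<^sup>2..R\<^sup>2 / \<epsilon>})"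
proof -
  obtain e1 where e1: "0 < e1" "\<And>\<epsilon> R n. 0 < \<epsilon> \<Longrightarrow> \<epsilon> \<le> e1 \<Longrightarrow> \<epsilon> \<le> 1 \<Longrightarrow> 2 \<le> \<epsilon> * R\<^sup>2 \<Longrightarrow>
     \<gamma>1 \<le> real n * \<phi> (1 / R\<^sup>2) \<Longrightarrow> measure (T n) {..<\<epsilon> * R\<^sup>2} \<le> 1 / 4"
    using T_lower_tail[OF g(1)] by blast
  obtain e2 where e2: "0 < e2" "\<And>\<epsilon> R n. 0 < \<epsilon> \<Longrightarrow> \<epsilon> \<le> e2 \<Longrightarrow> \<epsilon> \<le> 1 / 2 \<Longrightarrow> 1 \<le> R \<Longrightarrow>
     real n * \<phi> (1 / R\<^sup>2) \<le> \<gamma>2 \<Longrightarrow> measure (T n) {R\<^sup>2 / \<epsilon><..} \<le> 1 / 4"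
    using T_upper_tail[OF g(2)] by blast
  define \<epsilon> where "\<epsilon> = min (1 / 2) (min e1 e2)"
  have \<epsilon>: "0 < \<epsilon>" "\<epsilon> \<le> e1" "\<epsilon> \<le> e2" "\<epsilon> \<le> 1 / 2" using e1 e2 by (auto simp: \<epsilon>_def)
  show ?thesis
  proof (intro exI[of _ \<epsilon>] conjI allI impI \<epsilon>)
    fix R :: real and n :: nat
    assume R: "1 \<le> R" "2 \<le> \<epsilon> * R\<^sup>2" and n: "\<gamma>1 \<le> real n * \<phi> (1 / R\<^sup>2)" "real n * \<phi> (1 / R\<^sup>2) \<le> \<gamma>2"
    interpret Tn: prob_space "T n" by (rule prob_space_conv_pow)
    have lo: "measure (T n) {..<\<epsilon> * R\<^sup>2} \<le> 1 / 4" using e1(2)[of \<epsilon> R n] \<epsilon> R n by simp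
    have up: "measure (T n) {R\<^sup>2 / \<epsilon><..} \<le> 1 / 4" using e2(2)[of \<epsilon> R n] \<epsilon> R n by simp
    have "1 = measure (T n) (space (T n))" by (simp add: Tn.prob_space)
    also have "\<dots> \<le> measure (T n) ({..<\<epsilon> * R\<^sup>2} \<union> ({\<epsilon> * R\<^sup>2..R\<^sup>2 / \<epsilon>} \<union> {R\<^sup>2 / \<epsilon><..}))"
      by (rule Tn.finite_measure_mono) auto
    also have "\<dots> \<le> measure (T n) {..<\<epsilon> * R\<^sup>2} + (measure (T n) {\<epsilon> * R\<^sup>2..R\<^sup>2 / \<epsilon>} + measure (T n) {R\<^sup>2 / \<epsilon><..})"
      by (rule order_trans[OF measure_Un_le]) (auto intro!: measure_Un_le)
    finally have "1 / 2 \<le> measure (T n) {\<epsilon> * R\<^sup>2..R\<^sup>2 / \<epsilon>}" using lo up by simp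
    then have "ennreal 1 \<le> ennreal (2 * measure (T n) {\<epsilon> * R\<^sup>2..R\<^sup>2 / \<epsilon>})"
      by (intro ennreal_leI) simp
    then show "1 \<le> 2 * emeasure (T n) {\<epsilon> * R\<^sup>2..R\<^sup>2 / \<epsilon>}"
      by (simp add: Tn.emeasure_eq_measure ennreal_mult')
  qed
qed

text \<open>For \<open>\<theta>\<^sub>n = t\<close> of order at least \<open>R\<^sup>2\<close>, add an independent increment \<open>\<theta>\<^sub>k\<close>, which lies in the
  window \<open>[\<epsilon> R\<^sup>2, R\<^sup>2 / \<epsilon>]\<close> with probability at least \<open>1/2\<close>; there the smoothing loss is bounded. For
  smaller \<open>t\<close> the increments need not be linked: the kernel at \<open>t\<close> is compared with the kernel at
  \<^emph>\<open>every\<close> time \<open>s\<close> of the window, which stays at distance of order \<open>R\<^sup>2\<close> from \<open>t\<close> because the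
  threshold is half the lower end of the window, and averaging over \<open>\<theta>\<^sub>n\<close> costs the finite expected
  loss.\<close>

lemma mixed_heat_Harnack:
  assumes g: "0 < \<gamma>1" "0 < \<gamma>2"
  shows "\<exists>C>0. \<exists>R0\<ge>1. \<forall>R\<ge>R0. \<forall>n k. \<forall>u y :: int ^ 'n.
     \<gamma>1 \<le> real n * \<phi> (1 / R\<^sup>2) \<longrightarrow> real n * \<phi> (1 / R\<^sup>2) \<le> \<gamma>2 \<longrightarrow>
     \<gamma>1 \<le> real k * \<phi> (1 / R\<^sup>2) \<longrightarrow> real k * \<phi> (1 / R\<^sup>2) \<le> \<gamma>2 \<longrightarrow>
     (\<forall>i. real_of_int \<bar>u $ i\<bar> \<le> 2 * R) \<longrightarrow>
     mixed_heat n y \<le> ennreal C * mixed_heat (n + k) (y + u)"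
proof -
  let ?d = "CARD('n)"
  obtain \<epsilon> where \<epsilon>: "0 < \<epsilon>" "\<epsilon> \<le> 1 / 2" and conc: "\<And>R n. 1 \<le> R \<Longrightarrow> 2 \<le> \<epsilon> * R\<^sup>2 \<Longrightarrow>
     \<gamma>1 \<le> real n * \<phi> (1 / R\<^sup>2) \<Longrightarrow> real n * \<phi> (1 / R\<^sup>2) \<le> 2 * \<gamma>2 \<Longrightarrow>
     1 \<le> 2 * emeasure (T n) {\<epsilon> * R\<^sup>2..R\<^sup>2 / \<epsilon>}"
    using T_concentration[of \<gamma>1 "2 * \<gamma>2"] g by (metis mult_pos_pos zero_less_numeral)
  obtain C0 where C0: "0 < C0" "\<And>R n. 1 \<le> R \<Longrightarrow> \<gamma>1 \<le> real n * \<phi> (1 / R\<^sup>2) \<Longrightarrow>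
     (\<integral>\<^sup>+t. ennreal (smoothing_loss ?d R t) \<partial>T n) \<le> ennreal C0"
    using smoothing_loss_moment[OF g(1), of ?d] by blast
  define \<delta> where "\<delta> = \<epsilon> / 2"
  have \<delta>: "0 < \<delta>" "\<delta> \<le> 1" "\<delta> \<le> \<epsilon>" using \<epsilon> by (auto simp: \<delta>_def)
  obtain C1 where C1_pos: "0 < C1" and C1_all: "\<forall>R\<ge>1. \<forall>t>0. \<forall>H\<ge>1. \<forall>u v :: int ^ 'n. \<delta> * R\<^sup>2 \<le> H \<longrightarrow> \<delta> * H \<le> R\<^sup>2 \<longrightarrow>
     (\<forall>i. real_of_int \<bar>u $ i\<bar> \<le> 2 * R) \<longrightarrow> heat t v \<le> C1 * smoothing_loss ?d R t * heat (t + H) (v + u)"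
    using heat_smoothing[OF \<delta>(1), where 'n='n] by (elim exE conjE)
  note C1 = C1_pos C1_all[rule_format]
  define C2 where "C2 = C1 * (1 / \<delta>) ^ ?d"
  have C2: "0 < C2" using C1 \<delta> by (simp add: C2_def)
  define C where "C = 2 * C2 + 2 * C1 * C0"
  have C: "0 < C" using C0 C1 C2 by (auto simp: C_def intro: add_pos_pos)
  \<comment> \<open>This puts the threshold \<open>\<delta> * R\<^sup>2\<close> above \<open>1\<close>, as the heat kernel estimates need times of at least \<open>1\<close>.\<close>
  define R0 where "R0 = max 1 (sqrt (2 / \<epsilon>))"
  show ?thesis
  proof (rule exI[of _ C], rule conjI[OF C], rule exI[of _ R0], intro conjI allI impI)
    show "1 \<le> R0" by (simp add: R0_def)
    fix R :: real and n k and u y :: "int ^ 'n"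
    assume "R0 \<le> R" and n: "\<gamma>1 \<le> real n * \<phi> (1 / R\<^sup>2)" "real n * \<phi> (1 / R\<^sup>2) \<le> \<gamma>2"
      and k: "\<gamma>1 \<le> real k * \<phi> (1 / R\<^sup>2)" "real k * \<phi> (1 / R\<^sup>2) \<le> \<gamma>2"
      and u: "\<forall>i. real_of_int \<bar>u $ i\<bar> \<le> 2 * R"
    then have R: "1 \<le> R" "sqrt (2 / \<epsilon>) \<le> R" by (auto simp: R0_def)
    have "2 / \<epsilon> \<le> R\<^sup>2" using R \<epsilon> by (simp add: sqrt_le_D)
    then have eR: "2 \<le> \<epsilon> * R\<^sup>2" using \<epsilon> by (simp add: divide_le_eq mult.commute)
    then have dR: "1 \<le> \<delta> * R\<^sup>2" by (simp add: \<delta>_def)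
    have n0: "0 < n" using n g by (intro gr0I) simp
    let ?G = "{\<epsilon> * R\<^sup>2..R\<^sup>2 / \<epsilon>}"
    have Gk: "1 \<le> 2 * emeasure (T k) ?G" using conc[OF R(1) eR k(1)] k g by simp
    have "real (n + k) * \<phi> (1 / R\<^sup>2) \<le> 2 * \<gamma>2" "\<gamma>1 \<le> real (n + k) * \<phi> (1 / R\<^sup>2)"
      using n k g by (simp_all add: algebra_simps)
    then have Gnk: "1 \<le> 2 * emeasure (T (n + k)) ?G" using conc[OF R(1) eR] by blast
    let ?h = "\<lambda>t. ennreal (heat t (y + u))"
    have hm: "?h \<in> borel_measurable borel" by measurable
    have pointwise: "ennreal (heat t y) \<le> ennreal (2 * C2) * (\<integral>\<^sup>+s. ?h (t + s) \<partial>T k) +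
        ennreal (2 * C1) * ennreal (smoothing_loss ?d R t) * mixed_heat (n + k) (y + u)" if t: "0 < t" for t
    proof (cases "\<delta> * R\<^sup>2 \<le> t")
      case True
      have "sqrt \<delta> * R \<le> sqrt t"
        using True R \<delta> real_sqrt_le_mono[OF True] by (simp add: real_sqrt_mult)
      moreover have "\<delta> \<le> sqrt \<delta>" using \<delta> by (intro real_le_rsqrt) (simp add: power2_eq_square mult_left_le)
      then have "\<delta> * R \<le> sqrt \<delta> * R" using R by (intro mult_right_mono) auto
      moreover have "\<delta> * R \<le> R" using \<delta> R by (simp add: mult_le_cancel_right1)
      ultimately have "\<delta> * R \<le> max 1 (min (sqrt t) R)" by auto
      then have "R / max 1 (min (sqrt t) R) \<le> 1 / \<delta>"
        using \<delta> by (simp add: divide_simps mult.commute)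
      then have loss: "smoothing_loss ?d R t \<le> (1 / \<delta>) ^ ?d"
        unfolding smoothing_loss_def using R by (intro power_mono) auto
      have "ennreal (heat t y) * 1 \<le> ennreal (heat t y) * (2 * emeasure (T k) ?G)"
        by (intro mult_left_mono Gk) auto
      also have "\<dots> = (\<integral>\<^sup>+s. 2 * ennreal (heat t y) * indicator ?G s \<partial>T k)"
        by (subst nn_integral_cmult_indicator) (auto simp: mult_ac)
      also have "\<dots> \<le> (\<integral>\<^sup>+s. ennreal (2 * C2) * ?h (t + s) \<partial>T k)"
      proof (rule nn_integral_mono)
        fix s
        have "heat t y \<le> C2 * heat (t + s) (y + u)" if s: "s \<in> ?G"
        proof -
          have "heat t y \<le> C1 * smoothing_loss ?d R t * heat (t + s) (y + u)"
          proof (rule C1(2)[OF R(1) t])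
            show "1 \<le> s" using s eR by simp
            show "\<delta> * R\<^sup>2 \<le> s" using s \<delta> R by (auto intro: order_trans[OF mult_right_mono])
            have "\<delta> * s \<le> \<epsilon> * (R\<^sup>2 / \<epsilon>)" using s \<delta> \<epsilon> eR by (intro mult_mono) auto
            then show "\<delta> * s \<le> R\<^sup>2" using \<epsilon> by simp
          qed (use u in auto)
          also have "\<dots> \<le> C1 * (1 / \<delta>) ^ ?d * heat (t + s) (y + u)"
            using C1 loss by (intro mult_right_mono mult_left_mono) auto
          finally show ?thesis by (simp add: C2_def)
        qed
        then have "2 * ennreal (heat t y) \<le> ennreal (2 * C2) * ?h (t + s)" if "s \<in> ?G"
          using that C2 ennreal_leI[of "2 * heat t y" "2 * C2 * heat (t + s) (y + u)"]
          by (simp add: ennreal_mult')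
        then show "2 * ennreal (heat t y) * indicator ?G s \<le> ennreal (2 * C2) * ?h (t + s)"
          by (auto simp: indicator_def)
      qed
      also have "\<dots> = ennreal (2 * C2) * (\<integral>\<^sup>+s. ?h (t + s) \<partial>T k)"
        by (rule nn_integral_cmult) measurable
      finally show ?thesis by (simp add: add_increasing2)
    next
      case False
      have "ennreal (heat t y) * 1 \<le> ennreal (heat t y) * (2 * emeasure (T (n + k)) ?G)"
        by (intro mult_left_mono Gnk) auto
      also have "\<dots> = (\<integral>\<^sup>+s. 2 * ennreal (heat t y) * indicator ?G s \<partial>T (n + k))"
        by (subst nn_integral_cmult_indicator) (auto simp: mult_ac)
      also have "\<dots> \<le> (\<integral>\<^sup>+s. ennreal (2 * C1) * ennreal (smoothing_loss ?d R t) * ?h s \<partial>T (n + k))"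
      proof (rule nn_integral_mono)
        fix s
        have "heat t y \<le> C1 * smoothing_loss ?d R t * heat s (y + u)" if s: "s \<in> ?G"
        proof -
          have "heat t y \<le> C1 * smoothing_loss ?d R t * heat (t + (s - t)) (y + u)"
          proof (rule C1(2)[OF R(1) t])
            show *: "\<delta> * R\<^sup>2 \<le> s - t" using s False by (simp add: \<delta>_def)
            show "1 \<le> s - t" using * dR by simp
            have "\<delta> * (s - t) \<le> \<epsilon> * (R\<^sup>2 / \<epsilon>)" using s t \<delta> \<epsilon> * dR by (intro mult_mono) auto
            then show "\<delta> * (s - t) \<le> R\<^sup>2" using \<epsilon> by simp
          qed (use u in auto)
          then show ?thesis by simp
        qed
        then have "2 * ennreal (heat t y) \<le> ennreal (2 * C1) * ennreal (smoothing_loss ?d R t) * ?h s" if "s \<in> ?G"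
          using that C1 R(1) ennreal_leI[of "2 * heat t y" "2 * C1 * smoothing_loss ?d R t * heat s (y + u)"]
          by (simp add: ennreal_mult' ennreal_mult)
        then show "2 * ennreal (heat t y) * indicator ?G s \<le> ennreal (2 * C1) * ennreal (smoothing_loss ?d R t) * ?h s"
          by (auto simp: indicator_def)
      qed
      also have "\<dots> = ennreal (2 * C1) * ennreal (smoothing_loss ?d R t) * mixed_heat (n + k) (y + u)"
        unfolding mixed_heat_def by (rule nn_integral_cmult) measurable
      finally show ?thesis by (simp add: add_increasing)
    qed
    have [measurable]: "(\<lambda>t. \<integral>\<^sup>+s. ?h (t + s) \<partial>T k) \<in> borel_measurable borel"
      by (rule measurable_nn_integral_conv_pow[OF hm])
    have "mixed_heat n y \<le> (\<integral>\<^sup>+t. ennreal (2 * C2) * (\<integral>\<^sup>+s. ?h (t + s) \<partial>T k) +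
        ennreal (2 * C1) * ennreal (smoothing_loss ?d R t) * mixed_heat (n + k) (y + u) \<partial>T n)"
      unfolding mixed_heat_def[of n]
      by (rule nn_integral_mono_AE, use conv_pow_pos[OF n0] in eventually_elim) (rule pointwise)
    also have "\<dots> = (\<integral>\<^sup>+t. ennreal (2 * C2) * (\<integral>\<^sup>+s. ?h (t + s) \<partial>T k) \<partial>T n) +
        (\<integral>\<^sup>+t. ennreal (2 * C1) * ennreal (smoothing_loss ?d R t) * mixed_heat (n + k) (y + u) \<partial>T n)"
      by (rule nn_integral_add) measurable
    also have "(\<integral>\<^sup>+t. ennreal (2 * C2) * (\<integral>\<^sup>+s. ?h (t + s) \<partial>T k) \<partial>T n) = ennreal (2 * C2) * (\<integral>\<^sup>+t. (\<integral>\<^sup>+s. ?h (t + s) \<partial>T k) \<partial>T n)"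
      by (rule nn_integral_cmult) measurable
    also have "(\<integral>\<^sup>+t. (\<integral>\<^sup>+s. ?h (t + s) \<partial>T k) \<partial>T n) = mixed_heat (n + k) (y + u)"
      unfolding mixed_heat_def by (rule nn_integral_conv_pow_add[symmetric, OF hm])
    also have "(\<integral>\<^sup>+t. ennreal (2 * C1) * ennreal (smoothing_loss ?d R t) * mixed_heat (n + k) (y + u) \<partial>T n) =
       ennreal (2 * C1) * (\<integral>\<^sup>+t. ennreal (smoothing_loss ?d R t) \<partial>T n) * mixed_heat (n + k) (y + u)"
      by (subst nn_integral_multc, measurable, subst nn_integral_cmult, measurable)
    also have "ennreal (2 * C2) * mixed_heat (n + k) (y + u) +
        ennreal (2 * C1) * (\<integral>\<^sup>+t. ennreal (smoothing_loss ?d R t) \<partial>T n) * mixed_heat (n + k) (y + u) \<le>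
        ennreal (2 * C2) * mixed_heat (n + k) (y + u) + ennreal (2 * C1) * ennreal C0 * mixed_heat (n + k) (y + u)"
      by (intro add_left_mono mult_right_mono mult_left_mono C0(2)[OF R(1) n(1)]) auto
    also have "\<dots> = (ennreal (2 * C2) + ennreal (2 * C1) * ennreal C0) * mixed_heat (n + k) (y + u)"
      by (simp only: distrib_right)
    also have "ennreal (2 * C2) + ennreal (2 * C1) * ennreal C0 = ennreal C"
      using C0 C1 C2 by (simp add: C_def ennreal_plus ennreal_mult'[symmetric])
    finally show "mixed_heat n y \<le> ennreal C * mixed_heat (n + k) (y + u)" .
  qed
qed

text \<open>The additional \<open>k\<close> steps of the simple random walk stay within distance \<open>R\<close> with probability at
  least \<open>1/2\<close>: since \<open>\<alpha>_up < 1\<close>, \<open>k\<close> is of smaller order than \<open>R\<^sup>2\<close>. They are absorbed into the shift,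
  which may then be as large as \<open>2 R\<close> in each coordinate.\<close>

lemma walk_kernel_Harnack:
  assumes g: "0 < \<gamma>1" "0 < \<gamma>2"
  shows "\<exists>C>0. \<exists>R0\<ge>1. \<forall>R\<ge>R0. \<forall>n k. \<forall>u v :: int ^ 'n.
     \<gamma>1 \<le> real n * \<phi> (1 / R\<^sup>2) \<longrightarrow> real n * \<phi> (1 / R\<^sup>2) \<le> \<gamma>2 \<longrightarrow>
     \<gamma>1 \<le> real k * \<phi> (1 / R\<^sup>2) \<longrightarrow> real k * \<phi> (1 / R\<^sup>2) \<le> \<gamma>2 \<longrightarrow>
     (\<forall>i. real_of_int \<bar>u $ i\<bar> \<le> R) \<longrightarrow>
     walk_kernel n v \<le> ennreal C * walk_kernel (n + k) (v + u)"
proof -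
  obtain C R0 where C: "0 < C" "1 \<le> R0" and mh: "\<And>R n k (u :: int ^ 'n) y. R0 \<le> R \<Longrightarrow>
     \<gamma>1 \<le> real n * \<phi> (1 / R\<^sup>2) \<Longrightarrow> real n * \<phi> (1 / R\<^sup>2) \<le> \<gamma>2 \<Longrightarrow>
     \<gamma>1 \<le> real k * \<phi> (1 / R\<^sup>2) \<Longrightarrow> real k * \<phi> (1 / R\<^sup>2) \<le> \<gamma>2 \<Longrightarrow>
     (\<And>i. real_of_int \<bar>u $ i\<bar> \<le> 2 * R) \<Longrightarrow>
     mixed_heat n y \<le> ennreal C * mixed_heat (n + k) (y + u)"
    using mixed_heat_Harnack[OF g, where 'n='n] by metis
  \<comment> \<open>The second entry makes \<open>k\<close> at most \<open>R\<^sup>2 / 2\<close>.\<close>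
  define R1 where "R1 = max R0 ((2 * \<gamma>2 * c_up) powr (1 / (2 - 2 * \<alpha>_up)))"
  show ?thesis
  proof (rule exI[of _ "2 * C"], rule conjI, use C in simp, rule exI[of _ R1], intro conjI allI impI)
    show "1 \<le> R1" using C by (simp add: R1_def)
    fix R :: real and n k and u v :: "int ^ 'n"
    assume "R1 \<le> R" and n: "\<gamma>1 \<le> real n * \<phi> (1 / R\<^sup>2)" "real n * \<phi> (1 / R\<^sup>2) \<le> \<gamma>2"
      and k: "\<gamma>1 \<le> real k * \<phi> (1 / R\<^sup>2)" "real k * \<phi> (1 / R\<^sup>2) \<le> \<gamma>2"
      and u: "\<forall>i. real_of_int \<bar>u $ i\<bar> \<le> R"
    then have RR: "R0 \<le> R" "(2 * \<gamma>2 * c_up) powr (1 / (2 - 2 * \<alpha>_up)) \<le> R" by (auto simp: R1_def)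
    have R: "1 \<le> R" using RR C by simp
    have kR: "real k / R\<^sup>2 \<le> 1 / 2"
    proof -
      have "R\<^sup>2 = R powr 2" using R by (simp add: powr_numeral)
      have "(1 / R\<^sup>2) powr \<alpha>_up = (R powr (- 2)) powr \<alpha>_up"
        using R by (simp add: powr_minus_divide powr_numeral)
      also have "\<dots> = R powr (- 2 * \<alpha>_up)" by (simp only: powr_powr)
      finally have lo: "R powr (- 2 * \<alpha>_up) / c_up \<le> \<phi> (1 / R\<^sup>2)"
        using phi_lower[of "1 / R\<^sup>2"] R by (simp add: divide_le_eq)
      have "((2 * \<gamma>2 * c_up) powr (1 / (2 - 2 * \<alpha>_up))) powr (2 - 2 * \<alpha>_up) \<le> R powr (2 - 2 * \<alpha>_up)"
        using RR alpha by (intro powr_mono2) auto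
      then have big: "2 * \<gamma>2 * c_up \<le> R powr (2 - 2 * \<alpha>_up)"
        using alpha g c_pos by (simp add: powr_powr)
      have "real k * (R powr (- 2 * \<alpha>_up) / c_up) \<le> \<gamma>2"
        using order_trans[OF mult_left_mono[OF lo, of "real k"] k(2)] by simp
      then have "2 * (real k * R powr (- 2 * \<alpha>_up)) \<le> 2 * \<gamma>2 * c_up" using c_pos by (simp add: field_simps)
      also have "\<dots> \<le> R powr (2 - 2 * \<alpha>_up)" by (rule big)
      also have "\<dots> = R\<^sup>2 * R powr (- 2 * \<alpha>_up)"
        unfolding \<open>R\<^sup>2 = R powr 2\<close> powr_add[symmetric] by simp
      finally have "(2 * real k) * R powr (- 2 * \<alpha>_up) \<le> R\<^sup>2 * R powr (- 2 * \<alpha>_up)" by simp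
      then have "2 * real k \<le> R\<^sup>2" using R by (simp only: mult_le_cancel_right_pos powr_gt_zero)
      then show ?thesis using R by (simp add: divide_le_eq)
    qed
    let ?S = "{x :: int ^ 'n. sqnorm x < R\<^sup>2}"
    have "1 - real k / R\<^sup>2 \<le> measure (srw k :: (int ^ 'n) pmf) ?S"
      using R by (intro sqnorm_Chebyshev[OF srw_second_moment]) auto
    then have "ennreal 1 \<le> ennreal (2 * measure (srw k :: (int ^ 'n) pmf) ?S)"
      using kR by (intro ennreal_leI) simp
    then have half: "1 \<le> 2 * emeasure (srw k :: (int ^ 'n) pmf) ?S"
      by (simp add: measure_pmf.emeasure_eq_measure ennreal_mult')
    have step: "mixed_heat n (v - x) \<le> (\<integral>\<^sup>+x'. ennreal (2 * C) * mixed_heat (n + k) (v + u - (x + x')) \<partial>(srw k :: (int ^ 'n) pmf))" for x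
    proof -
      have "mixed_heat n (v - x) * 1 \<le> mixed_heat n (v - x) * (2 * emeasure (srw k :: (int ^ 'n) pmf) ?S)"
        by (intro mult_left_mono half) auto
      also have "\<dots> = (\<integral>\<^sup>+x'. 2 * mixed_heat n (v - x) * indicator ?S x' \<partial>(srw k :: (int ^ 'n) pmf))"
        by (subst nn_integral_cmult_indicator) (auto simp: mult_ac)
      also have "\<dots> \<le> (\<integral>\<^sup>+x'. ennreal (2 * C) * mixed_heat (n + k) (v + u - (x + x')) \<partial>(srw k :: (int ^ 'n) pmf))"
      proof (rule nn_integral_mono)
        fix x' :: "int ^ 'n"
        have "mixed_heat n (v - x) \<le> ennreal C * mixed_heat (n + k) (v + u - (x + x'))" if "x' \<in> ?S"
        proof -
          have "real_of_int \<bar>(u - x') $ i\<bar> \<le> 2 * R" for i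
            using abs_le_of_sqnorm_less[of x' R i] that R u[rule_format, of i] by simp
          from mh[OF RR(1) n k this, of "v - x"] show ?thesis by (simp add: algebra_simps)
        qed
        then have "2 * mixed_heat n (v - x) \<le> 2 * (ennreal C * mixed_heat (n + k) (v + u - (x + x')))" if "x' \<in> ?S"
          using that by (intro mult_left_mono) auto
        then show "2 * mixed_heat n (v - x) * indicator ?S x' \<le> ennreal (2 * C) * mixed_heat (n + k) (v + u - (x + x'))"
          using C by (auto simp: indicator_def ennreal_mult' mult.assoc)
      qed
      finally show ?thesis by simp
    qed
    have "walk_kernel n v \<le> (\<integral>\<^sup>+x. (\<integral>\<^sup>+x'. ennreal (2 * C) * mixed_heat (n + k) (v + u - (x + x')) \<partial>(srw k :: (int ^ 'n) pmf)) \<partial>(srw n :: (int ^ 'n) pmf))"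
      unfolding walk_kernel_eq by (intro nn_integral_mono step)
    also have "\<dots> = (\<integral>\<^sup>+x. ennreal (2 * C) * mixed_heat (n + k) (v + u - x) \<partial>(srw (n + k) :: (int ^ 'n) pmf))"
      by (simp add: iid_sum_add)
    also have "\<dots> = ennreal (2 * C) * walk_kernel (n + k) (v + u)"
      unfolding walk_kernel_eq by (rule nn_integral_cmult) simp
    finally show "walk_kernel n v \<le> ennreal (2 * C) * walk_kernel (n + k) (v + u)" .
  qed
qed

end

section \<open>Parabolic functions as averages\<close>

lemma integral_chain_law:
  fixes g :: "(nat \<Rightarrow> nat \<times> (int ^ 'n)) \<Rightarrow> real"
  assumes g: "g \<in> borel_measurable (chain_law \<mu> (k, y))"
  shows "(\<integral>p. g p \<partial>chain_law \<mu> (k, y)) = (\<integral>\<omega>. g (\<lambda>j. (k + j, y + subordinated_walk \<omega> j)) \<partial>step_space \<mu>)"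
    and "integrable (chain_law \<mu> (k, y)) g \<longleftrightarrow> integrable (step_space \<mu>) (\<lambda>\<omega>. g (\<lambda>j. (k + j, y + subordinated_walk \<omega> j)))"
proof -
  have W: "(\<lambda>\<omega> k. y + subordinated_walk \<omega> k) \<in> measurable (step_space \<mu>) path_space"
    by (rule measurable_walk)
  have S: "(\<lambda>s j. (k + j, s j)) \<in> measurable path_space (path_space :: (nat \<Rightarrow> nat \<times> (int ^ 'n)) measure)"
    by (rule measurable_space_time)
  have eq: "chain_law \<mu> (k, y) = distr (step_space \<mu>) path_space (\<lambda>\<omega> j. (k + j, y + subordinated_walk \<omega> j))"
    unfolding chain_law_def walk_law_def prod.case using distr_distr[OF S W] by (simp add: o_def)
  have WS: "(\<lambda>\<omega> j. (k + j, y + subordinated_walk \<omega> j)) \<in> measurable (step_space \<mu>) path_space"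
    using measurable_comp[OF W S] by (simp add: o_def)
  have g': "g \<in> borel_measurable path_space" using g by (simp add: eq)
  show "(\<integral>p. g p \<partial>chain_law \<mu> (k, y)) = (\<integral>\<omega>. g (\<lambda>j. (k + j, y + subordinated_walk \<omega> j)) \<partial>step_space \<mu>)"
    unfolding eq by (rule integral_distr[OF WS g'])
  show "integrable (chain_law \<mu> (k, y)) g \<longleftrightarrow> integrable (step_space \<mu>) (\<lambda>\<omega>. g (\<lambda>j. (k + j, y + subordinated_walk \<omega> j)))"
    unfolding eq by (rule integrable_distr_eq[OF WS g'])
qed

text \<open>Up to time \<open>N\<close> the chain started at time \<open>k\<close> cannot leave the strip, so the stopped process at the
  steps \<open>0\<close> and \<open>l\<close> is the unstopped one; a martingale has constant expectation.\<close>

lemma parabolic_average: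
  fixes q :: "nat \<times> (int ^ 'n) \<Rightarrow> real"
  assumes par: "parabolic \<mu> ({..N} \<times> UNIV) q" and q0: "\<And>v. 0 \<le> q v" and kl: "k + l \<le> N"
  shows "ennreal (q (k, y)) = (\<integral>\<^sup>+\<omega>. ennreal (q (k + l, y + subordinated_walk \<omega> l)) \<partial>step_space \<mu>)"
proof -
  let ?M = "chain_law \<mu> (k, y)"
  let ?X = "\<lambda>j p. q (p (the_enat (min (enat j) (exit_time ({..N} \<times> UNIV) p))))"
  let ?path = "\<lambda>\<omega> j. (k + j, y + subordinated_walk \<omega> j)"
  interpret P: prob_space "step_space \<mu> :: ((nat \<Rightarrow> int ^ 'n) \<times> (nat \<Rightarrow> nat)) measure"
    by (rule prob_space_step_space)
  interpret M: prob_space ?M by (rule prob_space_chain_law)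
  have mart: "martingale ?M path_filtration ?X" using par unfolding parabolic_def by blast
  then have sub: "subalgebra ?M (path_filtration 0)" and int: "\<And>j. integrable ?M (?X j)"
    and ce: "AE p in ?M. real_cond_exp ?M (path_filtration 0) (?X l) p = ?X 0 p"
    unfolding martingale_def by auto
  interpret sub: finite_measure_subalgebra ?M "path_filtration 0"
    by unfold_locales (rule sub)
  have meas: "?X j \<in> borel_measurable ?M" for j using int by (rule borel_measurable_integrable)
  have path: "?X j (?path \<omega>) = q (k + j, y + subordinated_walk \<omega> j)" if "k + j \<le> N" for j \<omega>
  proof -
    have "enat j \<le> exit_time ({..N} \<times> UNIV) (?path \<omega>)"
      unfolding exit_time_def using that by (auto intro!: Inf_greatest)
    then show ?thesis by (simp add: min_absorb1)
  qed
  have "(\<integral>p. ?X l p \<partial>?M) = (\<integral>p. real_cond_exp ?M (path_filtration 0) (?X l) p \<partial>?M)"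
    using sub.real_cond_exp_int(2)[OF int] by simp
  also have "\<dots> = (\<integral>p. ?X 0 p \<partial>?M)"
    using ce meas by (intro integral_cong_AE) auto
  finally have eq: "(\<integral>p. ?X l p \<partial>?M) = (\<integral>p. ?X 0 p \<partial>?M)" .
  have "(\<integral>\<omega>. q (k + l, y + subordinated_walk \<omega> l) \<partial>step_space \<mu>) = (\<integral>\<omega>. q (k + 0, y + subordinated_walk \<omega> 0) \<partial>step_space \<mu>)"
    using eq integral_chain_law(1)[OF meas[of l]] integral_chain_law(1)[OF meas[of 0]] path[of l] path[of 0] kl by simp
  also have "\<dots> = q (k, y)" by (simp add: subordinated_walk_def case_prod_beta' P.prob_space)
  finally have 1: "(\<integral>\<omega>. q (k + l, y + subordinated_walk \<omega> l) \<partial>step_space \<mu>) = q (k, y)" .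
  have "integrable (step_space \<mu>) (\<lambda>\<omega>. q (k + l, y + subordinated_walk \<omega> l))"
    using int[of l] integral_chain_law(2)[OF meas[of l]] path[of l] kl by simp
  from nn_integral_eq_integral[OF this] show ?thesis using q0 1 by simp
qed

context bernstein
begin

lemma parabolic_kernel:
  fixes q :: "nat \<times> (int ^ 'n) \<Rightarrow> real"
  assumes par: "parabolic \<mu> ({..k + l} \<times> UNIV) q" and q0: "\<And>v. 0 \<le> q v"
  shows "ennreal (q (k, y)) = (\<integral>\<^sup>+x. walk_kernel l (x - y) * ennreal (q (k + l, x)) \<partial>count_space UNIV)"
proof -
  have "ennreal (q (k, y)) = (\<integral>\<^sup>+x. walk_kernel l x * ennreal (q (k + l, y + x)) \<partial>count_space UNIV)"
    unfolding parabolic_average[OF par q0 order.refl] by (rule nn_integral_walk_pmf)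
  also have "\<dots> = (\<integral>\<^sup>+x. walk_kernel l ((x + y) - y) * ennreal (q (k + l, x + y)) \<partial>count_space UNIV)"
    by (simp add: add.commute)
  also have "\<dots> = (\<integral>\<^sup>+x. walk_kernel l (x - y) * ennreal (q (k + l, x)) \<partial>count_space UNIV)"
    by (rule nn_integral_bij_count_space[where g="\<lambda>x. x + y" and f="\<lambda>x. walk_kernel l (x - y) * ennreal (q (k + l, x))"])
       (rule bij_betwI[where g="\<lambda>x. x - y"], auto)
  finally show ?thesis .
qed

lemma parabolic_Harnack_of_kernel:
  fixes q :: "nat \<times> (int ^ 'n) \<Rightarrow> real"
  assumes par: "parabolic \<mu> ({..l + k} \<times> UNIV) q" and q0: "\<And>v. 0 \<le> q v" and C: "0 \<le> C"
    and kernel: "\<And>v. walk_kernel l v \<le> ennreal C * walk_kernel (l + k) (v + (y - w))"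
  shows "q (k, y) \<le> C * q (0, w)"
proof -
  have "ennreal (q (k, y)) = (\<integral>\<^sup>+x. walk_kernel l (x - y) * ennreal (q (k + l, x)) \<partial>count_space UNIV)"
    using par q0 by (intro parabolic_kernel) (auto simp: add.commute)
  also have "\<dots> \<le> (\<integral>\<^sup>+x. ennreal C * (walk_kernel (l + k) (x - w) * ennreal (q (0 + (l + k), x))) \<partial>count_space UNIV)"
  proof (rule nn_integral_mono)
    fix x
    have "walk_kernel l (x - y) * ennreal (q (k + l, x)) \<le> ennreal C * walk_kernel (l + k) (x - w) * ennreal (q (k + l, x))"
      using kernel[of "x - y"] by (intro mult_right_mono) auto
    then show "walk_kernel l (x - y) * ennreal (q (k + l, x)) \<le> ennreal C * (walk_kernel (l + k) (x - w) * ennreal (q (0 + (l + k), x)))"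
      by (simp add: mult.assoc add.commute)
  qed
  also have "\<dots> = ennreal C * (\<integral>\<^sup>+x. walk_kernel (l + k) (x - w) * ennreal (q (0 + (l + k), x)) \<partial>count_space UNIV)"
    by (rule nn_integral_cmult) simp
  also have "\<dots> = ennreal C * ennreal (q (0, w))"
    using par q0 by (subst parabolic_kernel[of 0 "l + k" q w]) auto
  finally show ?thesis using C q0 by (simp add: ennreal_mult'[symmetric])
qed

end

section \<open>The Harnack inequality\<close>

lemma abs_component_diff_le:
  assumes "y \<in> lattice_ball z r" "w \<in> lattice_ball z r"
  shows "real_of_int \<bar>(y - w) $ i\<bar> \<le> 2 * r"
proof -
  have "\<bar>real_of_int ((y - w) $ i)\<bar> = \<bar>(real_vec y - real_vec w) $ i\<bar>"
    by (simp add: real_vec_def)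
  also have "\<dots> \<le> norm (real_vec y - real_vec w)" by (rule component_le_norm_cart)
  also have "\<dots> = norm ((real_vec y - z) - (real_vec w - z))" by simp
  also have "\<dots> \<le> norm (real_vec y - z) + norm (real_vec w - z)" by (rule norm_triangle_ineq4)
  also have "\<dots> \<le> 2 * r" using assms by (simp add: lattice_ball_def)
  finally show ?thesis by simp
qed

context scaled_bernstein
begin

lemma time_scale_eq: "time_scale \<phi> \<gamma> r = nat \<lfloor>\<gamma> / \<phi> (1 / r\<^sup>2)\<rfloor>"
  by (simp add: time_scale_def power_int_minus divide_inverse)

text \<open>Write \<open>X = \<gamma> / \<phi> (R\<^sup>-\<^sup>2)\<close>. The choice of \<open>B\<close> makes the cylinder at most \<open>X / 2\<close> steps long, so \<open>k\<close> is
  between \<open>X - 1\<close> and \<open>3 X / 2\<close>; the choice of \<open>b\<close> makes the strip at least \<open>3 X - 1\<close> steps long, so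
  that at least \<open>3 X / 2 - 1\<close> steps remain after \<open>k\<close>. Since \<open>X\<close> tends to infinity with \<open>R\<close>, rounding
  is harmless once \<open>X \<ge> 2\<close>.\<close>

lemma time_scales:
  assumes \<gamma>: "0 < \<gamma>"
  shows "\<exists>\<gamma>2>0. \<exists>R0\<ge>1. \<forall>R\<ge>R0. \<forall>k. k \<in> {time_scale \<phi> \<gamma> R..time_scale \<phi> \<gamma> R + time_scale \<phi> \<gamma> (R / const_B c_low \<alpha>_low)} \<longrightarrow>
     (\<exists>l. time_scale \<phi> \<gamma> (sqrt (const_b c_low \<alpha>_low) * R) = l + k \<and>
       \<gamma> / 2 \<le> real l * \<phi> (1 / R\<^sup>2) \<and> real l * \<phi> (1 / R\<^sup>2) \<le> \<gamma>2 \<and>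
       \<gamma> / 2 \<le> real k * \<phi> (1 / R\<^sup>2) \<and> real k * \<phi> (1 / R\<^sup>2) \<le> \<gamma>2)"
proof -
  define B where "B = const_B c_low \<alpha>_low"
  define b where "b = real_of_int (const_b c_low \<alpha>_low)"
  have B3: "3 \<le> B" and BB: "(2 / c_low) powr (1 / (2 * \<alpha>_low)) \<le> B" by (auto simp: B_def const_B_def)
  have b3: "3 \<le> b" and bb: "(3 / c_low) powr (1 / \<alpha>_low) \<le> b"
    by (auto simp: b_def const_b_def) linarith
  have "2 / c_low = ((2 / c_low) powr (1 / (2 * \<alpha>_low))) powr (2 * \<alpha>_low)"
    using c_pos alpha by (simp add: powr_powr)
  also have "\<dots> \<le> B powr (2 * \<alpha>_low)" using BB alpha by (intro powr_mono2) auto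
  also have "\<dots> = (B powr 2) powr \<alpha>_low" by (simp only: powr_powr)
  also have "B powr 2 = B\<^sup>2" using B3 by (simp add: powr_numeral)
  finally have B2: "2 \<le> c_low * (B\<^sup>2) powr \<alpha>_low" using c_pos by (simp add: field_simps)
  have "3 / c_low = ((3 / c_low) powr (1 / \<alpha>_low)) powr \<alpha>_low"
    using c_pos alpha by (simp add: powr_powr)
  also have "\<dots> \<le> b powr \<alpha>_low" using bb alpha by (intro powr_mono2) auto
  finally have b2: "3 \<le> c_low * b powr \<alpha>_low" using c_pos by (simp add: field_simps)
  define \<gamma>2 where "\<gamma>2 = \<gamma> * (c_up * b powr \<alpha>_up)"
  have \<gamma>2: "0 < \<gamma>2" using \<gamma> c_pos b3 by (simp add: \<gamma>2_def)
  \<comment> \<open>The first entry keeps \<open>B\<^sup>2 / R\<^sup>2\<close> within the range of the scaling condition, the second makes \<open>X\<close> at least \<open>2\<close>.\<close>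
  define R0 where "R0 = max B ((2 / (\<gamma> * c_low)) powr (1 / (2 * \<alpha>_low)))"
  show ?thesis
  proof (rule exI[of _ \<gamma>2], rule conjI[OF \<gamma>2], rule exI[of _ R0], intro conjI allI impI)
    show "1 \<le> R0" using B3 by (simp add: R0_def)
    fix R k assume "R0 \<le> R"
      and k: "k \<in> {time_scale \<phi> \<gamma> R..time_scale \<phi> \<gamma> R + time_scale \<phi> \<gamma> (R / const_B c_low \<alpha>_low)}"
    then have RB: "B \<le> R" and RR: "(2 / (\<gamma> * c_low)) powr (1 / (2 * \<alpha>_low)) \<le> R" by (auto simp: R0_def)
    have R: "1 \<le> R" "0 < R" using RB B3 by auto
    define s where "s = \<phi> (1 / R\<^sup>2)"
    have R2: "1 \<le> R\<^sup>2" using R by simp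
    have s: "0 < s" unfolding s_def using R R2 by (intro phi_pos) auto
    define X where "X = \<gamma> / s"
    have X: "0 < X" "X * s = \<gamma>" using s \<gamma> by (auto simp: X_def)
    have "2 / (\<gamma> * c_low) = ((2 / (\<gamma> * c_low)) powr (1 / (2 * \<alpha>_low))) powr (2 * \<alpha>_low)"
      using c_pos alpha \<gamma> by (simp add: powr_powr)
    also have "\<dots> \<le> R powr (2 * \<alpha>_low)" using RR alpha by (intro powr_mono2) auto
    also have "\<dots> = (R powr 2) powr \<alpha>_low" by (simp only: powr_powr)
    also have "R powr 2 = R\<^sup>2" using R by (simp add: powr_numeral)
    finally have Rbig: "2 / (\<gamma> * c_low) \<le> (R\<^sup>2) powr \<alpha>_low" .
    have "s \<le> (1 / R\<^sup>2) powr \<alpha>_low / c_low" unfolding s_def using R R2 by (intro phi_upper) auto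
    also have "\<dots> = 1 / ((R\<^sup>2) powr \<alpha>_low * c_low)" using R by (simp add: powr_divide)
    also have "\<dots> \<le> 1 / (2 / (\<gamma> * c_low) * c_low)"
      using Rbig c_pos \<gamma> R by (intro divide_left_mono mult_right_mono mult_pos_pos) auto
    also have "\<dots> = \<gamma> / 2" using c_pos \<gamma> by simp
    finally have "s \<le> \<gamma> / 2" .
    then have X2: "2 \<le> X" using s by (simp add: X_def field_simps)
    have tR: "time_scale \<phi> \<gamma> R = nat \<lfloor>X\<rfloor>" by (simp add: time_scale_eq X_def s_def)
    have tRB: "real (time_scale \<phi> \<gamma> (R / B)) \<le> X / 2"
    proof -
      have scale: "c_low * ((B\<^sup>2 / R\<^sup>2) / (1 / R\<^sup>2)) powr \<alpha>_low * \<phi> (1 / R\<^sup>2) \<le> \<phi> (B\<^sup>2 / R\<^sup>2)"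
      proof (rule phi_scale_ge)
        show "1 / R\<^sup>2 \<le> B\<^sup>2 / R\<^sup>2" using B3 by (intro divide_right_mono) (auto simp: one_le_power)
        show "B\<^sup>2 / R\<^sup>2 \<le> 1" using RB B3 R by (simp add: divide_le_eq power_mono)
      qed (use R in simp)
      have ratio: "(B\<^sup>2 / R\<^sup>2) / (1 / R\<^sup>2) = B\<^sup>2" using R by simp
      have "2 * s \<le> \<phi> (B\<^sup>2 / R\<^sup>2)"
        using order_trans[OF mult_right_mono[OF B2, of s] scale[unfolded ratio, folded s_def]] s by simp
      then have le: "\<gamma> / \<phi> (B\<^sup>2 / R\<^sup>2) \<le> \<gamma> / (2 * s)"
        using s \<gamma> by (intro divide_left_mono mult_pos_pos) auto
      have "0 \<le> \<gamma> / \<phi> (B\<^sup>2 / R\<^sup>2)" using \<gamma> \<open>2 * s \<le> \<phi> (B\<^sup>2 / R\<^sup>2)\<close> s by simp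
      then have "real (time_scale \<phi> \<gamma> (R / B)) \<le> \<gamma> / \<phi> (B\<^sup>2 / R\<^sup>2)"
        by (simp add: time_scale_eq power_divide) 
      then show ?thesis using le by (simp add: X_def)
    qed
    define N where "N = time_scale \<phi> \<gamma> (sqrt b * R)"
    have N: "3 * X - 1 \<le> real N" "real N \<le> X * (c_up * b powr \<alpha>_up)"
    proof -
      have sq: "1 / (sqrt b * R)\<^sup>2 = 1 / (b * R\<^sup>2)" using b3 by (simp add: power_mult_distrib)
      define f where "f = \<phi> (1 / (b * R\<^sup>2))"
      have bR: "0 < 1 / (b * R\<^sup>2)" "1 / (b * R\<^sup>2) \<le> 1 / R\<^sup>2" "1 / R\<^sup>2 \<le> 1"
        using b3 R R2 by (auto simp: divide_simps)
      have f: "0 < f" unfolding f_def by (rule phi_pos[OF bR(1) order_trans[OF bR(2,3)]])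
      have ratio: "(1 / R\<^sup>2) / (1 / (b * R\<^sup>2)) = b" using R b3 by simp
      have "c_low * b powr \<alpha>_low * f \<le> s"
        using phi_scale_ge[OF bR] unfolding ratio s_def f_def .
      moreover have "3 * f \<le> c_low * b powr \<alpha>_low * f" using b2 f by (intro mult_right_mono) auto
      ultimately have f3: "3 * f \<le> s" by linarith
      have fs: "s \<le> c_up * b powr \<alpha>_up * f"
        using phi_scale_le[OF bR] unfolding ratio s_def f_def .
      have "3 * X = \<gamma> / (s / 3)" by (simp add: X_def)
      also have "\<dots> \<le> \<gamma> / f" using f3 f s \<gamma> by (intro divide_left_mono) auto
      finally have lo: "3 * X \<le> \<gamma> / f" .
      have "\<gamma> * s \<le> \<gamma> * (c_up * b powr \<alpha>_up * f)" using fs \<gamma> by (intro mult_left_mono) auto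
      then have up: "\<gamma> / f \<le> X * (c_up * b powr \<alpha>_up)"
        using f s by (simp add: X_def field_simps)
      have "N = nat \<lfloor>\<gamma> / f\<rfloor>" unfolding N_def time_scale_eq sq f_def ..
      then show "3 * X - 1 \<le> real N" "real N \<le> X * (c_up * b powr \<alpha>_up)"
        using lo up X by linarith+
    qed
    have klo: "X - 1 \<le> real k" and kup: "real k \<le> X + X / 2"
      using k tRB X unfolding tR B_def[symmetric] by auto linarith+
    define l where "l = N - k"
    have "real k \<le> real N" using kup N X2 by linarith
    then have Nl: "N = l + k" by (simp add: l_def)
    have llo: "X / 2 \<le> real l" using N(1) kup X2 Nl by simp
    have kN: "real k \<le> X * (c_up * b powr \<alpha>_up)" "real l \<le> X * (c_up * b powr \<alpha>_up)"
      using N(2) Nl by simp_all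
    have g2s: "X * (c_up * b powr \<alpha>_up) * s = \<gamma>2"
      unfolding \<gamma>2_def X(2)[symmetric] by (simp add: mult_ac)
    show "\<exists>l. time_scale \<phi> \<gamma> (sqrt (const_b c_low \<alpha>_low) * R) = l + k \<and>
       \<gamma> / 2 \<le> real l * \<phi> (1 / R\<^sup>2) \<and> real l * \<phi> (1 / R\<^sup>2) \<le> \<gamma>2 \<and>
       \<gamma> / 2 \<le> real k * \<phi> (1 / R\<^sup>2) \<and> real k * \<phi> (1 / R\<^sup>2) \<le> \<gamma>2"
    proof (rule exI[of _ l], unfold s_def[symmetric], intro conjI)
      show "time_scale \<phi> \<gamma> (sqrt (const_b c_low \<alpha>_low) * R) = l + k"
        using Nl by (simp add: N_def b_def)
      show "\<gamma> / 2 \<le> real l * s" using mult_right_mono[OF llo, of s] s X by simp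
      show "real l * s \<le> \<gamma>2" unfolding g2s[symmetric] using s by (intro mult_right_mono kN) auto
      have "X / 2 \<le> real k" using klo X2 by simp
      then show "\<gamma> / 2 \<le> real k * s" using mult_right_mono[of "X / 2" "real k" s] s X by simp
      show "real k * s \<le> \<gamma>2" unfolding g2s[symmetric] using s by (intro mult_right_mono kN) auto
    qed
  qed
qed

lemma parabolic_Harnack:
  assumes \<gamma>: "0 < \<gamma>"
  shows "\<exists>C>0. \<exists>R1>0. \<forall>R\<ge>R1. \<forall>z :: int ^ 'n. \<forall>q :: nat \<times> (int ^ 'n) \<Rightarrow> real.
     (\<forall>v. 0 \<le> q v) \<longrightarrow> parabolic \<mu> ({..time_scale \<phi> \<gamma> (sqrt (const_b c_low \<alpha>_low) * R)} \<times> UNIV) q \<longrightarrow>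
     (\<forall>v\<in>cylinder \<phi> \<gamma> (time_scale \<phi> \<gamma> R) (real_vec z) (R / const_B c_low \<alpha>_low).
      \<forall>w\<in>lattice_ball (real_vec z) (R / const_B c_low \<alpha>_low). q v \<le> C * q (0, w))"
proof -
  obtain \<gamma>2 R0 where g2: "0 < \<gamma>2" "1 \<le> R0" and ts: "\<forall>R\<ge>R0. \<forall>k. k \<in> {time_scale \<phi> \<gamma> R..time_scale \<phi> \<gamma> R + time_scale \<phi> \<gamma> (R / const_B c_low \<alpha>_low)} \<longrightarrow>
     (\<exists>l. time_scale \<phi> \<gamma> (sqrt (const_b c_low \<alpha>_low) * R) = l + k \<and>
       \<gamma> / 2 \<le> real l * \<phi> (1 / R\<^sup>2) \<and> real l * \<phi> (1 / R\<^sup>2) \<le> \<gamma>2 \<and>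
       \<gamma> / 2 \<le> real k * \<phi> (1 / R\<^sup>2) \<and> real k * \<phi> (1 / R\<^sup>2) \<le> \<gamma>2)"
    using time_scales[OF \<gamma>] by (elim exE conjE)
  have "0 < \<gamma> / 2" using \<gamma> by simp
  from walk_kernel_Harnack[OF this g2(1), where 'n='n]
  obtain C R0' where C: "0 < C" "1 \<le> R0'" and wk: "\<forall>R\<ge>R0'. \<forall>n k. \<forall>u v :: int ^ 'n.
     \<gamma> / 2 \<le> real n * \<phi> (1 / R\<^sup>2) \<longrightarrow> real n * \<phi> (1 / R\<^sup>2) \<le> \<gamma>2 \<longrightarrow>
     \<gamma> / 2 \<le> real k * \<phi> (1 / R\<^sup>2) \<longrightarrow> real k * \<phi> (1 / R\<^sup>2) \<le> \<gamma>2 \<longrightarrow>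
     (\<forall>i. real_of_int \<bar>u $ i\<bar> \<le> R) \<longrightarrow>
     walk_kernel n v \<le> ennreal C * walk_kernel (n + k) (v + u)"
    by (elim exE conjE)
  show ?thesis
  proof (rule exI[of _ C], rule conjI[OF C(1)], rule exI[of _ "max R0 R0'"], intro conjI allI impI ballI)
    show "0 < max R0 R0'" using C by simp
    fix R z and q :: "nat \<times> (int ^ 'n) \<Rightarrow> real" and v and w :: "int ^ 'n"
    assume R: "max R0 R0' \<le> R" and q0: "\<forall>v. 0 \<le> q v"
      and par: "parabolic \<mu> ({..time_scale \<phi> \<gamma> (sqrt (const_b c_low \<alpha>_low) * R)} \<times> UNIV) q"
      and v: "v \<in> cylinder \<phi> \<gamma> (time_scale \<phi> \<gamma> R) (real_vec z) (R / const_B c_low \<alpha>_low)"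
      and w: "w \<in> lattice_ball (real_vec z) (R / const_B c_low \<alpha>_low)"
    obtain k y where vk: "v = (k, y)" by (cases v)
    have k: "k \<in> {time_scale \<phi> \<gamma> R..time_scale \<phi> \<gamma> R + time_scale \<phi> \<gamma> (R / const_B c_low \<alpha>_low)}"
      and y: "y \<in> lattice_ball (real_vec z) (R / const_B c_low \<alpha>_low)"
      using v by (auto simp: vk cylinder_def)
    obtain l where l: "time_scale \<phi> \<gamma> (sqrt (const_b c_low \<alpha>_low) * R) = l + k"
       "\<gamma> / 2 \<le> real l * \<phi> (1 / R\<^sup>2)" "real l * \<phi> (1 / R\<^sup>2) \<le> \<gamma>2"
       "\<gamma> / 2 \<le> real k * \<phi> (1 / R\<^sup>2)" "real k * \<phi> (1 / R\<^sup>2) \<le> \<gamma>2"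
      using ts k R by auto
    have "3 \<le> const_B c_low \<alpha>_low" by (simp add: const_B_def)
    then have "2 * (R / const_B c_low \<alpha>_low) \<le> R" using R g2 by (simp add: field_simps)
    then have u: "real_of_int \<bar>(y - w) $ i\<bar> \<le> R" for i
      using abs_component_diff_le[OF y w, of i] by linarith
    show "q v \<le> C * q (0, w)" unfolding vk
    proof (rule parabolic_Harnack_of_kernel)
      show "parabolic \<mu> ({..l + k} \<times> UNIV) q" using par l by simp
      show "walk_kernel l v \<le> ennreal C * walk_kernel (l + k) (v + (y - w))" for v
        by (rule wk[rule_format]) (use R l u in auto)
    qed (use q0 C in auto)
  qed
qed

end

theorem theorem4p2:
  fixes \<phi> :: "real \<Rightarrow> real" and \<mu> :: "real measure"
    and c_low c_up \<alpha>_low \<alpha>_up \<gamma> :: real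
  assumes "complete_Bernstein_no_drift \<phi> \<mu>" and "\<phi> 0 = 0" and "\<phi> 1 = 1"
    and "0 < c_low" and "0 < c_up" and "0 < \<alpha>_low" and "\<alpha>_low \<le> \<alpha>_up" and "\<alpha>_up < 1"
    and "\<And>r R. 0 < r \<Longrightarrow> r \<le> R \<Longrightarrow> R \<le> 1 \<Longrightarrow>
           c_low * (R / r) powr \<alpha>_low \<le> \<phi> R / \<phi> r \<and> \<phi> R / \<phi> r \<le> c_up * (R / r) powr \<alpha>_up"
    and "0 < \<gamma>" and "\<gamma> < 1"
    and "\<And>(x :: int ^ 'n) r. 0 < r \<Longrightarrow>
           measure (walk_law \<mu> x)
             {s. (MAX k\<in>{..time_scale \<phi> \<gamma> r}. norm (real_vec (s k) - real_vec x)) \<ge> r / 2} \<le> 1 / 4"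
  shows "\<exists>C_PH > 0. \<exists>R\<^sub>1 > 0. \<forall>R \<ge> R\<^sub>1. \<forall>z :: int ^ 'n. \<forall>q :: nat \<times> (int ^ 'n) \<Rightarrow> real.
           (\<forall>v. 0 \<le> q v) \<longrightarrow> bounded (range q) \<longrightarrow>
           parabolic \<mu> ({..time_scale \<phi> \<gamma> (sqrt (const_b c_low \<alpha>_low) * R)} \<times> UNIV) q \<longrightarrow>
           (MAX v\<in>cylinder \<phi> \<gamma> (time_scale \<phi> \<gamma> R) (real_vec z) (R / const_B c_low \<alpha>_low). q v)
             \<le> C_PH * (MIN w\<in>lattice_ball (real_vec z) (R / const_B c_low \<alpha>_low). q (0, w))"
proof -
  interpret scaled_bernstein \<phi> \<mu> c_low c_up \<alpha>_low \<alpha>_up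
    using assms(1,3-9) by unfold_locales auto
  obtain C R1 where C: "0 < C" "0 < R1" and harnack: "\<forall>R\<ge>R1. \<forall>z :: int ^ 'n. \<forall>q :: nat \<times> (int ^ 'n) \<Rightarrow> real.
     (\<forall>v. 0 \<le> q v) \<longrightarrow> parabolic \<mu> ({..time_scale \<phi> \<gamma> (sqrt (const_b c_low \<alpha>_low) * R)} \<times> UNIV) q \<longrightarrow>
     (\<forall>v\<in>cylinder \<phi> \<gamma> (time_scale \<phi> \<gamma> R) (real_vec z) (R / const_B c_low \<alpha>_low).
      \<forall>w\<in>lattice_ball (real_vec z) (R / const_B c_low \<alpha>_low). q v \<le> C * q (0, w))"
    using parabolic_Harnack[OF \<open>0 < \<gamma>\<close>, where 'n='n] by (elim exE conjE)
  show ?thesis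
  proof (rule exI[of _ C], rule conjI[OF C(1)], rule exI[of _ R1], rule conjI[OF C(2)], intro allI impI)
    fix R and z :: "int ^ 'n" and q :: "nat \<times> (int ^ 'n) \<Rightarrow> real"
    assume R: "R1 \<le> R" and q0: "\<forall>v. 0 \<le> q v"
      and par: "parabolic \<mu> ({..time_scale \<phi> \<gamma> (sqrt (const_b c_low \<alpha>_low) * R)} \<times> UNIV) q"
    let ?ball = "lattice_ball (real_vec z) (R / const_B c_low \<alpha>_low)"
    let ?cyl = "cylinder \<phi> \<gamma> (time_scale \<phi> \<gamma> R) (real_vec z) (R / const_B c_low \<alpha>_low)"
    have "3 \<le> const_B c_low \<alpha>_low" by (simp add: const_B_def)
    then have z: "z \<in> ?ball" using R C by (intro centre_in_lattice_ball divide_pos_pos) auto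
    have fin: "finite ?ball" "finite ?cyl" by (auto simp: cylinder_def finite_lattice_ball)
    have "(time_scale \<phi> \<gamma> R, z) \<in> ?cyl" using z by (simp add: cylinder_def)
    then have ne: "?cyl \<noteq> {}" by blast
    have "(MIN w\<in>?ball. q (0, w)) \<in> (\<lambda>w. q (0, w)) ` ?ball"
      using fin z by (intro Min_in) auto
    then obtain w where w: "w \<in> ?ball" "(MIN w\<in>?ball. q (0, w)) = q (0, w)" by blast
    have "q v \<le> C * q (0, w)" if "v \<in> ?cyl" for v
      using harnack R q0 par w(1) that by blast
    then show "(MAX v\<in>?cyl. q v) \<le> C * (MIN w\<in>?ball. q (0, w))"
      unfolding w(2) using fin ne by (subst Max_le_iff) auto
  qed
qed

end
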